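(* Let $(\mathfrak{p}_n)_{n\in\mathbb{N}}$ be a sequence of positive numbers tending to $0$ and let $N_0$ be a ground state of (KP I) such that $N_{\mathfrak{p}_n}\to N_0$ in $W^{k,q}(\mathbb{R}^2)$ as $n\to+\infty$, for any $k\in\mathbb{N}$ and any $1<q\leq+\infty$. Then, passing possibly to a further subsequence, $$\partial_1\Theta_{\mathfrak{p}_n}\to N_0\quad\text{in } W^{k,q}(\mathbb{R}^2),\quad\text{as } n\to+\infty,$$ for any $k\in\mathbb{N}$ and any $1<q\leq+\infty$.
   Context: **Gross-Pitaevskii travelling waves.** $\langle\cdot,\cdot\rangle$ is the real scalar product on $\mathbb{C}\simeq\mathbb{R}^2$. The Ginzburg-Landau energy of $v:\mathbb{R}^2\to\mathbb{C}$ is $E(v) = \frac12\int_{\mathbb{R}^2}|\nabla v|^2 + \frac14\int_{\mathbb{R}^2}(1-|v|^2)^2$. Let $W(\mathbb{R}^2) = \{1\}+V(\mathbb{R}^2)$, where $V(\mathbb{R}^2)$ is the set of $v:\mathbb{R}^2\to\mathbb{C}$ with $\nabla v, \mathrm{Re}(v)\in L^2(\mathbb{R}^2)$, $\mathrm{Im}(v)\in L^4(\mathbb{R}^2)$, $\nabla \mathrm{Re}(v)\in L^{4/3}(\mathbb{R}^2)$. The momentum of $v\in W(\mathbb{R}^2)$ is $p(v)=\frac12\int_{\mathbb{R}^2}\langle i\partial_1 v, v-1\rangle$. The travelling wave equation of speed $c$ is (TWc): $ic\,\partial_1 u+\Delta u+u(1-|u|^2)=0$ on $\mathbb{R}^2$.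 **The family $u_{\mathfrak{p}}$.** It is known that for every $\mathfrak{p}>0$ there is a non-constant finite energy solution $u_{\mathfrak{p}}\in W(\mathbb{R}^2)$ of (TWc) with some speed $c=c(u_{\mathfrak{p}})\in(0,\sqrt2)$, with $p(u_{\mathfrak{p}})=\mathfrak{p}$ and $E(u_{\mathfrak{p}})=E_{\min}(\mathfrak{p})=\inf\{E(v): v\in W(\mathbb{R}^2),\ p(v)=\mathfrak{p}\}$. One such $u_{\mathfrak{p}}$ is fixed for each $\mathfrak{p}$, translated so that $\eta_{\mathfrak{p}}=1-|u_{\mathfrak{p}}|^2$ achieves its maximum at the origin, i.e. $\|\eta_{\mathfrak{p}}\|_{L^\infty(\mathbb{R}^2)}=|\eta_{\mathfrak{p}}(0)|$. Set $\varepsilon_{\mathfrak{p}}=\sqrt{2-c(u_{\mathfrak{p}})^2}$. For $\mathfrak{p}$ sufficiently small, it is known that $\frac12\le|u_{\mathfrak{p}}|\le2$, so $u_{\mathfrak{p}}=\varrho_{\mathfrak{p}}\exp i\varphi_{\mathfrak{p}}$ with $\varrho_{\mathfrak p}=|u_{\mathfrak p}|$ and $\varphi_{\mathfrak{p}}$ smooth and real-valued (unique modulo $2\pi$). Set $$N_{\mathfrak{p}}(x)=\frac{6}{\varepsilon_{\mathfrak{p}}^2}\,\eta_{\mathfrak{p}}\Big(\frac{x_1}{\varepsilon_{\mathfrak{p}}},\frac{\sqrt2\,x_2}{\varepsilon_{\mathfrak{p}}^2}\Big),\qquad \Theta_{\mathfrak{p}}(x)=\frac{6\sqrt2}{\varepsilon_{\mathfrak{p}}}\,\varphi_{\mathfrak{p}}\Big(\frac{x_1}{\varepsilon_{\mathfrak{p}}},\frac{\sqrt2\,x_2}{\varepsilon_{\mathfrak{p}}^2}\Big).$$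 **KP I.** (KP I) is $\partial_t\psi+\psi\partial_1\psi+\partial_1^3\psi-\partial_1^{-1}(\partial_2^2\psi)=0$. The energy space $Y(\mathbb{R}^2)$ is the closure of $\partial_1 C_c^\infty(\mathbb{R}^2)$ for the norm $\|\partial_1 f\|_{Y}=(\|\nabla f\|_{L^2}^2+\|\partial_1^2 f\|_{L^2}^2)^{1/2}$; for $w\in Y(\mathbb{R}^2)$, $\partial_1^{-1}\partial_2 w\in L^2(\mathbb{R}^2)$ is defined by continuity from $\partial_1^{-1}\partial_2(\partial_1 f)=\partial_2 f$. A solitary wave of speed $\sigma$ is a $w\in Y(\mathbb{R}^2)$ solving $\sigma\partial_1 w-w\partial_1 w-\partial_1^3 w+\partial_1^{-1}(\partial_2^2 w)=0$. The Hamiltonian is $E_{KP}(w)=\frac12\int(\partial_1 w)^2+\frac12\int(\partial_1^{-1}\partial_2 w)^2-\frac16\int w^3$ and the action (for speed $\sigma$) is $S(w)=E_{KP}(w)+\frac\sigma2\int w^2$. A ground state (of speed $\sigma$) is a solitary wave minimizing $S$ among all non-constant solitary waves of speed $\sigma$. *)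

theory Defs
  imports "HOL-Probability.Essential_Supremum"
begin

type_synonym R2 = "real \<times> real"

section \<open>Smooth functions and test functions on the plane\<close>

abbreviation e1 :: R2 where "e1 \<equiv> (1, 0)"
abbreviation e2 :: R2 where "e2 \<equiv> (0, 1)"

definition partial :: "R2 \<Rightarrow> (R2 \<Rightarrow> 'b::euclidean_space) \<Rightarrow> R2 \<Rightarrow> 'b" where
  "partial e f x = frechet_derivative f (at x) e"

primrec Ck :: "nat \<Rightarrow> (R2 \<Rightarrow> 'b::euclidean_space) \<Rightarrow> bool" where
  "Ck 0 f \<longleftrightarrow> continuous_on UNIV f"
| "Ck (Suc k) f \<longleftrightarrow>
     (\<forall>x. f differentiable (at x)) \<and> Ck k (partial e1 f) \<and> Ck k (partial e2 f)"

definition smooth :: "(R2 \<Rightarrow> 'b::euclidean_space) \<Rightarrow> bool" where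
  "smooth f \<longleftrightarrow> (\<forall>k. Ck k f)"

text \<open>A multi-index \<open>(i, j)\<close> stands for \<open>i\<close> derivatives in the first and \<open>j\<close> in the second variable.\<close>

definition multi_partial :: "nat \<times> nat \<Rightarrow> (R2 \<Rightarrow> 'b::euclidean_space) \<Rightarrow> R2 \<Rightarrow> 'b" where
  "multi_partial \<alpha> f = (partial e1 ^^ fst \<alpha>) ((partial e2 ^^ snd \<alpha>) f)"

definition test_fun :: "(R2 \<Rightarrow> real) \<Rightarrow> bool" where
  "test_fun \<psi> \<longleftrightarrow> smooth \<psi> \<and> compact (closure {x. \<psi> x \<noteq> 0})"

section \<open>Lebesgue and Sobolev spaces\<close>

text \<open>Elements of these spaces are represented by functions; all the notions below are
  insensitive to changes on null sets.\<close>

definition Lq :: "ereal \<Rightarrow> (R2 \<Rightarrow> 'b::euclidean_space) set" where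
  "Lq q = {f \<in> borel_measurable lebesgue.
     if q = \<infinity> then esssup lebesgue (\<lambda>x. ereal (norm (f x))) < \<infinity>
     else integrable lebesgue (\<lambda>x. norm (f x) powr real_of_ereal q)}"

text \<open>Meaningful on \<open>Lq q\<close> only.\<close>

definition Lq_norm :: "ereal \<Rightarrow> (R2 \<Rightarrow> 'b::euclidean_space) \<Rightarrow> real" where
  "Lq_norm q f =
    (if q = \<infinity> then real_of_ereal (esssup lebesgue (\<lambda>x. ereal (norm (f x))))
     else (LINT x|lebesgue. norm (f x) powr real_of_ereal q) powr (1 / real_of_ereal q))"

definition locally_integrable :: "(R2 \<Rightarrow> 'b::euclidean_space) \<Rightarrow> bool" where
  "locally_integrable f \<longleftrightarrow> (\<forall>K. compact K \<longrightarrow> set_integrable lebesgue K f)"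

definition is_weak_deriv ::
    "nat \<times> nat \<Rightarrow> (R2 \<Rightarrow> 'b::euclidean_space) \<Rightarrow> (R2 \<Rightarrow> 'b) \<Rightarrow> bool" where
  "is_weak_deriv \<alpha> f g \<longleftrightarrow> locally_integrable f \<and> locally_integrable g \<and>
     (\<forall>\<psi>. test_fun \<psi> \<longrightarrow>
        (LINT x|lebesgue. multi_partial \<alpha> \<psi> x *\<^sub>R f x) =
        (- 1) ^ (fst \<alpha> + snd \<alpha>) *\<^sub>R (LINT x|lebesgue. \<psi> x *\<^sub>R g x))"

text \<open>The weak derivative, unique up to null sets when it exists.\<close>

definition weak_deriv ::
    "nat \<times> nat \<Rightarrow> (R2 \<Rightarrow> 'b::euclidean_space) \<Rightarrow> R2 \<Rightarrow> 'b" where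
  "weak_deriv \<alpha> f = (SOME g. is_weak_deriv \<alpha> f g)"

definition deriv_in_Lq :: "nat \<times> nat \<Rightarrow> ereal \<Rightarrow> (R2 \<Rightarrow> 'b::euclidean_space) \<Rightarrow> bool" where
  "deriv_in_Lq \<alpha> q f \<longleftrightarrow> (\<exists>g. is_weak_deriv \<alpha> f g \<and> g \<in> Lq q)"

definition Wkq :: "nat \<Rightarrow> ereal \<Rightarrow> (R2 \<Rightarrow> 'b::euclidean_space) set" where
  "Wkq k q = {f. \<forall>\<alpha>. fst \<alpha> + snd \<alpha> \<le> k \<longrightarrow> deriv_in_Lq \<alpha> q f}"

definition Wkq_norm :: "nat \<Rightarrow> ereal \<Rightarrow> (R2 \<Rightarrow> 'b::euclidean_space) \<Rightarrow> real" where
  "Wkq_norm k q f = (\<Sum>\<alpha> | fst \<alpha> + snd \<alpha> \<le> k. Lq_norm q (weak_deriv \<alpha> f))"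

definition Wkq_tendsto ::
    "nat \<Rightarrow> ereal \<Rightarrow> (nat \<Rightarrow> R2 \<Rightarrow> 'b::euclidean_space) \<Rightarrow> (R2 \<Rightarrow> 'b) \<Rightarrow> bool" where
  "Wkq_tendsto k q F f \<longleftrightarrow> (\<forall>\<^sub>F n in sequentially. F n \<in> Wkq k q) \<and> f \<in> Wkq k q \<and>
     (\<lambda>n. Wkq_norm k q (\<lambda>x. F n x - f x)) \<longlonglongrightarrow> 0"

definition Lq_tendsto ::
    "ereal \<Rightarrow> (nat \<Rightarrow> R2 \<Rightarrow> 'b::euclidean_space) \<Rightarrow> (R2 \<Rightarrow> 'b) \<Rightarrow> bool" where
  "Lq_tendsto q F f \<longleftrightarrow> (\<forall>\<^sub>F n in sequentially. F n \<in> Lq q) \<and> f \<in> Lq q \<and>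
     (\<lambda>n. Lq_norm q (\<lambda>x. F n x - f x)) \<longlonglongrightarrow> 0"

section \<open>Gross-Pitaevskii travelling waves\<close>

definition GL_energy :: "(R2 \<Rightarrow> complex) \<Rightarrow> ennreal" where
  "GL_energy v =
     1 / 2 * (\<integral>\<^sup>+ x. ennreal ((cmod (weak_deriv (1, 0) v x))\<^sup>2
                           + (cmod (weak_deriv (0, 1) v x))\<^sup>2) \<partial>lebesgue)
   + 1 / 4 * (\<integral>\<^sup>+ x. ennreal ((1 - (cmod (v x))\<^sup>2)\<^sup>2) \<partial>lebesgue)"

definition V_space :: "(R2 \<Rightarrow> complex) set" where
  "V_space = {v. (\<forall>\<alpha> \<in> {(1, 0), (0, 1)}.
                    deriv_in_Lq \<alpha> 2 v \<and> deriv_in_Lq \<alpha> (4 / 3) (\<lambda>x. Re (v x))) \<and>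
                 (\<lambda>x. Re (v x)) \<in> Lq 2 \<and> (\<lambda>x. Im (v x)) \<in> Lq 4}"

definition W_space :: "(R2 \<Rightarrow> complex) set" where
  "W_space = {v. (\<lambda>x. v x - 1) \<in> V_space}"

definition momentum :: "(R2 \<Rightarrow> complex) \<Rightarrow> real" where
  "momentum v = 1 / 2 * (LINT x|lebesgue. (\<i> * weak_deriv (1, 0) v x) \<bullet> (v x - 1))"

definition E_min :: "real \<Rightarrow> ennreal" where
  "E_min \<pp> = Inf {GL_energy v | v. v \<in> W_space \<and> momentum v = \<pp>}"

definition TW_solution :: "real \<Rightarrow> (R2 \<Rightarrow> complex) \<Rightarrow> bool" where
  "TW_solution c u \<longleftrightarrow> smooth u \<and>
     (\<forall>x. \<i> * of_real c * partial e1 u x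
        + (partial e1 (partial e1 u) x + partial e2 (partial e2 u) x)
        + u x * of_real (1 - (cmod (u x))\<^sup>2) = 0)"

definition eta :: "(R2 \<Rightarrow> complex) \<Rightarrow> R2 \<Rightarrow> real" where
  "eta u x = 1 - (cmod (u x))\<^sup>2"

definition GP_minimizer :: "real \<Rightarrow> real \<Rightarrow> (R2 \<Rightarrow> complex) \<Rightarrow> bool" where
  "GP_minimizer \<pp> c u \<longleftrightarrow>
     u \<in> W_space \<and> GL_energy u < \<infinity> \<and> \<not> u constant_on UNIV \<and>
     0 < c \<and> c < sqrt 2 \<and> TW_solution c u \<and>
     momentum u = \<pp> \<and> GL_energy u = E_min \<pp> \<and>
     eta u \<in> Lq \<infinity> \<and> Lq_norm \<infinity> (eta u) = \<bar>eta u 0\<bar>"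

definition phase_of :: "(R2 \<Rightarrow> real) \<Rightarrow> (R2 \<Rightarrow> complex) \<Rightarrow> bool" where
  "phase_of \<phi> u \<longleftrightarrow>
     smooth \<phi> \<and> (\<forall>x. u x = of_real (cmod (u x)) * exp (\<i> * of_real (\<phi> x)))"

definition eps :: "real \<Rightarrow> real" where
  "eps c = sqrt (2 - c\<^sup>2)"

definition rescale :: "real \<Rightarrow> R2 \<Rightarrow> R2" where
  "rescale \<epsilon> x = (fst x / \<epsilon>, sqrt 2 * snd x / \<epsilon>\<^sup>2)"

definition N_resc :: "real \<Rightarrow> (R2 \<Rightarrow> complex) \<Rightarrow> R2 \<Rightarrow> real" where
  "N_resc c u x = 6 / (eps c)\<^sup>2 * eta u (rescale (eps c) x)"

definition Theta_resc :: "real \<Rightarrow> (R2 \<Rightarrow> real) \<Rightarrow> R2 \<Rightarrow> real" where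
  "Theta_resc c \<phi> x = 6 * sqrt 2 / eps c * \<phi> (rescale (eps c) x)"

section \<open>Solitary waves of the KP I equation\<close>

text \<open>The \<open>Y\<close>-norm of \<open>partial e1 f\<close>, for \<open>f\<close> a test function; \<open>f\<close> is determined by
  \<open>partial e1 f\<close> since its support is compact.\<close>

definition Y_norm_d1 :: "(R2 \<Rightarrow> real) \<Rightarrow> real" where
  "Y_norm_d1 f = sqrt ((Lq_norm 2 (partial e1 f))\<^sup>2 + (Lq_norm 2 (partial e2 f))\<^sup>2
                        + (Lq_norm 2 (partial e1 (partial e1 f)))\<^sup>2)"

text \<open>\<open>w\<close> is the limit of \<open>partial e1 (f n)\<close> in the completion for the \<open>Y\<close>-norm, which is
  realised as a space of square integrable functions.\<close>

definition Y_approx :: "(nat \<Rightarrow> R2 \<Rightarrow> real) \<Rightarrow> (R2 \<Rightarrow> real) \<Rightarrow> bool" where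
  "Y_approx f w \<longleftrightarrow> (\<forall>n. test_fun (f n)) \<and>
     (\<forall>e>0. \<exists>M. \<forall>m\<ge>M. \<forall>n\<ge>M. Y_norm_d1 (\<lambda>x. f m x - f n x) < e) \<and>
     Lq_tendsto 2 (\<lambda>n. partial e1 (f n)) w"

definition Y_space :: "(R2 \<Rightarrow> real) set" where
  "Y_space = {w. \<exists>f. Y_approx f w}"

text \<open>The operator \<open>\<partial>\<^sub>1\<^sup>-\<^sup>1 \<partial>\<^sub>2\<close> on \<open>Y_space\<close>; its value is unique up to null sets.\<close>

definition inv_d1_d2 :: "(R2 \<Rightarrow> real) \<Rightarrow> R2 \<Rightarrow> real" where
  "inv_d1_d2 w = (SOME g. \<exists>f. Y_approx f w \<and> Lq_tendsto 2 (\<lambda>n. partial e2 (f n)) g)"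

text \<open>The equation
  \<open>\<sigma> \<partial>\<^sub>1 w - w \<partial>\<^sub>1 w - \<partial>\<^sub>1\<^sup>3 w + \<partial>\<^sub>1\<^sup>-\<^sup>1 (\<partial>\<^sub>2\<^sup>2 w) = 0\<close>
  is understood in the sense of distributions, with
  \<open>\<partial>\<^sub>1\<^sup>-\<^sup>1 (\<partial>\<^sub>2\<^sup>2 w) = \<partial>\<^sub>2 (\<partial>\<^sub>1\<^sup>-\<^sup>1 \<partial>\<^sub>2 w)\<close>.\<close>

definition solitary_wave :: "real \<Rightarrow> (R2 \<Rightarrow> real) \<Rightarrow> bool" where
  "solitary_wave \<sigma> w \<longleftrightarrow> w \<in> Y_space \<and>
     (\<forall>\<psi>. test_fun \<psi> \<longrightarrow>
        (LINT x|lebesgue. \<sigma> * weak_deriv (1, 0) w x * \<psi> x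
                        - w x * weak_deriv (1, 0) w x * \<psi> x
                        + w x * multi_partial (3, 0) \<psi> x
                        - inv_d1_d2 w x * partial e2 \<psi> x) = 0)"

definition KP_energy :: "(R2 \<Rightarrow> real) \<Rightarrow> real" where
  "KP_energy w = 1 / 2 * (LINT x|lebesgue. (weak_deriv (1, 0) w x)\<^sup>2)
               + 1 / 2 * (LINT x|lebesgue. (inv_d1_d2 w x)\<^sup>2)
               - 1 / 6 * (LINT x|lebesgue. (w x) ^ 3)"

definition KP_action :: "real \<Rightarrow> (R2 \<Rightarrow> real) \<Rightarrow> real" where
  "KP_action \<sigma> w = KP_energy w + \<sigma> / 2 * (LINT x|lebesgue. (w x)\<^sup>2)"

definition nonconstant_ae :: "(R2 \<Rightarrow> real) \<Rightarrow> bool" where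
  "nonconstant_ae w \<longleftrightarrow> \<not> (\<exists>a. AE x in lebesgue. w x = a)"

definition ground_state :: "real \<Rightarrow> (R2 \<Rightarrow> real) \<Rightarrow> bool" where
  "ground_state \<sigma> w \<longleftrightarrow> solitary_wave \<sigma> w \<and> nonconstant_ae w \<and>
     (\<forall>v. solitary_wave \<sigma> v \<and> nonconstant_ae v \<longrightarrow> KP_action \<sigma> w \<le> KP_action \<sigma> v)"

end

theory Submission imports Defs begin

text \<open>
  Let \<open>U\<close> be the rescaled travelling wave, \<open>\<Phi>\<close> its phase, so that
  \<open>\<partial>\<^sub>1 \<Theta> = (6 sqrt 2 / \<epsilon>) \<partial>\<^sub>1 \<Phi>\<close>, and \<open>\<bar>U\<bar>\<^sup>2 = 1 - \<epsilon>\<^sup>2 N / 6\<close>.  Written for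
  \<open>ln U = ln \<bar>U\<bar> + \<i> \<Phi>\<close>, the travelling wave equation splits into two real equations
  (\<open>polar_equations\<close>).  With \<open>z1 = \<partial>\<^sub>1 \<Phi>\<close> and \<open>z2 = (\<epsilon> / sqrt 2) \<partial>\<^sub>2 \<Phi>\<close> the real part is
  \<open>(c / sqrt 2) \<partial>\<^sub>1 \<Theta> = N + 6 A - 6 (z1\<^sup>2 + z2\<^sup>2)\<close>, where \<open>A\<close> is explicit in \<open>N\<close> and carries a factor
  \<open>\<epsilon>\<^sup>2\<close>.  Hence \<open>\<partial>\<^sub>1 \<Theta> - N\<close> is small in every Sobolev space as soon as \<open>\<epsilon>\<close> tends to \<open>0\<close> and the
  quadratic term is small, and for the latter it is enough that \<open>z1\<close>, \<open>z2\<close> and all their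
  derivatives tend to \<open>0\<close> both in \<open>L\<^sup>2\<close> and uniformly.

  All the smallness comes from the energy.  The momentum is quadratic in \<open>v - 1\<close>; dilating the fixed
  minimizer of momentum \<open>1\<close> about the constant \<open>1\<close> shows that the minimal energy at momentum \<open>\<pp>\<close> is
  \<open>O(\<pp>)\<close> (\<open>E_min_le_linear\<close>).  The change of scale gives \<open>\<epsilon> \<integral> N\<^sup>2 = (36 / sqrt 2) \<integral> \<eta>\<^sup>2\<close>, and
  \<open>\<integral> N\<^sup>2\<close> stays away from \<open>0\<close> because the ground state is not constant; so \<open>\<epsilon>\<close> tends to \<open>0\<close>.
  As \<open>N\<close> is uniformly bounded, \<open>\<bar>u\<bar>\<close> then tends to \<open>1\<close> uniformly and the phase exists after
  finitely many terms: dropping these is the only use made of a subsequence.  Finally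
  \<open>\<integral> z1\<^sup>2\<close> and \<open>\<integral> z2\<^sup>2\<close> are at most \<open>8 \<epsilon>\<close> times the energy.

  Derivatives of \<open>z1\<close> and \<open>z2\<close> are controlled by the imaginary part, a linear elliptic equation
  \<open>\<partial>\<^sub>1 z1 + (\<epsilon> / sqrt 2) \<partial>\<^sub>2 z2 = \<epsilon> (f + b z1 + d z2)\<close> with \<open>f\<close>, \<open>b\<close>, \<open>d\<close> bounded in terms of \<open>N\<close>.
  Testing it with the unknown times a cut-off function (\<open>energy_estimate\<close>) bounds the gradient, and
  differentiating the equation preserves its form, so an induction on the number of derivatives
  (\<open>jets_energy_null\<close>) reaches every order in \<open>L\<^sup>2\<close>; the Sobolev inequality \<open>sobolev_2d\<close> turns this
  into uniform smallness.

  The Sobolev spaces are defined through weak derivatives.  The fundamental lemma of the calculus of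
  variations (\<open>AE_zero_if_test_integrals_zero\<close>) makes these unique, so that for smooth sequences
  convergence can be read off classical derivatives (\<open>Wkq_tendsto_smooth_iff\<close>).
\<close>

section \<open>Calculus of smooth functions on the plane\<close>

(* Points of the plane are handled as single variables, not as pairs of coordinates. *)
declare split_paired_All [simp del] split_paired_Ex [simp del]

lemma differentiable_continuous:
  fixes f :: "R2 \<Rightarrow> 'b::euclidean_space"
  shows "(\<And>x. f differentiable (at x)) \<Longrightarrow> continuous_on UNIV f"
  by (simp add: continuous_on_eq_continuous_at differentiable_imp_continuous_within)

lemma partial_eq: "(f has_derivative D) (at x) \<Longrightarrow> partial e f x = D e"
  unfolding partial_def using frechet_derivative_at by metis

lemma has_derivative_partial:
  assumes "f differentiable (at x)"
  shows "(f has_derivative (\<lambda>h. fst h *\<^sub>R partial e1 f x + snd h *\<^sub>R partial e2 f x)) (at x)"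
proof -
  let ?D = "frechet_derivative f (at x)"
  have D: "(f has_derivative ?D) (at x)"
    using assms frechet_derivative_works by blast
  then interpret bounded_linear ?D by (rule has_derivative_bounded_linear)
  have "?D h = fst h *\<^sub>R partial e1 f x + snd h *\<^sub>R partial e2 f x" for h
  proof -
    have "h = fst h *\<^sub>R e1 + snd h *\<^sub>R e2" by (cases h) simp
    then show ?thesis by (metis add scale partial_def)
  qed
  then have "?D = (\<lambda>h. fst h *\<^sub>R partial e1 f x + snd h *\<^sub>R partial e2 f x)" by blast
  with D show ?thesis by simp
qed

lemma Ck_continuous: "Ck k f \<Longrightarrow> continuous_on UNIV f"
  by (cases k) (auto intro: differentiable_continuous)

lemma Ck_Suc_imp: "Ck (Suc k) f \<Longrightarrow> Ck k f"
proof (induction k arbitrary: f)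
  case 0
  then show ?case using Ck_continuous[of "Suc 0" f] by simp
next
  case (Suc k)
  from Suc.prems have d: "\<And>x. f differentiable (at x)"
    and p: "Ck (Suc k) (partial e1 f)" "Ck (Suc k) (partial e2 f)"
    unfolding Ck.simps(2)[of "Suc k"] by blast+
  show ?case unfolding Ck.simps(2) by (intro conjI allI d Suc.IH p)
qed

lemma smooth_rec:
  "smooth f \<longleftrightarrow> (\<forall>x. f differentiable (at x)) \<and> smooth (partial e1 f) \<and> smooth (partial e2 f)"
proof
  assume "smooth f"
  then have "Ck (Suc k) f" for k unfolding smooth_def by blast
  then show "(\<forall>x. f differentiable (at x)) \<and> smooth (partial e1 f) \<and> smooth (partial e2 f)"
    by (simp add: smooth_def)
next
  assume *: "(\<forall>x. f differentiable (at x)) \<and> smooth (partial e1 f) \<and> smooth (partial e2 f)"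
  then have "Ck (Suc k) f" for k unfolding smooth_def Ck.simps(2) by blast
  then show "smooth f" unfolding smooth_def using Ck_Suc_imp by blast
qed

lemma smooth_differentiable: "smooth f \<Longrightarrow> f differentiable (at x)"
  using smooth_rec by blast

lemma smooth_partial: "smooth f \<Longrightarrow> e = e1 \<or> e = e2 \<Longrightarrow> smooth (partial e f)"
  using smooth_rec by blast

lemma smooth_partial1 [intro]: "smooth f \<Longrightarrow> smooth (partial e1 f)"
  and smooth_partial2 [intro]: "smooth f \<Longrightarrow> smooth (partial e2 f)"
  using smooth_rec by blast+

lemma smooth_continuous: "smooth f \<Longrightarrow> continuous_on UNIV f"
  using Ck_continuous smooth_def by blast

lemma smooth_borel : "smooth f \<Longrightarrow> f \<in> borel_measurable borel"
  by (rule borel_measurable_continuous_onI[OF smooth_continuous])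

lemma smooth_coinduct:
  assumes f: "f \<in> S"
    and diff: "\<And>g x. g \<in> S \<Longrightarrow> g differentiable (at x)"
    and part: "\<And>g. g \<in> S \<Longrightarrow> partial e1 g \<in> S \<and> partial e2 g \<in> S"
  shows "smooth f"
proof -
  have "Ck k g" if "g \<in> S" for k g
    using that
  proof (induction k arbitrary: g)
    case 0
    then show ?case
      using diff by (auto intro: differentiable_continuous)
  qed (use diff part in auto)
  with f show ?thesis by (simp add: smooth_def)
qed

lemma differentiable_bounded_linear:
  "bounded_linear h \<Longrightarrow> f differentiable F \<Longrightarrow> (\<lambda>x. h (f x)) differentiable F"
  unfolding differentiable_def by (blast intro: bounded_linear.has_derivative)

lemma differentiable_bounded_bilinear:
  "bounded_bilinear h \<Longrightarrow> f differentiable (at x) \<Longrightarrow> g differentiable (at x)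
    \<Longrightarrow> (\<lambda>x. h (f x) (g x)) differentiable (at x)"
  unfolding differentiable_def by (blast intro: bounded_bilinear.FDERIV)

lemma partial_bilinear:
  assumes "bounded_bilinear h" "f differentiable (at x)" "g differentiable (at x)"
  shows "partial e (\<lambda>x. h (f x) (g x)) x = h (f x) (partial e g x) + h (partial e f x) (g x)"
  using partial_eq[OF bounded_bilinear.FDERIV[OF assms(1)
        assms(2)[unfolded frechet_derivative_works] assms(3)[unfolded frechet_derivative_works]]]
  by (simp add: partial_def)

lemma partial_linear:
  assumes "bounded_linear h" "f differentiable (at x)"
  shows "partial e (\<lambda>x. h (f x)) x = h (partial e f x)"
  using partial_eq[OF bounded_linear.has_derivative[OF assms(1)
        assms(2)[unfolded frechet_derivative_works]]]
  by (simp add: partial_def)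

lemma partial_add:
  assumes "f differentiable (at x)" "g differentiable (at x)"
  shows "partial e (\<lambda>x. f x + g x) x = partial e f x + partial e g x"
  using partial_eq[OF has_derivative_add[OF assms(1)[unfolded frechet_derivative_works]
        assms(2)[unfolded frechet_derivative_works]]]
  by (simp add: partial_def)

lemma partial_diff:
  assumes "f differentiable (at x)" "g differentiable (at x)"
  shows "partial e (\<lambda>x. f x - g x) x = partial e f x - partial e g x"
  using partial_eq[OF has_derivative_diff[OF assms(1)[unfolded frechet_derivative_works]
        assms(2)[unfolded frechet_derivative_works]]]
  by (simp add: partial_def)

lemma partial_const: "partial e (\<lambda>x. c) = (\<lambda>x. 0)"
  using partial_eq[OF has_derivative_const] by blast

lemma smooth_const [simp]: "smooth (\<lambda>x. c)"
proof (rule smooth_coinduct[where S = "range (\<lambda>c x. c)"])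
  show "(\<lambda>x. c) \<in> range (\<lambda>c x. c)" by blast
qed (auto simp: partial_const)

lemma Ck_add: "Ck k f \<Longrightarrow> Ck k g \<Longrightarrow> Ck k (\<lambda>x. f x + g x)"
proof (induction k arbitrary: f g)
  case (Suc k)
  then have "partial e (\<lambda>x. f x + g x) = (\<lambda>x. partial e f x + partial e g x)" for e
    using partial_add by fastforce
  with Suc show ?case by simp
qed (simp add: continuous_on_add)

lemma Ck_linear: "bounded_linear h \<Longrightarrow> Ck k f \<Longrightarrow> Ck k (\<lambda>x. h (f x))"
proof (induction k arbitrary: f)
  case (Suc k)
  then have "partial e (\<lambda>x. h (f x)) = (\<lambda>x. h (partial e f x))" for e
    using partial_linear by fastforce
  with Suc show ?case
    by (simp add: differentiable_bounded_linear)
qed (simp add: bounded_linear.continuous_on)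

lemma Ck_bilinear: "bounded_bilinear h \<Longrightarrow> Ck k f \<Longrightarrow> Ck k g \<Longrightarrow> Ck k (\<lambda>x. h (f x) (g x))"
proof (induction k arbitrary: f g)
  case (Suc k)
  then have P: "partial e (\<lambda>x. h (f x) (g x)) =
      (\<lambda>x. h (f x) (partial e g x) + h (partial e f x) (g x))" for e
    using partial_bilinear by fastforce
  have "(\<lambda>x. h (f x) (g x)) differentiable (at x)" for x
    by (rule differentiable_bounded_bilinear[OF Suc.prems(1)]) (use Suc.prems in auto)
  moreover have "Ck k f" "Ck k g" using Suc.prems Ck_Suc_imp by blast+
  moreover have "Ck k (partial e1 f)" "Ck k (partial e2 f)" "Ck k (partial e1 g)" "Ck k (partial e2 g)"
    using Suc.prems by auto
  ultimately show ?case
    unfolding Ck.simps(2) P by (intro conjI allI Ck_add Suc.IH[OF Suc.prems(1)])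
qed (simp add: bounded_bilinear.continuous_on)

text \<open>The derivative \<open>- (1/f) \<partial>f (1/f)\<close> involves \<open>1/f\<close> itself with one derivative less, which is
  what the induction supplies.\<close>

lemma Ck_inverse:
  fixes f :: "R2 \<Rightarrow> real"
  shows "(\<And>x. f x \<noteq> 0) \<Longrightarrow> Ck k f \<Longrightarrow> Ck k (\<lambda>x. inverse (f x))"
proof (induction k arbitrary: f)
  case (Suc k)
  have D: "((\<lambda>x. inverse (f x)) has_derivative
       (\<lambda>h. - (inverse (f x) * frechet_derivative f (at x) h * inverse (f x)))) (at x)" for x
    using Suc.prems by (intro Deriv.has_derivative_inverse) (auto simp: frechet_derivative_works)
  have P: "partial e (\<lambda>x. inverse (f x)) = (\<lambda>x. - (inverse (f x) * partial e f x * inverse (f x)))"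
    for e
    using partial_eq[OF D] unfolding partial_def by (intro ext)
  have I: "Ck k (\<lambda>x. inverse (f x))" using Suc Ck_Suc_imp by blast
  have "Ck k (\<lambda>x. - (inverse (f x) * partial e f x * inverse (f x)))" if "e = e1 \<or> e = e2" for e
    by (rule Ck_linear[OF bounded_linear_minus[OF bounded_linear_ident]],
        intro Ck_bilinear[OF bounded_bilinear_mult] I)
      (use Suc.prems that in auto)
  moreover have "(\<lambda>x. inverse (f x)) differentiable (at x)" for x
    using D differentiable_def by blast
  ultimately show ?case using P by auto
qed (simp add: continuous_on_inverse)

lemma partial_scale:
  fixes a b :: real
  assumes "\<And>x. f differentiable (at x)"
  shows "partial e1 (\<lambda>x. f (a * fst x, b * snd x)) x = a *\<^sub>R partial e1 f (a * fst x, b * snd x)"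
    and "partial e2 (\<lambda>x. f (a * fst x, b * snd x)) x = b *\<^sub>R partial e2 f (a * fst x, b * snd x)"
    and "(\<lambda>x. f (a * fst x, b * snd x)) differentiable (at x)"
proof -
  let ?R = "\<lambda>x::R2. (a * fst x, b * snd x)"
  have R: "(?R has_derivative ?R) (at x)"
    by (auto intro!: derivative_eq_intros)
  have D: "((\<lambda>x. f (?R x)) has_derivative
      (\<lambda>h. fst (?R h) *\<^sub>R partial e1 f (?R x) + snd (?R h) *\<^sub>R partial e2 f (?R x))) (at x)"
    using has_derivative_compose[OF R has_derivative_partial[OF assms]] by simp
  show "partial e1 (\<lambda>x. f (?R x)) x = a *\<^sub>R partial e1 f (?R x)"
    and "partial e2 (\<lambda>x. f (?R x)) x = b *\<^sub>R partial e2 f (?R x)"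
    using partial_eq[OF D] by simp_all
  show "(\<lambda>x. f (?R x)) differentiable (at x)"
    using D differentiable_def by blast
qed

lemma Ck_scale: "Ck k f \<Longrightarrow> Ck k (\<lambda>x. f (a * fst x, b * snd x))"
proof (induction k arbitrary: f)
  case 0
  then show ?case
    by (auto intro!: continuous_on_compose2[of UNIV f] continuous_intros)
next
  case (Suc k)
  then have d: "f differentiable (at x)" for x by (metis Ck.simps(2))
  have "Ck k (\<lambda>x. a *\<^sub>R partial e1 f (a * fst x, b * snd x))"
       "Ck k (\<lambda>x. b *\<^sub>R partial e2 f (a * fst x, b * snd x))"
    using Suc by (auto intro!: Ck_linear[OF bounded_linear_scaleR_right])
  then show ?case
    using partial_scale(3)[OF d] by (simp add: partial_scale(1,2)[OF d, abs_def])
qed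

lemma smooth_add [intro]: "smooth f \<Longrightarrow> smooth g \<Longrightarrow> smooth (\<lambda>x. f x + g x)"
  by (simp add: smooth_def Ck_add)

lemma smooth_linear: "bounded_linear h \<Longrightarrow> smooth f \<Longrightarrow> smooth (\<lambda>x. h (f x))"
  by (simp add: smooth_def Ck_linear)

lemma smooth_bilinear: "bounded_bilinear h \<Longrightarrow> smooth f \<Longrightarrow> smooth g \<Longrightarrow> smooth (\<lambda>x. h (f x) (g x))"
  by (simp add: smooth_def Ck_bilinear)

lemma smooth_scale: "smooth f \<Longrightarrow> smooth (\<lambda>x. f (a * fst x, b * snd x))"
  by (simp add: smooth_def Ck_scale)

lemma smooth_inverse:
  fixes f :: "R2 \<Rightarrow> real"
  shows "smooth f \<Longrightarrow> (\<And>x. f x \<noteq> 0) \<Longrightarrow> smooth (\<lambda>x. inverse (f x))"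
  by (simp add: smooth_def Ck_inverse)

lemmas smooth_minus [intro] = smooth_linear[OF bounded_linear_minus[OF bounded_linear_ident]]
lemmas smooth_mult [intro] = smooth_bilinear[OF bounded_bilinear_mult]
lemmas smooth_cmult = smooth_linear[OF bounded_linear_mult_right]
lemmas smooth_scaleR [intro] = smooth_bilinear[OF bounded_bilinear_scaleR]
lemmas smooth_inner [intro] = smooth_bilinear[OF bounded_bilinear_inner]

lemma smooth_diff [intro]: "smooth f \<Longrightarrow> smooth g \<Longrightarrow> smooth (\<lambda>x. f x - g x)"
  using smooth_add[of f "\<lambda>x. - g x"] smooth_minus by fastforce

lemma partial_mult:
  fixes f g :: "R2 \<Rightarrow> 'a::{euclidean_space, real_normed_algebra}"
  shows "smooth f \<Longrightarrow> smooth g \<Longrightarrow>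
    partial e (\<lambda>x. f x * g x) x = f x * partial e g x + partial e f x * g x"
  using partial_bilinear[OF bounded_bilinear_mult] smooth_differentiable by blast

lemma partial_cmult:
  fixes f :: "R2 \<Rightarrow> 'a::{euclidean_space, real_normed_algebra}"
  shows "smooth f \<Longrightarrow> partial e (\<lambda>x. c * f x) x = c * partial e f x"
  using partial_linear[OF bounded_linear_mult_right] smooth_differentiable by blast

lemma partial_scaleR_const:
  "smooth f \<Longrightarrow> partial e (\<lambda>x. c *\<^sub>R f x) x = c *\<^sub>R partial e f x"
  using partial_linear[OF bounded_linear_scaleR_right] smooth_differentiable by blast

section \<open>Test functions\<close>

text \<open>All derivatives of \<open>exp (- 1 / t)\<close>, extended by \<open>0\<close> to \<open>t \<le> 0\<close>, are linear combinations of these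
  functions.\<close>

definition flat_exp :: "nat \<Rightarrow> real \<Rightarrow> real" where
  "flat_exp k t = (if t > 0 then inverse t ^ k * exp (- inverse t) else 0)"

text \<open>Quadratic decay at \<open>0\<close> makes every member of the family differentiable there, with derivative \<open>0\<close>.
  It follows from \<open>(1 + s / n)\<^sup>n \<le> exp s\<close> with \<open>s = 1 / t\<close>.\<close>

lemma flat_exp_bound: "\<bar>flat_exp k t\<bar> \<le> real (k + 2) ^ (k + 2) * t\<^sup>2"
proof (cases "t > 0")
  case True
  define s where "s = inverse t"
  have s: "s > 0" "t = inverse s" using True by (auto simp: s_def)
  have "(s / real (k + 2)) ^ (k + 2) \<le> (1 + s / real (k + 2)) ^ (k + 2)"
    using s by (intro power_mono) auto
  also have "\<dots> \<le> exp s"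
    using s by (intro exp_ge_one_plus_x_over_n_power_n) auto
  finally have "s ^ (k + 2) \<le> real (k + 2) ^ (k + 2) * exp s"
    unfolding power_divide by (simp add: divide_le_eq mult.commute)
  then have "s ^ k * exp (- s) * s\<^sup>2 \<le> real (k + 2) ^ (k + 2)"
    by (simp add: exp_minus divide_simps power_add power2_eq_square ac_simps)
  then have "s ^ k * exp (- s) \<le> real (k + 2) ^ (k + 2) * (inverse s)\<^sup>2"
    using s by (simp add: field_simps)
  moreover have "flat_exp k t = s ^ k * exp (- s)"
    using True s by (simp add: flat_exp_def)
  moreover have "s ^ k * exp (- s) \<ge> 0" using s by simp
  ultimately show ?thesis using s(2) by simp
qed (simp add: flat_exp_def)

lemma flat_exp_deriv:
  "(flat_exp k has_real_derivative flat_exp (k + 2) t - real k * flat_exp (k + 1) t) (at t)"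
proof -
  consider "t > 0" | "t < 0" | "t = 0" by linarith
  then show ?thesis
  proof cases
    case 1
    have "real k * inverse t ^ (k - 1) * inverse t = real k * inverse t ^ k"
      by (cases k) auto
    then have "((\<lambda>t. inverse t ^ k * exp (- inverse t)) has_real_derivative
        flat_exp (k + 2) t - real k * flat_exp (k + 1) t) (at t)"
      using 1 by (auto intro!: derivative_eq_intros simp: flat_exp_def algebra_simps power2_eq_square)
    then show ?thesis
      by (rule has_field_derivative_transform_within_open[where S = "{0<..}"])
        (use 1 in \<open>auto simp: flat_exp_def\<close>)
  next
    case 2
    have "((\<lambda>t. 0) has_real_derivative 0) (at t)" by simp
    then have "(flat_exp k has_real_derivative 0) (at t)"
      by (rule has_field_derivative_transform_within_open[where S = "{..<0}"])
        (use 2 in \<open>auto simp: flat_exp_def\<close>)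
    with 2 show ?thesis by (simp add: flat_exp_def)
  next
    case 3
    define C where "C = real (k + 2) ^ (k + 2)"
    have lim: "((\<lambda>h. C * \<bar>h\<bar>) \<longlongrightarrow> 0) (at (0::real))"
      by (auto intro!: tendsto_eq_intros)
    have "norm (flat_exp k h / h) \<le> C * \<bar>h\<bar>" if "h \<noteq> 0" for h
    proof -
      have "\<bar>flat_exp k h\<bar> \<le> C * \<bar>h\<bar> * \<bar>h\<bar>"
        using flat_exp_bound[of k h] by (simp add: C_def power2_eq_square)
      then show ?thesis using that by (simp add: divide_le_eq)
    qed
    then have "\<forall>\<^sub>F h in at 0. norm (flat_exp k h / h) \<le> C * \<bar>h\<bar>"
      unfolding eventually_at_filter by (intro always_eventually allI impI)
    from Lim_null_comparison[OF this lim]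
    have "((\<lambda>h. flat_exp k h / h) \<longlongrightarrow> 0) (at 0)" .
    then show ?thesis
      using 3 by (simp add: DERIV_def flat_exp_def)
  qed
qed

lemma smooth_flat_exp_affine: "smooth (\<lambda>x. flat_exp k (a * fst x + b * snd x + c))"
proof -
  have "Ck K (\<lambda>x. flat_exp k (a * fst x + b * snd x + c))" for K
  proof (induction K arbitrary: k)
    case 0
    have "continuous_on UNIV (flat_exp k)"
      using flat_exp_deriv by (intro continuous_at_imp_continuous_on ballI DERIV_isCont)
    then show ?case
      by (auto intro!: continuous_on_compose2[of UNIV "flat_exp k"] continuous_intros)
  next
    case (Suc K)
    let ?l = "\<lambda>x::R2. a * fst x + b * snd x + c"
    have D: "((\<lambda>x. flat_exp k (?l x)) has_derivative
        (\<lambda>h. (flat_exp (k + 2) (?l x) - real k * flat_exp (k + 1) (?l x)) * (a * fst h + b * snd h)))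
        (at x)" for x
    proof -
      have "(?l has_derivative (\<lambda>h. a * fst h + b * snd h)) (at x)"
        by (auto intro!: derivative_eq_intros)
      from has_derivative_compose[OF this flat_exp_deriv[unfolded has_field_derivative_def]]
      show ?thesis .
    qed
    have P: "partial e (\<lambda>x. flat_exp k (?l x)) =
      (\<lambda>x. (a * fst e + b * snd e) *
        (flat_exp (k + 2) (?l x) + - real k * flat_exp (k + 1) (?l x)))" for e
      by (rule ext, subst partial_eq[OF D]) (simp add: algebra_simps)
    have "Ck K (partial e (\<lambda>x. flat_exp k (?l x)))" for e
      unfolding P
      by (intro Ck_linear[OF bounded_linear_mult_right] Ck_add Suc)
    moreover have "(\<lambda>x. flat_exp k (?l x)) differentiable (at x)" for x
      using D differentiable_def by blast
    ultimately show ?case unfolding Ck.simps(2) by blast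
  qed
  then show ?thesis by (simp add: smooth_def)
qed

text \<open>The product vanishes outside the box and, as \<open>j\<close> tends to infinity, increases to its indicator
  function.\<close>

definition box_bump :: "R2 \<Rightarrow> R2 \<Rightarrow> real \<Rightarrow> R2 \<Rightarrow> real" where
  "box_bump a b j x =
     flat_exp 0 (j * (fst x - fst a)) * flat_exp 0 (j * (fst b - fst x)) *
     (flat_exp 0 (j * (snd x - snd a)) * flat_exp 0 (j * (snd b - snd x)))"

lemma mem_box_R2: "x \<in> box a b \<longleftrightarrow>
    fst a < fst x \<and> fst x < fst b \<and> snd a < snd x \<and> snd x < snd (b::R2)"
  by (auto simp: mem_box Basis_prod_def inner_Pair_0 inner_commute)

lemma box_bump_eq_0: "j > 0 \<Longrightarrow> x \<notin> box a b \<Longrightarrow> box_bump a b j x = 0"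
  by (auto simp: box_bump_def flat_exp_def mem_box_R2 zero_less_mult_iff not_less)

lemma flat_exp_0_range: "0 \<le> flat_exp 0 t" "flat_exp 0 t \<le> 1"
  by (auto simp: flat_exp_def)

lemma box_bump_range: "0 \<le> box_bump a b j x" "box_bump a b j x \<le> 1"
  unfolding box_bump_def by (auto intro!: mult_nonneg_nonneg mult_le_one flat_exp_0_range)

lemma smooth_box_bump: "smooth (box_bump a b j)"
proof -
  have "smooth (\<lambda>x. flat_exp 0 (j * fst x + 0 * snd x + - j * fst a) *
      flat_exp 0 (- j * fst x + 0 * snd x + j * fst b) *
     (flat_exp 0 (0 * fst x + j * snd x + - j * snd a) *
      flat_exp 0 (0 * fst x + - j * snd x + j * snd b)))"
    by (intro smooth_mult smooth_flat_exp_affine)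
  also have "(\<lambda>x. flat_exp 0 (j * fst x + 0 * snd x + - j * fst a) *
      flat_exp 0 (- j * fst x + 0 * snd x + j * fst b) *
     (flat_exp 0 (0 * fst x + j * snd x + - j * snd a) *
      flat_exp 0 (0 * fst x + - j * snd x + j * snd b))) = box_bump a b j"
    by (rule ext) (simp add: box_bump_def right_diff_distrib)
  finally show ?thesis .
qed

lemma compact_support_iff: "compact (closure {x. f x \<noteq> 0}) \<longleftrightarrow> bounded {x. f x \<noteq> 0}"
  for f :: "R2 \<Rightarrow> 'b::euclidean_space"
  unfolding compact_eq_bounded_closed using bounded_subset[OF _ closure_subset] bounded_closure
  by blast

lemma test_fun_iff: "test_fun \<psi> \<longleftrightarrow> smooth \<psi> \<and> bounded {x. \<psi> x \<noteq> 0}"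
  by (simp add: test_fun_def compact_support_iff)

lemma test_fun_box_bump: "j > 0 \<Longrightarrow> test_fun (box_bump a b j)"
  unfolding test_fun_iff
proof
  assume "j > 0"
  then have "{x. box_bump a b j x \<noteq> 0} \<subseteq> box a b" using box_bump_eq_0[of j _ a b] by blast
  then show "bounded {x. box_bump a b j x \<noteq> 0}" by (rule bounded_subset[OF bounded_box])
qed (rule smooth_box_bump)

lemma box_bump_tendsto:
  assumes "x \<in> box a b"
  shows "(\<lambda>n. box_bump a b (real (Suc n)) x) \<longlonglongrightarrow> 1"
proof -
  have "(\<lambda>n. flat_exp 0 (real (Suc n) * d)) \<longlonglongrightarrow> 1" if "d > 0" for d
  proof -
    have "(\<lambda>n. inverse (real (Suc n)) * inverse d) \<longlonglongrightarrow> 0 * inverse d"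
      by (intro tendsto_mult LIMSEQ_inverse_real_of_nat tendsto_const)
    then have "(\<lambda>n. exp (- (inverse (real (Suc n)) * inverse d))) \<longlonglongrightarrow> exp (- 0)"
      by (intro tendsto_exp tendsto_minus) simp
    then show ?thesis
      using that by (simp add: flat_exp_def)
  qed
  note this[tendsto_intros]
  show ?thesis
    unfolding box_bump_def using assms unfolding mem_box_R2
    by (auto intro!: tendsto_eq_intros simp del: of_nat_Suc)
qed

section \<open>Integration by parts\<close>

lemma integrable_bounded_support:
  fixes f :: "R2 \<Rightarrow> 'b::euclidean_space"
  assumes "continuous_on UNIV f" "bounded {x. f x \<noteq> 0}"
  shows "integrable lborel f"
proof -
  let ?S = "closure {x. f x \<noteq> 0}"
  have "compact ?S" using assms(2) compact_support_iff by blast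
  then have "integrable lborel (\<lambda>x. indicator ?S x *\<^sub>R f x)"
    using assms(1) by (intro borel_integrable_compact) (auto intro: continuous_on_subset)
  also have "(\<lambda>x. indicator ?S x *\<^sub>R f x) = f"
    using closure_subset[of "{x. f x \<noteq> 0}"] unfolding indicator_def by fastforce
  finally show ?thesis .
qed

lemma partial_eq_0_outside:
  assumes "x \<notin> closure {x. f x \<noteq> 0}"
  shows "partial e f x = 0"
proof -
  have "open (- closure {x. f x \<noteq> 0})" by blast
  moreover have "0 = f y" if "y \<in> - closure {x. f x \<noteq> 0}" for y
    using subsetD[OF closure_subset, of y "{x. f x \<noteq> 0}"] that by auto
  ultimately have "(f has_derivative (\<lambda>h. 0)) (at x)"
    using assms
    by (intro has_derivative_transform_within_open[OF has_derivative_const, of "- closure {x. f x \<noteq> 0}" _ 0])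
      blast+
  then show ?thesis by (rule partial_eq)
qed

lemma bounded_support_partial:
  "bounded {x. f x \<noteq> 0} \<Longrightarrow> bounded {x. partial e f x \<noteq> 0}"
  using partial_eq_0_outside[of _ f e] by (blast intro: bounded_subset[OF bounded_closure])

lemma has_vector_derivative_line1:
  assumes "f differentiable (at (s, t))"
  shows "((\<lambda>s. f (s, t)) has_vector_derivative partial e1 f (s, t)) (at s)"
proof -
  have "((\<lambda>s. (s, t)) has_derivative (\<lambda>h. (h, 0))) (at s)"
    by (auto intro!: derivative_eq_intros)
  from has_derivative_compose[OF this has_derivative_partial[OF assms]]
  show ?thesis by (simp add: has_vector_derivative_def)
qed

lemma has_vector_derivative_line2:
  assumes "f differentiable (at (s, t))"
  shows "((\<lambda>t. f (s, t)) has_vector_derivative partial e2 f (s, t)) (at t)"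
proof -
  have "((\<lambda>t. (s, t)) has_derivative (\<lambda>h. (0, h))) (at t)"
    by (auto intro!: derivative_eq_intros)
  from has_derivative_compose[OF this has_derivative_partial[OF assms]]
  show ?thesis by (simp add: has_vector_derivative_def)
qed

lemma integral_derivative_bounded_support:
  fixes F f :: "real \<Rightarrow> 'b::euclidean_space"
  assumes F: "\<And>x. (F has_vector_derivative f x) (at x)" and f: "continuous_on UNIV f"
    and supp: "\<And>x. \<bar>x\<bar> \<ge> r \<Longrightarrow> F x = 0 \<and> f x = 0"
  shows "(LINT x|lborel. f x) = 0"
proof -
  define r' where "r' = \<bar>r\<bar>"
  have "(LINT x|lborel. indicator {-r'..r'} x *\<^sub>R f x) = F r' - F (- r')"
    by (rule integral_FTC_atLeastAtMost)
      (auto simp: r'_def intro: has_vector_derivative_at_within[OF F] continuous_on_subset[OF f])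
  also have "(\<lambda>x. indicator {-r'..r'} x *\<^sub>R f x) = f"
    using supp by (fastforce simp: r'_def indicator_def)
  finally show ?thesis using supp[of r'] supp[of "-r'"] by (simp add: r'_def)
qed

text \<open>Integrate first along the direction of differentiation: on each line the integral of the derivative
  of a compactly supported function vanishes.\<close>

lemma integral_partial_eq_0:
  fixes f :: "R2 \<Rightarrow> 'b::euclidean_space"
  assumes f: "smooth f" and supp: "bounded {x. f x \<noteq> 0}" and e: "e = e1 \<or> e = e2"
  shows "(LINT x|lborel. partial e f x) = 0"
proof -
  have c: "continuous_on UNIV (partial e f)"
    using f e smooth_continuous smooth_partial by blast
  have suppe: "bounded {x. partial e f x \<noteq> 0}" by (rule bounded_support_partial[OF supp])
  have int: "integrable (lborel \<Otimes>\<^sub>M lborel) (partial e f)"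
    using integrable_bounded_support[OF c suppe] by (simp add: lborel_prod)
  have "bounded ({x. f x \<noteq> 0} \<union> {x. partial e f x \<noteq> 0})" using supp suppe by simp
  then obtain r where r: "\<And>x. f x \<noteq> 0 \<or> partial e f x \<noteq> 0 \<Longrightarrow> norm x < r"
    unfolding bounded_pos_less by auto
  have z: "f x = 0 \<and> partial e f x = 0" if "\<bar>fst x\<bar> \<ge> r \<or> \<bar>snd x\<bar> \<ge> r" for x
    using r[of x] norm_fst_le[of "fst x" "snd x"] norm_snd_le[of "snd x" "fst x"] that
    by fastforce
  from e show ?thesis
  proof
    assume e: "e = e1"
    have "(LINT s|lborel. partial e f (s, t)) = 0" for t
      by (rule integral_derivative_bounded_support[where F = "\<lambda>s. f (s, t)" and r = r])
        (use z f in \<open>auto simp: e intro!: has_vector_derivative_line1 smooth_differentiable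
            continuous_on_compose2[OF c[unfolded e]] continuous_intros\<close>)
    then have "(LINT t|lborel. LINT s|lborel. partial e f (s, t)) = 0" by simp
    also have "(LINT t|lborel. LINT s|lborel. partial e f (s, t)) =
        (LINT x|(lborel \<Otimes>\<^sub>M lborel). partial e f x)"
      using lborel_pair.integral_snd[of "\<lambda>s t. partial e f (s, t)"] int by simp
    finally show ?thesis by (simp add: lborel_prod)
  next
    assume e: "e = e2"
    have "(LINT t|lborel. partial e f (s, t)) = 0" for s
      by (rule integral_derivative_bounded_support[where F = "\<lambda>t. f (s, t)" and r = r])
        (use z f in \<open>auto simp: e intro!: has_vector_derivative_line2 smooth_differentiable
            continuous_on_compose2[OF c[unfolded e]] continuous_intros\<close>)
    then have "(LINT s|lborel. LINT t|lborel. partial e f (s, t)) = 0" by simp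
    also have "(LINT s|lborel. LINT t|lborel. partial e f (s, t)) =
        (LINT x|(lborel \<Otimes>\<^sub>M lborel). partial e f x)"
      using lborel_pair.integral_fst'[OF int] by simp
    finally show ?thesis by (simp add: lborel_prod)
  qed
qed

section \<open>Symmetry of second derivatives\<close>

text \<open>Both mixed derivatives arise from the same second difference, by applying the mean value theorem in
  the two possible orders.\<close>

lemma second_difference_mvt:
  fixes f :: "R2 \<Rightarrow> real" and a b h :: real
  assumes f: "smooth f" and h: "h > 0"
  defines "\<Delta> \<equiv> f (a + h, b + h) - f (a + h, b) - f (a, b + h) + f (a, b)"
  shows "\<exists>s t. a < s \<and> s < a + h \<and> b < t \<and> t < b + h \<and>
            \<Delta> = h * h * partial e2 (partial e1 f) (s, t)"
    and "\<exists>s t. a < s \<and> s < a + h \<and> b < t \<and> t < b + h \<and>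
            \<Delta> = h * h * partial e1 (partial e2 f) (s, t)"
proof -
  have D1: "((\<lambda>s. g (s, t)) has_real_derivative partial e1 g (s, t)) (at s)"
    and D2: "((\<lambda>t. g (s, t)) has_real_derivative partial e2 g (s, t)) (at t)"
    if "smooth g" for g :: "R2 \<Rightarrow> real" and s t
    using has_vector_derivative_line1 has_vector_derivative_line2 smooth_differentiable[OF that]
    unfolding has_real_derivative_iff_has_vector_derivative by blast+
  have "\<exists>s>a. s < a + h \<and> (f (a + h, b + h) - f (a + h, b)) - (f (a, b + h) - f (a, b)) =
      (a + h - a) * (partial e1 f (s, b + h) - partial e1 f (s, b))"
    using h by (intro MVT2 DERIV_diff D1 f) auto
  then obtain s where s: "a < s" "s < a + h"
    "\<Delta> = h * (partial e1 f (s, b + h) - partial e1 f (s, b))"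
    by (auto simp: \<Delta>_def)
  have "\<exists>t>b. t < b + h \<and> partial e1 f (s, b + h) - partial e1 f (s, b) =
      (b + h - b) * partial e2 (partial e1 f) (s, t)"
    using h by (intro MVT2 D2 smooth_partial1 f) auto
  with s show "\<exists>s t. a < s \<and> s < a + h \<and> b < t \<and> t < b + h \<and>
            \<Delta> = h * h * partial e2 (partial e1 f) (s, t)"
    by auto
  have "\<exists>t>b. t < b + h \<and> (f (a + h, b + h) - f (a, b + h)) - (f (a + h, b) - f (a, b)) =
      (b + h - b) * (partial e2 f (a + h, t) - partial e2 f (a, t))"
    using h by (intro MVT2 DERIV_diff D2 f) auto
  then obtain t where t: "b < t" "t < b + h"
    "\<Delta> = h * (partial e2 f (a + h, t) - partial e2 f (a, t))"
    by (auto simp: \<Delta>_def)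
  have "\<exists>s>a. s < a + h \<and> partial e2 f (a + h, t) - partial e2 f (a, t) =
      (a + h - a) * partial e1 (partial e2 f) (s, t)"
    using h by (intro MVT2 D1 smooth_partial2 f) auto
  with t show "\<exists>s t. a < s \<and> s < a + h \<and> b < t \<and> t < b + h \<and>
            \<Delta> = h * h * partial e1 (partial e2 f) (s, t)"
    by auto
qed

lemma partial_commute_real:
  fixes f :: "R2 \<Rightarrow> real"
  assumes f: "smooth f"
  shows "partial e2 (partial e1 f) x = partial e1 (partial e2 f) x"
proof -
  obtain a b where x: "x = (a, b)" by (cases x)
  have "\<exists>p q. a < fst p \<and> fst p < a + inverse (real (Suc n)) \<and> b < snd p \<and> snd p < b + inverse (real (Suc n)) \<and>
        a < fst q \<and> fst q < a + inverse (real (Suc n)) \<and> b < snd q \<and> snd q < b + inverse (real (Suc n)) \<and>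
        partial e2 (partial e1 f) p = partial e1 (partial e2 f) q" for n
  proof -
    let ?h = "inverse (real (Suc n))"
    have h: "?h > 0" by simp
    from second_difference_mvt[OF f h, of a b] obtain s t s' t' where
      "a < s" "s < a + ?h" "b < t" "t < b + ?h" "a < s'" "s' < a + ?h" "b < t'" "t' < b + ?h"
      "?h * ?h * partial e2 (partial e1 f) (s, t) = ?h * ?h * partial e1 (partial e2 f) (s', t')"
      by metis
    with h show ?thesis by (intro exI[of _ "(s, t)"] exI[of _ "(s', t')"]) simp
  qed
  then obtain p q where pq: "\<And>n. a < fst (p n) \<and> fst (p n) < a + inverse (real (Suc n)) \<and>
        b < snd (p n) \<and> snd (p n) < b + inverse (real (Suc n)) \<and>
        a < fst (q n) \<and> fst (q n) < a + inverse (real (Suc n)) \<and>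
        b < snd (q n) \<and> snd (q n) < b + inverse (real (Suc n)) \<and>
        partial e2 (partial e1 f) (p n) = partial e1 (partial e2 f) (q n)"
    by metis
  have sq: "r \<longlonglongrightarrow> c" if "\<And>n. c < r n \<and> r n < c + inverse (real (Suc n))" for r c
  proof (rule tendsto_sandwich[of "\<lambda>_. c"])
    show "(\<lambda>n. c + inverse (real (Suc n))) \<longlonglongrightarrow> c"
      using tendsto_add[OF tendsto_const LIMSEQ_inverse_real_of_nat, of c] by simp
  qed (use that in \<open>auto intro!: always_eventually less_imp_le simp del: of_nat_Suc\<close>)
  have "(\<lambda>n. (fst (p n), snd (p n))) \<longlonglongrightarrow> (a, b)" "(\<lambda>n. (fst (q n), snd (q n))) \<longlonglongrightarrow> (a, b)"
    by (intro tendsto_Pair sq conjI; use pq in blast)+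
  then have lim: "p \<longlonglongrightarrow> x" "q \<longlonglongrightarrow> x" by (simp_all add: x)
  have "(\<lambda>n. partial e2 (partial e1 f) (p n)) \<longlonglongrightarrow> partial e2 (partial e1 f) x"
       "(\<lambda>n. partial e1 (partial e2 f) (q n)) \<longlonglongrightarrow> partial e1 (partial e2 f) x"
    by (rule continuous_on_tendsto_compose[OF smooth_continuous lim(1)]
        continuous_on_tendsto_compose[OF smooth_continuous lim(2)]; use f in auto)+
  then show ?thesis using pq LIMSEQ_unique by fastforce
qed

lemma partial_commute:
  fixes f :: "R2 \<Rightarrow> 'b::euclidean_space"
  assumes f: "smooth f"
  shows "partial e2 (partial e1 f) = partial e1 (partial e2 f)"
proof (rule ext, rule euclidean_eqI)
  fix x and i :: 'b
  have I: "partial e (\<lambda>x. g x \<bullet> i) = (\<lambda>x. partial e g x \<bullet> i)" if "smooth g" for e and g :: "R2 \<Rightarrow> 'b"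
    using partial_linear[OF bounded_linear_inner_left] smooth_differentiable[OF that] by blast
  have "smooth (\<lambda>x. f x \<bullet> i)" using f by (intro smooth_inner smooth_const)
  from partial_commute_real[OF this]
  show "partial e2 (partial e1 f) x \<bullet> i = partial e1 (partial e2 f) x \<bullet> i"
    using f by (simp add: I smooth_partial1 smooth_partial2)
qed

lemma smooth_funpow1: "smooth f \<Longrightarrow> smooth ((partial e1 ^^ i) f)"
  by (induction i) auto

lemma smooth_funpow2: "smooth f \<Longrightarrow> smooth ((partial e2 ^^ i) f)"
  by (induction i) auto

lemma smooth_multi_partial: "smooth f \<Longrightarrow> smooth (multi_partial \<alpha> f)"
  unfolding multi_partial_def by (intro smooth_funpow1 smooth_funpow2)

lemma partial2_funpow1: "smooth f \<Longrightarrow> partial e2 ((partial e1 ^^ i) f) = (partial e1 ^^ i) (partial e2 f)"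
  by (induction i) (simp_all add: partial_commute smooth_funpow1)

lemma funpow2_funpow1:
  "smooth f \<Longrightarrow> (partial e2 ^^ j) ((partial e1 ^^ i) f) = (partial e1 ^^ i) ((partial e2 ^^ j) f)"
  by (induction j) (simp_all add: partial2_funpow1 smooth_funpow2)

lemma partial1_multi_partial: "partial e1 (multi_partial (i, j) f) = multi_partial (Suc i, j) f"
  by (simp add: multi_partial_def)

lemma partial2_multi_partial:
  "smooth f \<Longrightarrow> partial e2 (multi_partial (i, j) f) = multi_partial (i, Suc j) f"
  by (simp add: multi_partial_def partial2_funpow1 smooth_funpow2)

section \<open>Weak and classical derivatives\<close>

lemma lebesgue_measurable_continuous:
  fixes f :: "R2 \<Rightarrow> 'b::euclidean_space"
  shows "continuous_on UNIV f \<Longrightarrow> f \<in> borel_measurable lebesgue"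
  by (intro measurable_completion) (simp add: borel_measurable_continuous_onI)

lemma locally_integrable_continuous:
  fixes f :: "R2 \<Rightarrow> 'b::euclidean_space"
  assumes "continuous_on UNIV f"
  shows "locally_integrable f"
  unfolding locally_integrable_def set_integrable_def
proof (intro allI impI)
  fix K :: "R2 set" assume "compact K"
  with assms have "integrable lborel (\<lambda>x. indicator K x *\<^sub>R f x)"
    by (intro borel_integrable_compact) (auto intro: continuous_on_subset)
  then show "integrable lebesgue (\<lambda>x. indicator K x *\<^sub>R f x)"
    by (simp add: integrable_completion borel_measurable_integrable)
qed

lemma test_fun_partial: "test_fun \<psi> \<Longrightarrow> e = e1 \<or> e = e2 \<Longrightarrow> test_fun (partial e \<psi>)"
  by (meson test_fun_iff smooth_partial bounded_support_partial)

lemma test_fun_funpow: "test_fun \<psi> \<Longrightarrow> e = e1 \<or> e = e2 \<Longrightarrow> test_fun ((partial e ^^ i) \<psi>)"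
  by (induction i) (auto intro: test_fun_partial)

lemma integral_by_parts:
  fixes f :: "R2 \<Rightarrow> 'b::euclidean_space"
  assumes \<psi>: "test_fun \<psi>" and f: "smooth f" and e: "e = e1 \<or> e = e2"
  shows "(LINT x|lborel. partial e \<psi> x *\<^sub>R f x) = - (LINT x|lborel. \<psi> x *\<^sub>R partial e f x)"
proof -
  have s: "smooth \<psi>" and b: "bounded {x. \<psi> x \<noteq> 0}" using \<psi> by (auto simp: test_fun_iff)
  have be: "bounded {x. partial e \<psi> x \<noteq> 0}" by (rule bounded_support_partial[OF b])
  have "bounded {x. \<psi> x *\<^sub>R f x \<noteq> 0}" by (rule bounded_subset[OF b]) auto
  then have "(LINT x|lborel. partial e (\<lambda>x. \<psi> x *\<^sub>R f x) x) = 0"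
    using s f e by (intro integral_partial_eq_0 smooth_scaleR)
  also have "partial e (\<lambda>x. \<psi> x *\<^sub>R f x) = (\<lambda>x. \<psi> x *\<^sub>R partial e f x + partial e \<psi> x *\<^sub>R f x)"
    by (rule ext, rule partial_bilinear[OF bounded_bilinear_scaleR
          smooth_differentiable[OF s] smooth_differentiable[OF f]])
  also have "(LINT x|lborel. \<psi> x *\<^sub>R partial e f x + partial e \<psi> x *\<^sub>R f x) =
      (LINT x|lborel. \<psi> x *\<^sub>R partial e f x) + (LINT x|lborel. partial e \<psi> x *\<^sub>R f x)"
  proof (rule Bochner_Integration.integral_add)
    show "integrable lborel (\<lambda>x. \<psi> x *\<^sub>R partial e f x)"
      by (rule integrable_bounded_support[OF _ bounded_subset[OF b]])
        (use s f e in \<open>auto intro!: continuous_intros smooth_continuous\<close>)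
    show "integrable lborel (\<lambda>x. partial e \<psi> x *\<^sub>R f x)"
      by (rule integrable_bounded_support[OF _ bounded_subset[OF be]])
        (use s f e in \<open>auto intro!: continuous_intros smooth_continuous\<close>)
  qed
  finally show ?thesis by (simp add: add_eq_0_iff)
qed

lemma integral_by_parts_funpow:
  assumes \<psi>: "test_fun \<psi>" and f: "smooth f" and e: "e = e1 \<or> e = e2"
  shows "(LINT x|lborel. (partial e ^^ i) \<psi> x *\<^sub>R f x) =
    (- 1) ^ i *\<^sub>R (LINT x|lborel. \<psi> x *\<^sub>R (partial e ^^ i) f x)"
  using f
proof (induction i arbitrary: f)
  case (Suc i)
  have "(LINT x|lborel. (partial e ^^ Suc i) \<psi> x *\<^sub>R f x) =
      - (LINT x|lborel. (partial e ^^ i) \<psi> x *\<^sub>R partial e f x)"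
    using integral_by_parts[OF test_fun_funpow[OF \<psi> e] Suc.prems e] by simp
  also have "\<dots> = - ((- 1) ^ i *\<^sub>R (LINT x|lborel. \<psi> x *\<^sub>R (partial e ^^ i) (partial e f) x))"
    using Suc.prems e by (subst Suc.IH) auto
  finally show ?case by (simp add: funpow_swap1)
qed simp

text \<open>Integrating by parts moves the derivatives to \<open>f\<close> in the reverse order, so the symmetry of second
  derivatives is needed to recognise \<open>multi_partial\<close>.\<close>

lemma is_weak_deriv_smooth:
  assumes f: "smooth f"
  shows "is_weak_deriv \<alpha> f (multi_partial \<alpha> f)"
proof -
  obtain i j where \<alpha>: "\<alpha> = (i, j)" by (cases \<alpha>)
  have L: "(LINT x|lebesgue. \<psi> x *\<^sub>R g x) = (LINT x|lborel. \<psi> x *\<^sub>R g x)"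
    if "smooth \<psi>" "smooth g" for \<psi> and g :: "R2 \<Rightarrow> 'a"
    using that by (intro integral_completion) (auto intro: smooth_borel)
  have "(LINT x|lborel. multi_partial (i, j) \<psi> x *\<^sub>R f x) =
        (- 1) ^ (i + j) *\<^sub>R (LINT x|lborel. \<psi> x *\<^sub>R multi_partial (i, j) f x)"
    if \<psi>: "test_fun \<psi>" for \<psi>
  proof -
    have "(LINT x|lborel. multi_partial (i, j) \<psi> x *\<^sub>R f x) =
       (- 1) ^ i *\<^sub>R (LINT x|lborel. (partial e2 ^^ j) \<psi> x *\<^sub>R (partial e1 ^^ i) f x)"
      unfolding multi_partial_def fst_conv snd_conv
      using \<psi> f by (intro integral_by_parts_funpow test_fun_funpow) auto
    also have "\<dots> = (- 1) ^ i *\<^sub>R (- 1) ^ j *\<^sub>R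
        (LINT x|lborel. \<psi> x *\<^sub>R (partial e2 ^^ j) ((partial e1 ^^ i) f) x)"
      using \<psi> f by (subst integral_by_parts_funpow) (auto intro: smooth_funpow1)
    finally show ?thesis
      using f by (simp add: funpow2_funpow1 multi_partial_def power_add)
  qed
  then show ?thesis
    unfolding is_weak_deriv_def \<alpha>
    using f by (auto simp: L smooth_multi_partial test_fun_iff
        intro!: locally_integrable_continuous smooth_continuous)
qed

lemma integrable_test_scaleR:
  assumes \<psi>: "continuous_on UNIV \<psi>" "bounded {x. \<psi> x \<noteq> 0}" and g: "locally_integrable g"
  shows "integrable lebesgue (\<lambda>x. \<psi> x *\<^sub>R g x)"
proof -
  let ?K = "closure {x. \<psi> x \<noteq> (0::real)}"
  have K: "compact ?K" using \<psi>(2) compact_support_iff by blast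
  then have int: "integrable lebesgue (\<lambda>x. indicator ?K x *\<^sub>R g x)"
    using g unfolding locally_integrable_def set_integrable_def by blast
  have z: "\<psi> x = 0" if "x \<notin> ?K" for x
    using subsetD[OF closure_subset, of x "{x. \<psi> x \<noteq> 0}"] that by auto
  have "compact (\<psi> ` ?K)"
    using K \<psi>(1) by (intro compact_continuous_image) (auto intro: continuous_on_subset)
  then obtain B where "\<forall>y\<in>\<psi> ` ?K. norm y \<le> B"
    using compact_imp_bounded bounded_iff by blast
  then have B: "\<And>x. x \<in> ?K \<Longrightarrow> \<bar>\<psi> x\<bar> \<le> B" by simp
  have "integrable lebesgue (\<lambda>x. \<psi> x *\<^sub>R (indicator ?K x *\<^sub>R g x))"
  proof (rule Bochner_Integration.integrable_bound)
    show "integrable lebesgue (\<lambda>x. \<bar>B\<bar> *\<^sub>R (indicator ?K x *\<^sub>R g x))"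
      by (rule integrable_scaleR_right) (use int in blast)
    show "(\<lambda>x. \<psi> x *\<^sub>R (indicator ?K x *\<^sub>R g x)) \<in> borel_measurable lebesgue"
      using borel_measurable_integrable[OF int] lebesgue_measurable_continuous[OF \<psi>(1)]
      by (rule borel_measurable_scaleR[rotated])
    show "AE x in lebesgue. norm (\<psi> x *\<^sub>R indicat_real ?K x *\<^sub>R g x)
        \<le> norm (\<bar>B\<bar> *\<^sub>R indicat_real ?K x *\<^sub>R g x)"
    proof (rule AE_I2)
      fix x
      show "norm (\<psi> x *\<^sub>R indicat_real ?K x *\<^sub>R g x) \<le> norm (\<bar>B\<bar> *\<^sub>R indicat_real ?K x *\<^sub>R g x)"
        using B[of x] by (cases "x \<in> ?K") (auto intro!: mult_right_mono)
    qed
  qed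
  also have "(\<lambda>x. \<psi> x *\<^sub>R (indicator ?K x *\<^sub>R g x)) = (\<lambda>x. \<psi> x *\<^sub>R g x)"
  proof
    fix x
    show "\<psi> x *\<^sub>R (indicat_real ?K x *\<^sub>R g x) = \<psi> x *\<^sub>R g x"
      using z[of x] by (cases "x \<in> ?K") auto
  qed
  finally show ?thesis .
qed

lemma box_Int_box_R2:
  "box a b \<inter> box c d = box (max (fst a) (fst c), max (snd a) (snd c))
     (min (fst b) (fst d), min (snd b) (snd (d::R2)))"
  by (rule set_eqI) (auto simp: mem_box_R2)

lemma integrable_box:
  assumes "locally_integrable g"
  shows "integrable lebesgue (\<lambda>x. indicator (box a b) x *\<^sub>R g x)"
proof -
  have "set_integrable lebesgue (cbox a b) g"
    using assms compact_cbox[of a b] by (simp add: locally_integrable_def)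
  then have "set_integrable lebesgue (box a b) g"
    by (rule set_integrable_subset) (auto simp: box_subset_cbox)
  then show ?thesis by (simp add: set_integrable_def)
qed

text \<open>The functions \<open>box_bump\<close> are test functions dominated by the indicator function of the box and
  converging to it.\<close>

lemma integral_box_eq_0:
  assumes g: "locally_integrable g"
    and 0: "\<And>\<psi>. test_fun \<psi> \<Longrightarrow> (LINT x|lebesgue. \<psi> x *\<^sub>R g x) = 0"
  shows "(LINT x|lebesgue. indicator (box a b) x *\<^sub>R g x) = 0"
proof -
  let ?s = "\<lambda>n x. box_bump a b (real (Suc n)) x *\<^sub>R g x"
  have "(\<lambda>n. LINT x|lebesgue. ?s n x) \<longlonglongrightarrow> (LINT x|lebesgue. indicator (box a b) x *\<^sub>R g x)"
  proof (rule integral_dominated_convergence)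
    show "integrable lebesgue (\<lambda>x. norm (indicat_real (box a b) x *\<^sub>R g x))"
      using integrable_box[OF g] by (rule integrable_norm)
    show "(\<lambda>x. indicat_real (box a b) x *\<^sub>R g x) \<in> borel_measurable lebesgue"
      using integrable_box[OF g] by (rule borel_measurable_integrable)
    show "?s n \<in> borel_measurable lebesgue" for n
      using integrable_test_scaleR[OF _ _ g] test_fun_box_bump[of "real (Suc n)" a b]
        smooth_continuous unfolding test_fun_iff by (auto intro!: borel_measurable_integrable)
    show "AE x in lebesgue. (\<lambda>n. ?s n x) \<longlonglongrightarrow> indicat_real (box a b) x *\<^sub>R g x"
    proof (rule AE_I2)
      fix x
      have "(\<lambda>n. box_bump a b (real (Suc n)) x) \<longlonglongrightarrow> indicat_real (box a b) x"
        using box_bump_tendsto[of x a b] box_bump_eq_0[of "real (Suc n)" x a b for n]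
        by (cases "x \<in> box a b") auto
      then show "(\<lambda>n. ?s n x) \<longlonglongrightarrow> indicat_real (box a b) x *\<^sub>R g x"
        by (intro tendsto_scaleR tendsto_const)
    qed
    show "AE x in lebesgue. norm (?s n x) \<le> norm (indicat_real (box a b) x *\<^sub>R g x)" for n
    proof (rule AE_I2)
      fix x
      show "norm (?s n x) \<le> norm (indicat_real (box a b) x *\<^sub>R g x)"
        using box_bump_eq_0[of "real (Suc n)" x a b] box_bump_range[of a b "real (Suc n)" x]
        by (cases "x \<in> box a b") (auto intro!: mult_left_le_one_le)
    qed
  qed
  moreover have "(LINT x|lebesgue. ?s n x) = 0" for n
    using 0 test_fun_box_bump[of "real (Suc n)" a b] by simp
  ultimately show ?thesis by (simp add: LIMSEQ_const_iff)
qed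

lemma sigma_finite_lebesgue: "sigma_finite_measure (lebesgue :: R2 measure)"
proof
  obtain A :: "R2 set set" where A: "countable A \<and> A \<subseteq> sets lborel \<and> \<Union> A = space lborel \<and>
    (\<forall>a\<in>A. emeasure lborel a \<noteq> \<infinity>)"
    using lborel.sigma_finite_countable by (elim exE)
  then show "\<exists>A. countable A \<and> A \<subseteq> sets lebesgue \<and> \<Union> A = space lebesgue \<and>
      (\<forall>a\<in>A. emeasure lebesgue (a :: R2 set) \<noteq> \<infinity>)"
    by (intro exI[of _ A]) (auto simp: subset_iff)
qed

text \<open>Open boxes generate the Borel sets and are closed under intersection.  Hence a function whose
  integrals over all boxes vanish has vanishing integrals over all measurable sets.\<close>

lemma AE_zero_if_test_integrals_zero:
  assumes g: "locally_integrable g"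
    and 0: "\<And>\<psi>. test_fun \<psi> \<Longrightarrow> (LINT x|lebesgue. \<psi> x *\<^sub>R g x) = 0"
  shows "AE x in lebesgue. g x = 0"
proof -
  define B :: "nat \<Rightarrow> R2 set" where "B n = box (- real n, - real n) (real n, real n)" for n
  have "AE x in lebesgue. indicator (B n) x *\<^sub>R g x = 0" for n
  proof -
    let ?G = "\<lambda>x. indicator (B n) x *\<^sub>R g x"
    have int: "integrable lebesgue ?G" unfolding B_def by (rule integrable_box[OF g])
    have intA: "integrable lebesgue (\<lambda>x. indicator A x *\<^sub>R ?G x)" if "A \<in> sets borel" for A
      using that by (intro integrable_mult_indicator int) auto
    have borel_sets: "sets borel = sigma_sets UNIV (range (\<lambda>(a, b). box a b :: R2 set))"
      by (subst borel_eq_box) (simp add: sets_measure_of)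
    have bor: "(LINT x|lebesgue. indicator A x *\<^sub>R ?G x) = 0" if "A \<in> sets borel" for A
    proof -
      have stable: "Int_stable (range (\<lambda>(a, b). box a b :: R2 set))"
        using box_Int_box_R2 by (auto simp: Int_stable_def image_iff) blast
      have "A \<in> sigma_sets UNIV (range (\<lambda>(a, b). box a b :: R2 set))"
        using that borel_sets by simp
      have "range (\<lambda>(a, b). box a b :: R2 set) \<subseteq> Pow UNIV" by simp
      note stable this \<open>A \<in> sigma_sets UNIV _\<close>
      then show ?thesis
      proof (induction A rule: sigma_sets_induct_disjoint)
        case (basic A)
        then obtain a b where A: "A = box a b" by auto
        have "(\<lambda>x. indicator A x *\<^sub>R ?G x) = (\<lambda>x. indicator (A \<inter> B n) x *\<^sub>R g x)"
          by (auto simp: indicator_def)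
        then show ?case
          unfolding A B_def box_Int_box_R2 using integral_box_eq_0[OF assms] by simp
      next
        case (compl A)
        have "A \<in> sets borel" using compl borel_sets by simp
        then have "(LINT x|lebesgue. ?G x - indicator A x *\<^sub>R ?G x) = (LINT x|lebesgue. ?G x) - 0"
          using compl.IH intA int by (subst Bochner_Integration.integral_diff) auto
        also have "(LINT x|lebesgue. ?G x) = 0"
          unfolding B_def by (rule integral_box_eq_0[OF assms])
        also have "(\<lambda>x. ?G x - indicator A x *\<^sub>R ?G x) = (\<lambda>x. indicator (UNIV - A) x *\<^sub>R ?G x)"
          by (auto simp: indicator_def)
        finally show ?case by simp
      next
        case (union A)
        then have A: "A i \<in> sets borel" for i using borel_sets by auto
        have "set_lebesgue_integral lebesgue (\<Union>i. A i) ?G = (\<Sum>i. set_lebesgue_integral lebesgue (A i) ?G)"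
        proof (rule lebesgue_integral_countable_add)
          show "A i \<inter> A j = {}" if "i \<noteq> j" for i j
            using union(1) that by (auto simp: disjoint_family_on_def)
          show "set_integrable lebesgue (\<Union> (range A)) ?G"
            unfolding set_integrable_def by (intro intA sets.countable_UN'') (auto simp: A)
        qed (use A in auto)
        also have "\<dots> = 0" using union by (simp add: set_lebesgue_integral_def)
        finally show ?case by (simp add: set_lebesgue_integral_def)
      qed auto
    qed
    have "AE x in lebesgue. ?G x = (0::'a)"
    proof (rule sigma_finite_measure.density_unique_banach[OF sigma_finite_lebesgue])
      fix A :: "R2 set" assume A: "A \<in> sets lebesgue"
      have "AE x in lebesgue. x \<notin> null_part lborel A"
        using AE_notin_null_part[OF A] by (rule AE_completion)
      then have "(LINT x|lebesgue. indicator A x *\<^sub>R ?G x) =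
          (LINT x|lebesgue. indicator (main_part lborel A) x *\<^sub>R ?G x)"
      proof (intro integral_cong_AE)
        show "(\<lambda>x. indicat_real A x *\<^sub>R ?G x) \<in> borel_measurable lebesgue"
          using integrable_mult_indicator[OF A int] by (rule borel_measurable_integrable)
        show "(\<lambda>x. indicat_real (main_part lborel A) x *\<^sub>R ?G x) \<in> borel_measurable lebesgue"
          using intA main_part_sets[OF A] by (intro borel_measurable_integrable) simp
        show "AE x in lebesgue. indicat_real A x *\<^sub>R ?G x = indicat_real (main_part lborel A) x *\<^sub>R ?G x"
          if "AE x in lebesgue. x \<notin> null_part lborel A"
          using that
        proof eventually_elim
          case (elim x)
          then have "x \<in> A \<longleftrightarrow> x \<in> main_part lborel A"
            using main_part_null_part_Un[OF A] by blast
          then show ?case by (simp add: indicator_def)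
        qed
      qed
      also have "\<dots> = 0" using bor main_part_sets[OF A] by simp
      finally show "set_lebesgue_integral lebesgue A ?G = set_lebesgue_integral lebesgue A (\<lambda>x. 0)"
        by (simp add: set_lebesgue_integral_def)
    qed (use int in auto)
    then show ?thesis .
  qed
  then have "AE x in lebesgue. \<forall>n. indicator (B n) x *\<^sub>R g x = 0"
    unfolding AE_all_countable by blast
  then show ?thesis
  proof eventually_elim
    case (elim x)
    obtain n where "max \<bar>fst x\<bar> \<bar>snd x\<bar> < real n" using reals_Archimedean2 by blast
    then have "x \<in> B n" by (auto simp: B_def mem_box_R2)
    with elim[rule_format, of n] show ?case by simp
  qed
qed

lemma locally_integrable_diff:
  "locally_integrable f \<Longrightarrow> locally_integrable g \<Longrightarrow> locally_integrable (\<lambda>x. f x - g x)"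
  unfolding locally_integrable_def by (auto intro: set_integral_diff)

lemma locally_integrable_scaleR:
  "locally_integrable f \<Longrightarrow> locally_integrable (\<lambda>x. c *\<^sub>R f x)"
  unfolding locally_integrable_def by auto

lemma is_weak_deriv_diff:
  assumes f: "is_weak_deriv \<alpha> f f'" and g: "is_weak_deriv \<alpha> g g'"
  shows "is_weak_deriv \<alpha> (\<lambda>x. f x - g x) (\<lambda>x. f' x - g' x)"
proof -
  have D: "(LINT x|lebesgue. \<psi> x *\<^sub>R (h x - k x) :: 'a) =
      (LINT x|lebesgue. \<psi> x *\<^sub>R h x) - (LINT x|lebesgue. \<psi> x *\<^sub>R k x)"
    if "test_fun \<psi>" "locally_integrable h" "locally_integrable k" for \<psi> and h k :: "R2 \<Rightarrow> 'a"
    unfolding scaleR_right_diff_distrib using that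
    by (intro Bochner_Integration.integral_diff integrable_test_scaleR)
      (auto simp: test_fun_iff intro: smooth_continuous)
  have "test_fun (multi_partial \<alpha> \<psi>)" if "test_fun \<psi>" for \<psi>
    unfolding multi_partial_def using that by (intro test_fun_funpow) auto
  then show ?thesis
    using f g unfolding is_weak_deriv_def
    by (auto simp: D locally_integrable_diff simp flip: scaleR_right_diff_distrib)
qed

lemma is_weak_deriv_scaleR:
  assumes f: "is_weak_deriv \<alpha> f f'"
  shows "is_weak_deriv \<alpha> (\<lambda>x. c *\<^sub>R f x) (\<lambda>x. c *\<^sub>R f' x)"
proof -
  have "(LINT x|lebesgue. \<psi> x *\<^sub>R c *\<^sub>R h x) = c *\<^sub>R (LINT x|lebesgue. \<psi> x *\<^sub>R h x)"
    for \<psi> and h :: "R2 \<Rightarrow> 'a"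
  proof -
    have "(\<lambda>x. \<psi> x *\<^sub>R c *\<^sub>R h x) = (\<lambda>x. c *\<^sub>R \<psi> x *\<^sub>R h x)"
      by (simp add: mult.commute)
    then show ?thesis by (simp del: scaleR_scaleR)
  qed
  then show ?thesis
    using f unfolding is_weak_deriv_def
    by (simp add: locally_integrable_scaleR mult.commute del: scaleR_scaleR)
      (simp add: mult.commute)
qed

lemma is_weak_deriv_unique:
  assumes "is_weak_deriv \<alpha> f g" "is_weak_deriv \<alpha> f h"
  shows "AE x in lebesgue. g x = h x"
proof -
  have D: "is_weak_deriv \<alpha> (\<lambda>x. f x - f x) (\<lambda>x. g x - h x)"
    by (rule is_weak_deriv_diff[OF assms])
  have "AE x in lebesgue. g x - h x = 0"
  proof (rule AE_zero_if_test_integrals_zero)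
    show "locally_integrable (\<lambda>x. g x - h x)" using D by (simp add: is_weak_deriv_def)
    show "(LINT x|lebesgue. \<psi> x *\<^sub>R (g x - h x)) = 0" if "test_fun \<psi>" for \<psi>
    proof -
      have "0 = (- 1 :: real) ^ (fst \<alpha> + snd \<alpha>) *\<^sub>R (LINT x|lebesgue. \<psi> x *\<^sub>R (g x - h x))"
        using D that unfolding is_weak_deriv_def by simp
      then show ?thesis by simp
    qed
  qed
  then show ?thesis by simp
qed

lemma is_weak_deriv_weak_deriv: "is_weak_deriv \<alpha> f g \<Longrightarrow> is_weak_deriv \<alpha> f (weak_deriv \<alpha> f)"
  unfolding weak_deriv_def using someI[of "is_weak_deriv \<alpha> f" g] by blast

lemma weak_deriv_AE_eq: "is_weak_deriv \<alpha> f g \<Longrightarrow> AE x in lebesgue. weak_deriv \<alpha> f x = g x"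
  using is_weak_deriv_unique is_weak_deriv_weak_deriv by blast

section \<open>The Sobolev inequality\<close>

text \<open>The function \<open>(a + 1 - s) h(s)\<^sup>2\<close> is \<open>h(a)\<^sup>2\<close> at \<open>s = a\<close> and \<open>0\<close> at \<open>s = a + 1\<close>, so the integral of
  its derivative over this interval isolates \<open>h(a)\<^sup>2\<close>.\<close>

lemma sobolev_1d:
  fixes h h' :: "real \<Rightarrow> real"
  assumes h: "\<And>s. (h has_real_derivative h' s) (at s)" and h': "continuous_on UNIV h'"
  shows "ennreal ((h a)\<^sup>2) \<le> (\<integral>\<^sup>+ s. ennreal (2 * (h s)\<^sup>2 + (h' s)\<^sup>2) \<partial>lborel)"
proof -
  let ?F = "\<lambda>s. - ((a + 1 - s) * (h s)\<^sup>2)"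
  let ?f = "\<lambda>s. (h s)\<^sup>2 - (a + 1 - s) * (2 * h s * h' s)"
  have ch: "continuous_on UNIV h"
    using h by (intro continuous_at_imp_continuous_on ballI DERIV_isCont)
  have D: "(?F has_real_derivative ?f s) (at s)" for s
    by (rule derivative_eq_intros h refl | simp)+
  have cf: "continuous_on {a..a + 1} ?f"
    by (intro continuous_intros continuous_on_subset[OF ch] continuous_on_subset[OF h']) auto
  have int: "integrable lborel (\<lambda>s. indicator {a..a + 1} s *\<^sub>R ?f s)"
    using cf by (intro borel_integrable_compact) auto
  have "(LINT s|lborel. indicator {a..a + 1} s *\<^sub>R ?f s) = ?F (a + 1) - ?F a"
    by (rule integral_FTC_atLeastAtMost)
      (use D cf in \<open>auto simp: has_real_derivative_iff_has_vector_derivative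
         intro: has_vector_derivative_at_within\<close>)
  then have "ennreal ((h a)\<^sup>2) = ennreal (norm (LINT s|lborel. indicator {a..a + 1} s *\<^sub>R ?f s))"
    by simp
  also have "\<dots> \<le> (\<integral>\<^sup>+ s. ennreal (norm (indicator {a..a + 1} s *\<^sub>R ?f s)) \<partial>lborel)"
    by (rule integral_norm_bound_ennreal[OF int])
  also have "\<dots> \<le> (\<integral>\<^sup>+ s. ennreal (2 * (h s)\<^sup>2 + (h' s)\<^sup>2) \<partial>lborel)"
  proof (intro nn_integral_mono ennreal_leI)
    fix s
    have "\<bar>?f s\<bar> \<le> 2 * (h s)\<^sup>2 + (h' s)\<^sup>2" if s: "s \<in> {a..a + 1}"
    proof -
      have "\<bar>(a + 1 - s) * (2 * h s * h' s)\<bar> \<le> \<bar>2 * h s * h' s\<bar>"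
        unfolding abs_mult using s by (intro mult_left_le_one_le) auto
      moreover have "2 * h s * h' s \<le> (h s)\<^sup>2 + (h' s)\<^sup>2" "- (2 * h s * h' s) \<le> (h s)\<^sup>2 + (h' s)\<^sup>2"
        using sum_squares_bound[of "h s" "h' s"] sum_squares_bound[of "- h s" "h' s"] by auto
      ultimately show ?thesis
        using zero_le_power2[of "h s"] by linarith
    qed
    then show "norm (indicat_real {a..a + 1} s *\<^sub>R ?f s) \<le> 2 * (h s)\<^sup>2 + (h' s)\<^sup>2"
      by (cases "s \<in> {a..a + 1}") auto
  qed
  finally show ?thesis .
qed

text \<open>The one-dimensional inequality is applied along a horizontal line, and then to \<open>g\<close> and
  \<open>\<partial>\<^sub>1 g\<close> along all vertical lines.\<close>

lemma sobolev_2d: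
  fixes g :: "R2 \<Rightarrow> real"
  assumes g: "smooth g"
  shows "ennreal ((g x)\<^sup>2) \<le> (\<integral>\<^sup>+ x. ennreal (4 * (g x)\<^sup>2 + 2 * (partial e1 g x)\<^sup>2
           + 2 * (partial e2 g x)\<^sup>2 + (partial e2 (partial e1 g) x)\<^sup>2) \<partial>lborel)"
proof -
  obtain a b where x: "x = (a, b)" by (cases x)
  let ?G = "\<lambda>x. 4 * (g x)\<^sup>2 + 2 * (partial e1 g x)\<^sup>2
           + 2 * (partial e2 g x)\<^sup>2 + (partial e2 (partial e1 g) x)\<^sup>2"
  have D1: "((\<lambda>s. k (s, t)) has_real_derivative partial e1 k (s, t)) (at s)"
    and D2: "((\<lambda>t. k (s, t)) has_real_derivative partial e2 k (s, t)) (at t)"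
    if "smooth k" for k :: "R2 \<Rightarrow> real" and s t
    using has_vector_derivative_line1 has_vector_derivative_line2 smooth_differentiable[OF that]
    unfolding has_real_derivative_iff_has_vector_derivative by blast+
  have C: "continuous_on UNIV (\<lambda>s. k (s, t))" "continuous_on UNIV (\<lambda>t. k (s, t))"
    if "smooth k" for k :: "R2 \<Rightarrow> real" and s t
    by (intro continuous_on_compose2[OF smooth_continuous[OF that]] continuous_intros subset_UNIV)+
  have inner: "ennreal (2 * (g (s, b))\<^sup>2 + (partial e1 g (s, b))\<^sup>2)
      \<le> (\<integral>\<^sup>+ t. ennreal (?G (s, t)) \<partial>lborel)" for s
  proof -
    have m: "(\<lambda>t. ennreal (2 * (k (s, t))\<^sup>2 + (partial e2 k (s, t))\<^sup>2)) \<in> borel_measurable lborel"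
      if "smooth k" for k :: "R2 \<Rightarrow> real"
      using that C(2)
      by (intro measurable_compose[OF _ measurable_ennreal])
        (auto intro!: borel_measurable_continuous_onI continuous_intros)
    have "ennreal (2 * (g (s, b))\<^sup>2 + (partial e1 g (s, b))\<^sup>2) =
        2 * ennreal ((g (s, b))\<^sup>2) + ennreal ((partial e1 g (s, b))\<^sup>2)"
      by (simp add: ennreal_plus ennreal_mult)
    also have "\<dots> \<le> 2 * (\<integral>\<^sup>+ t. ennreal (2 * (g (s, t))\<^sup>2 + (partial e2 g (s, t))\<^sup>2) \<partial>lborel)
       + (\<integral>\<^sup>+ t. ennreal (2 * (partial e1 g (s, t))\<^sup>2 + (partial e2 (partial e1 g) (s, t))\<^sup>2) \<partial>lborel)"
      using g by (intro add_mono mult_left_mono sobolev_1d D2 C) auto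
    also have "\<dots> = (\<integral>\<^sup>+ t. 2 * ennreal (2 * (g (s, t))\<^sup>2 + (partial e2 g (s, t))\<^sup>2)
       + ennreal (2 * (partial e1 g (s, t))\<^sup>2 + (partial e2 (partial e1 g) (s, t))\<^sup>2) \<partial>lborel)"
      unfolding nn_integral_cmult[OF m[OF g], symmetric]
      using m g by (intro nn_integral_add[symmetric] borel_measurable_times_ennreal) auto
    also have "\<dots> = (\<integral>\<^sup>+ t. ennreal (?G (s, t)) \<partial>lborel)"
    proof (intro nn_integral_cong)
      have E: "2 * ennreal y + ennreal z = ennreal (2 * y + z)" if "y \<ge> 0" "z \<ge> 0" for y z
        using that by (simp add: ennreal_plus ennreal_mult)
      show "2 * ennreal (2 * (g (s, t))\<^sup>2 + (partial e2 g (s, t))\<^sup>2)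
         + ennreal (2 * (partial e1 g (s, t))\<^sup>2 + (partial e2 (partial e1 g) (s, t))\<^sup>2) = ennreal (?G (s, t))"
        for t
        by (subst E) (simp_all add: algebra_simps)
    qed
    finally show ?thesis .
  qed
  have "ennreal ((g (a, b))\<^sup>2)
      \<le> (\<integral>\<^sup>+ s. ennreal (2 * (g (s, b))\<^sup>2 + (partial e1 g (s, b))\<^sup>2) \<partial>lborel)"
    using g by (intro sobolev_1d[of "\<lambda>s. g (s, b)"] D1 C) auto
  also have "\<dots> \<le> (\<integral>\<^sup>+ s. (\<integral>\<^sup>+ t. ennreal (?G (s, t)) \<partial>lborel) \<partial>lborel)"
    by (intro nn_integral_mono inner)
  also have "\<dots> = (\<integral>\<^sup>+ x. ennreal (?G x) \<partial>(lborel \<Otimes>\<^sub>M lborel))"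
  proof (rule lborel.nn_integral_fst)
    have "continuous_on UNIV ?G"
      using g by (intro continuous_intros smooth_continuous) auto
    then show "(\<lambda>x. ennreal (?G x)) \<in> borel_measurable (lborel \<Otimes>\<^sub>M lborel)"
      unfolding lborel_prod
      by (intro measurable_compose[OF _ measurable_ennreal]) (simp add: borel_measurable_continuous_onI)
  qed
  finally show ?thesis by (simp add: x lborel_prod)
qed

section \<open>The energy estimate\<close>

text \<open>The product \<open>flat_exp 0 (1 + t) flat_exp 0 (1 - t) = exp (- 2 / (1 - t\<^sup>2))\<close> is maximal at \<open>t = 0\<close>, so
  a normalised \<open>box_bump\<close> attains its maximum \<open>1\<close> at the origin.\<close>

lemma cutoff_function:
  obtains \<kappa> where "test_fun \<kappa>" "\<kappa> 0 = 1" "\<And>x. 0 \<le> \<kappa> x" "\<And>x. \<kappa> x \<le> 1"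
proof
  let ?b = "box_bump (-1, -1) (1, 1) 1"
  let ?\<kappa> = "\<lambda>x. exp 4 * ?b x"
  show "test_fun ?\<kappa>"
    using test_fun_box_bump[of 1 "(-1, -1)" "(1, 1)"] unfolding test_fun_iff
    by (auto intro: smooth_cmult)
  have b0: "?b 0 = exp (- 4)"
    by (simp add: box_bump_def flat_exp_def flip: exp_add)
  show "?\<kappa> 0 = 1" by (simp add: b0 flip: exp_add)
  show "0 \<le> ?\<kappa> x" for x using box_bump_range(1) by simp
  have T: "flat_exp 0 (t + 1) * flat_exp 0 (1 - t) \<le> exp (- 2)" for t
  proof (cases "-1 < t \<and> t < 1")
    case True
    then have "inverse (t + 1) + inverse (1 - t) = 2 / (1 - t\<^sup>2)"
      by (simp add: field_simps power2_eq_square)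
    moreover have "t\<^sup>2 < 1" using True by (simp add: abs_square_less_1 abs_less_iff)
    then have "2 \<le> 2 / (1 - t\<^sup>2)" by (simp add: le_divide_eq)
    ultimately show ?thesis
      using True by (simp add: flat_exp_def flip: exp_add)
  qed (auto simp: flat_exp_def)
  have "?b x \<le> exp (- 2) * exp (- 2)" for x
    unfolding box_bump_def
    using T[of "fst x"] T[of "snd x"] flat_exp_0_range
    by (intro mult_mono) auto
  then show "?\<kappa> x \<le> 1" for x
    using mult_left_mono[of "?b x" "exp (-4)" "exp 4"] by (simp flip: exp_add)
qed

text \<open>Young's inequality for the integrand of the energy estimate.  The bracket multiplied by \<open>2\<close> is the
  divergence of \<open>\<kappa>\<^sup>2 w \<nabla>w\<close>, with \<open>\<nabla> = (\<partial>\<^sub>1, \<mu> \<partial>\<^sub>2)\<close> and the equation for \<open>w\<close> inserted, and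
  integrates to \<open>0\<close>; half of \<open>\<kappa>\<^sup>2 \<bar>\<nabla>w\<bar>\<^sup>2\<close> absorbs the other terms
  that contain the gradient.\<close>

lemma energy_pointwise:
  fixes w w1 w2 \<kappa> \<kappa>1 \<kappa>2 f b d \<epsilon> \<tau> B :: real
  assumes "\<bar>b\<bar> \<le> B" "\<bar>d\<bar> \<le> B" "\<tau> > 0"
  shows "\<kappa>\<^sup>2 * (w1\<^sup>2 + w2\<^sup>2) \<le>
    2 * (\<kappa>\<^sup>2 * (w1\<^sup>2 + w2\<^sup>2) + \<kappa>\<^sup>2 * w * (\<epsilon> * (f + b * w1 + d * w2)) + 2 * \<kappa> * w * (\<kappa>1 * w1 + \<kappa>2 * w2))
    + \<kappa>\<^sup>2 * (\<tau> * f\<^sup>2 + (1 / \<tau> + 4 * B\<^sup>2) * (\<epsilon> * w)\<^sup>2) + 8 * (w\<^sup>2 * (\<kappa>1\<^sup>2 + \<kappa>2\<^sup>2))"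
proof -
  define W where "W = \<epsilon> * w"
  have 1: "- (2 * W * f) \<le> \<tau> * f\<^sup>2 + 1 / \<tau> * W\<^sup>2"
  proof -
    have "0 \<le> (sqrt \<tau> * f + W / sqrt \<tau>)\<^sup>2" by simp
    also have "\<dots> = \<tau> * f\<^sup>2 + 2 * W * f + 1 / \<tau> * W\<^sup>2"
      using assms(3) by (simp add: power2_sum power_mult_distrib power_divide)
    finally show ?thesis by simp
  qed
  have 2: "- (2 * W * (c * v)) \<le> 2 * B\<^sup>2 * W\<^sup>2 + v\<^sup>2 / 2" if "\<bar>c\<bar> \<le> B" for c v
  proof -
    have "0 \<le> (2 * (W * c) + v)\<^sup>2" by simp
    then have "- (2 * W * (c * v)) \<le> 2 * (c\<^sup>2 * W\<^sup>2) + v\<^sup>2 / 2"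
      by (simp add: power2_sum power_mult_distrib algebra_simps)
    moreover have "c\<^sup>2 * W\<^sup>2 \<le> B\<^sup>2 * W\<^sup>2"
      using that by (intro mult_right_mono) (auto simp: abs_le_square_iff[symmetric])
    ultimately show ?thesis by simp
  qed
  have 3: "- (4 * \<kappa> * w * (c * v)) \<le> 8 * (w\<^sup>2 * c\<^sup>2) + \<kappa>\<^sup>2 * v\<^sup>2 / 2" for c v
  proof -
    have "0 \<le> (4 * (w * c) + \<kappa> * v)\<^sup>2" by simp
    then show ?thesis
      by (simp add: power2_sum power_mult_distrib algebra_simps)
  qed
  have "- (2 * W * (f + b * w1 + d * w2)) \<le>
      \<tau> * f\<^sup>2 + (1 / \<tau> + 4 * B\<^sup>2) * W\<^sup>2 + (w1\<^sup>2 + w2\<^sup>2) / 2"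
    using 1 2[OF assms(1), of w1] 2[OF assms(2), of w2] by (simp add: algebra_simps add_divide_distrib)
  then have "\<kappa>\<^sup>2 * - (2 * W * (f + b * w1 + d * w2)) \<le>
      \<kappa>\<^sup>2 * (\<tau> * f\<^sup>2 + (1 / \<tau> + 4 * B\<^sup>2) * W\<^sup>2 + (w1\<^sup>2 + w2\<^sup>2) / 2)"
    by (intro mult_left_mono) auto
  then show ?thesis
    using 3[of \<kappa>1 w1] 3[of \<kappa>2 w2] unfolding W_def by (simp add: algebra_simps add_divide_distrib)
qed

lemma integrable_cutoff:
  fixes f :: "R2 \<Rightarrow> real"
  assumes "bounded {x. \<kappa> x \<noteq> (0::real)}" "continuous_on UNIV f" "\<And>x. \<kappa> x = 0 \<Longrightarrow> f x = 0"
  shows "integrable lborel f"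
  using assms by (intro integrable_bounded_support) (auto intro: bounded_subset)

lemma energy_cutoff:
  fixes w f b d \<kappa> :: "R2 \<Rightarrow> real"
  assumes w: "smooth w" and f: "continuous_on UNIV f" and \<kappa>: "test_fun \<kappa>"
    and \<kappa>01: "\<And>x. 0 \<le> \<kappa> x" "\<And>x. \<kappa> x \<le> 1"
    and \<kappa>': "\<And>x. \<bar>partial e1 \<kappa> x\<bar> \<le> C" "\<And>x. \<bar>partial e2 \<kappa> x\<bar> \<le> C"
    and eq: "\<And>x. partial e1 (partial e1 w) x + \<mu>\<^sup>2 * partial e2 (partial e2 w) x =
       \<epsilon> * (f x + b x * partial e1 w x + d x * (\<mu> * partial e2 w x))"
    and B: "\<And>x. \<bar>b x\<bar> \<le> B" "\<And>x. \<bar>d x\<bar> \<le> B" and \<tau>: "\<tau> > 0"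
  shows "(\<integral>\<^sup>+ x. ennreal ((\<kappa> x)\<^sup>2 * ((partial e1 w x)\<^sup>2 + (\<mu> * partial e2 w x)\<^sup>2)) \<partial>lborel)
    \<le> (\<integral>\<^sup>+ x. ennreal (\<tau> * (f x)\<^sup>2 + (1 / \<tau> + 4 * B\<^sup>2) * (\<epsilon> * w x)\<^sup>2) \<partial>lborel)
     + ennreal (8 * (C\<^sup>2 * (1 + \<mu>\<^sup>2))) * (\<integral>\<^sup>+ x. ennreal ((w x)\<^sup>2) \<partial>lborel)"
proof -
  have s\<kappa>: "smooth \<kappa>" and b\<kappa>: "bounded {x. \<kappa> x \<noteq> 0}" using \<kappa> by (auto simp: test_fun_iff)
  let ?w1 = "partial e1 w" and ?w2 = "\<lambda>x. \<mu> * partial e2 w x"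
  let ?\<kappa>1 = "partial e1 \<kappa>" and ?\<kappa>2 = "\<lambda>x. \<mu> * partial e2 \<kappa> x"
  let ?X1 = "\<lambda>x. (\<kappa> x * \<kappa> x) * (w x * partial e1 w x)"
  let ?X2 = "\<lambda>x. (\<kappa> x * \<kappa> x) * (w x * partial e2 w x)"
  let ?D = "\<lambda>x. (\<kappa> x)\<^sup>2 * ((?w1 x)\<^sup>2 + (?w2 x)\<^sup>2)"
  let ?E = "\<lambda>x. (\<kappa> x)\<^sup>2 * (\<tau> * (f x)\<^sup>2 + (1 / \<tau> + 4 * B\<^sup>2) * (\<epsilon> * w x)\<^sup>2)"
  let ?H = "\<lambda>x. 8 * ((w x)\<^sup>2 * ((?\<kappa>1 x)\<^sup>2 + (?\<kappa>2 x)\<^sup>2))"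
  let ?I = "\<lambda>x. partial e1 ?X1 x + \<mu>\<^sup>2 * partial e2 ?X2 x"
  have sX: "smooth ?X1" "smooth ?X2" using w s\<kappa> by (auto intro!: smooth_mult)
  have bX: "bounded {x. ?X1 x \<noteq> 0}" "bounded {x. ?X2 x \<noteq> 0}"
    by (rule bounded_subset[OF b\<kappa>], force)+
  have cw: "continuous_on UNIV w" "continuous_on UNIV ?w1" "continuous_on UNIV (partial e2 w)"
     "continuous_on UNIV \<kappa>" "continuous_on UNIV ?\<kappa>1" "continuous_on UNIV (partial e2 \<kappa>)"
    using w s\<kappa> by (auto intro: smooth_continuous)
  have I: "?I x = (\<kappa> x)\<^sup>2 * ((?w1 x)\<^sup>2 + (?w2 x)\<^sup>2)
      + (\<kappa> x)\<^sup>2 * w x * (\<epsilon> * (f x + b x * ?w1 x + d x * ?w2 x))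
      + 2 * \<kappa> x * w x * (?\<kappa>1 x * ?w1 x + ?\<kappa>2 x * ?w2 x)" for x
  proof -
    have "partial e X x = (\<kappa> x)\<^sup>2 * ((partial e w x)\<^sup>2 + w x * partial e (partial e w) x)
       + 2 * \<kappa> x * w x * (partial e \<kappa> x * partial e w x)"
      if "e = e1 \<or> e = e2" "X = (\<lambda>x. (\<kappa> x * \<kappa> x) * (w x * partial e w x))" for e X
      unfolding that(2) using that(1) w s\<kappa>
      by (simp add: partial_mult smooth_mult smooth_partial power2_eq_square algebra_simps)
    note this[OF _ refl]
    then have "?I x = (\<kappa> x)\<^sup>2 * ((?w1 x)\<^sup>2 + (?w2 x)\<^sup>2)
      + (\<kappa> x)\<^sup>2 * w x * (partial e1 (partial e1 w) x + \<mu>\<^sup>2 * partial e2 (partial e2 w) x)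
      + 2 * \<kappa> x * w x * (?\<kappa>1 x * ?w1 x + ?\<kappa>2 x * ?w2 x)"
      by (simp add: algebra_simps power2_eq_square)
    then show ?thesis unfolding eq .
  qed
  have intX: "integrable lborel (partial e1 ?X1)" "integrable lborel (partial e2 ?X2)"
    using sX bX
    by (auto intro!: integrable_bounded_support smooth_continuous bounded_support_partial)
  have "(LINT x|lborel. ?I x) = 0"
    using intX sX bX by (simp add: integral_partial_eq_0)
  have intI: "integrable lborel ?I" using intX by simp
  have intD: "integrable lborel ?D" and intE: "integrable lborel ?E"
    by (rule integrable_cutoff[OF b\<kappa>], (intro continuous_intros cw f), simp)+
  have intH: "integrable lborel ?H"
  proof (rule integrable_bounded_support)
    show "continuous_on UNIV ?H" by (intro continuous_intros cw)
    have "bounded ({x. partial e1 \<kappa> x \<noteq> 0} \<union> {x. partial e2 \<kappa> x \<noteq> 0})"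
      using b\<kappa> by (simp add: bounded_support_partial)
    then show "bounded {x. ?H x \<noteq> 0}" by (rule bounded_subset) force
  qed
  have int2I: "integrable lborel (\<lambda>x. 2 * ?I x)"
    by (rule integrable_mult_right) (rule intI)
  note intIE = Bochner_Integration.integrable_add[OF int2I intE]
  have "(LINT x|lborel. ?D x) \<le> (LINT x|lborel. 2 * ?I x + ?E x + ?H x)"
  proof (rule integral_mono)
    show "integrable lborel (\<lambda>x. 2 * ?I x + ?E x + ?H x)"
      by (rule Bochner_Integration.integrable_add[OF intIE intH])
    show "?D x \<le> 2 * ?I x + ?E x + ?H x" for x
      unfolding I by (rule energy_pointwise[OF B \<tau>])
  qed (rule intD)
  also have "\<dots> = (LINT x|lborel. ?E x) + (LINT x|lborel. ?H x)"
  proof -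
    have "(LINT x|lborel. 2 * ?I x + ?E x + ?H x) = (LINT x|lborel. 2 * ?I x + ?E x) + (LINT x|lborel. ?H x)"
      by (rule Bochner_Integration.integral_add[OF intIE intH])
    also have "(LINT x|lborel. 2 * ?I x + ?E x) = (LINT x|lborel. 2 * ?I x) + (LINT x|lborel. ?E x)"
      by (rule Bochner_Integration.integral_add[OF int2I intE])
    also have "(LINT x|lborel. 2 * ?I x) = 2 * (LINT x|lborel. ?I x)"
      by (rule integral_mult_right_zero)
    finally show ?thesis using \<open>(LINT x|lborel. ?I x) = 0\<close> by simp
  qed
  finally have "ennreal (LINT x|lborel. ?D x) \<le> ennreal ((LINT x|lborel. ?E x) + (LINT x|lborel. ?H x))"
    by (rule ennreal_leI)
  also have "\<dots> = ennreal (LINT x|lborel. ?E x) + ennreal (LINT x|lborel. ?H x)"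
    using \<tau> by (intro ennreal_plus integral_nonneg) auto
  also have "ennreal (LINT x|lborel. ?D x) = (\<integral>\<^sup>+ x. ennreal (?D x) \<partial>lborel)"
    by (rule nn_integral_eq_integral[symmetric, OF intD]) auto
  also have "ennreal (LINT x|lborel. ?E x) = (\<integral>\<^sup>+ x. ennreal (?E x) \<partial>lborel)"
    using \<tau> by (intro nn_integral_eq_integral[symmetric, OF intE]) auto
  also have "ennreal (LINT x|lborel. ?H x) = (\<integral>\<^sup>+ x. ennreal (?H x) \<partial>lborel)"
    by (rule nn_integral_eq_integral[symmetric, OF intH]) auto
  also have "(\<integral>\<^sup>+ x. ennreal (?E x) \<partial>lborel) \<le>
      (\<integral>\<^sup>+ x. ennreal (\<tau> * (f x)\<^sup>2 + (1 / \<tau> + 4 * B\<^sup>2) * (\<epsilon> * w x)\<^sup>2) \<partial>lborel)"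
    using \<tau> \<kappa>01 by (intro nn_integral_mono ennreal_leI mult_left_le_one_le) (auto simp: power_le_one)
  also have "(\<integral>\<^sup>+ x. ennreal (?H x) \<partial>lborel) \<le>
      (\<integral>\<^sup>+ x. ennreal (8 * (C\<^sup>2 * (1 + \<mu>\<^sup>2))) * ennreal ((w x)\<^sup>2) \<partial>lborel)"
  proof (rule nn_integral_mono)
    fix x
    have c: "(partial e1 \<kappa> x)\<^sup>2 \<le> C\<^sup>2" "(partial e2 \<kappa> x)\<^sup>2 \<le> C\<^sup>2"
      using \<kappa>'[of x] by (auto simp: abs_le_square_iff[symmetric])
    have "(?\<kappa>1 x)\<^sup>2 + (?\<kappa>2 x)\<^sup>2 \<le> C\<^sup>2 + \<mu>\<^sup>2 * C\<^sup>2"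
      unfolding power_mult_distrib using c by (intro add_mono mult_left_mono) auto
    then have "?H x \<le> 8 * (C\<^sup>2 * (1 + \<mu>\<^sup>2)) * (w x)\<^sup>2"
      using mult_left_mono[of _ _ "(w x)\<^sup>2"] by (fastforce simp: algebra_simps)
    then show "ennreal (?H x) \<le> ennreal (8 * (C\<^sup>2 * (1 + \<mu>\<^sup>2))) * ennreal ((w x)\<^sup>2)"
      by (simp add: ennreal_leI flip: ennreal_mult)
  qed
  also have "(\<integral>\<^sup>+ x. ennreal (8 * (C\<^sup>2 * (1 + \<mu>\<^sup>2))) * ennreal ((w x)\<^sup>2) \<partial>lborel) =
      ennreal (8 * (C\<^sup>2 * (1 + \<mu>\<^sup>2))) * (\<integral>\<^sup>+ x. ennreal ((w x)\<^sup>2) \<partial>lborel)"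
    using cw(1) by (intro nn_integral_cmult measurable_compose[OF _ measurable_ennreal])
      (auto intro!: borel_measurable_continuous_onI continuous_intros)
  finally show ?thesis by (simp add: add_mono)
qed

text \<open>The estimate with a cut-off function of width \<open>R\<close> has an
  error \<open>O(R\<^sup>-\<^sup>2) \<integral> w\<^sup>2\<close>, and Fatou's lemma gives the limit \<open>R \<rightarrow> \<infinity>\<close>.  The parameter \<open>\<tau>\<close> trades the
  size of the source term against that of \<open>\<epsilon> w\<close>.\<close>

lemma energy_estimate:
  fixes w f b d :: "R2 \<Rightarrow> real"
  assumes w: "smooth w" and f: "continuous_on UNIV f"
    and eq: "\<And>x. partial e1 (partial e1 w) x + \<mu>\<^sup>2 * partial e2 (partial e2 w) x =
       \<epsilon> * (f x + b x * partial e1 w x + d x * (\<mu> * partial e2 w x))"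
    and B: "\<And>x. \<bar>b x\<bar> \<le> B" "\<And>x. \<bar>d x\<bar> \<le> B" and \<tau>: "\<tau> > 0"
    and fin: "(\<integral>\<^sup>+ x. ennreal ((w x)\<^sup>2) \<partial>lborel) < \<infinity>"
  shows "(\<integral>\<^sup>+ x. ennreal ((partial e1 w x)\<^sup>2 + (\<mu> * partial e2 w x)\<^sup>2) \<partial>lborel)
    \<le> (\<integral>\<^sup>+ x. ennreal (\<tau> * (f x)\<^sup>2 + (1 / \<tau> + 4 * B\<^sup>2) * (\<epsilon> * w x)\<^sup>2) \<partial>lborel)"
    (is "_ \<le> ?A")
proof -
  obtain \<kappa> where \<kappa>: "test_fun \<kappa>" "\<kappa> 0 = 1" "\<And>x. 0 \<le> \<kappa> x" "\<And>x. \<kappa> x \<le> 1"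
    by (rule cutoff_function) blast
  have s\<kappa>: "smooth \<kappa>" and b\<kappa>: "bounded {x. \<kappa> x \<noteq> 0}" using \<kappa> by (auto simp: test_fun_iff)
  have bd: "\<exists>C. \<forall>x. \<bar>partial e \<kappa> x\<bar> \<le> C" if "e = e1 \<or> e = e2" for e
  proof -
    have "bounded {x. partial e \<kappa> x \<noteq> 0}" by (rule bounded_support_partial[OF b\<kappa>])
    then have "compact (closure {x. partial e \<kappa> x \<noteq> 0})" using compact_support_iff by blast
    then have "compact (partial e \<kappa> ` closure {x. partial e \<kappa> x \<noteq> 0})"
      using s\<kappa> that
      by (intro compact_continuous_image continuous_on_subset[OF smooth_continuous]) (auto intro: smooth_partial)
    then obtain C where C: "\<forall>y\<in>partial e \<kappa> ` closure {x. partial e \<kappa> x \<noteq> 0}. norm y \<le> C"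
      using compact_imp_bounded bounded_iff by blast
    have "\<bar>partial e \<kappa> x\<bar> \<le> \<bar>C\<bar>" for x
    proof (cases "partial e \<kappa> x = 0")
      case False
      then have "x \<in> closure {x. partial e \<kappa> x \<noteq> 0}"
        using closure_subset[of "{x. partial e \<kappa> x \<noteq> 0}"] by blast
      then show ?thesis using C by fastforce
    qed simp
    then show ?thesis by blast
  qed
  obtain C1 C2 where C12: "\<forall>x. \<bar>partial e1 \<kappa> x\<bar> \<le> C1" "\<forall>x. \<bar>partial e2 \<kappa> x\<bar> \<le> C2"
    using bd[of e1] bd[of e2] by auto
  define C where "C = max C1 C2"
  have C: "\<bar>partial e1 \<kappa> x\<bar> \<le> C" "\<bar>partial e2 \<kappa> x\<bar> \<le> C" for x
    using C12[rule_format, of x] by (auto simp: C_def)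
  define r where "r n = inverse (real (Suc n))" for n
  have r: "r n > 0" for n by (simp add: r_def)
  define \<kappa>r where "\<kappa>r n x = \<kappa> (r n * fst x, r n * snd x)" for n and x :: R2
  let ?D = "\<lambda>x. (partial e1 w x)\<^sup>2 + (\<mu> * partial e2 w x)\<^sup>2"
  let ?W = "\<integral>\<^sup>+ x. ennreal ((w x)\<^sup>2) \<partial>lborel"
  have step: "(\<integral>\<^sup>+ x. ennreal ((\<kappa>r n x)\<^sup>2 * ?D x) \<partial>lborel) \<le>
      ?A + ennreal (8 * ((C * r n)\<^sup>2 * (1 + \<mu>\<^sup>2))) * ?W" for n
  proof (rule energy_cutoff[OF w f _ _ _ _ _ eq B \<tau>])
    have sr: "smooth (\<kappa>r n)" unfolding \<kappa>r_def by (rule smooth_scale[OF s\<kappa>])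
    moreover have "bounded {x. \<kappa>r n x \<noteq> 0}"
    proof -
      have "{x. \<kappa>r n x \<noteq> 0} \<subseteq> (\<lambda>x. inverse (r n) *\<^sub>R x) ` {x. \<kappa> x \<noteq> 0}"
      proof
        fix x assume "x \<in> {x. \<kappa>r n x \<noteq> 0}"
        moreover have "x = inverse (r n) *\<^sub>R (r n * fst x, r n * snd x)"
          using r[of n] by (simp add: prod_eq_iff)
        ultimately show "x \<in> (\<lambda>x. inverse (r n) *\<^sub>R x) ` {x. \<kappa> x \<noteq> 0}"
          unfolding \<kappa>r_def by blast
      qed
      then show ?thesis
        using bounded_scaling[OF b\<kappa>] bounded_subset by blast
    qed
    ultimately show "test_fun (\<kappa>r n)" by (simp add: test_fun_iff)
    show "0 \<le> \<kappa>r n x" "\<kappa>r n x \<le> 1" for x using \<kappa> by (auto simp: \<kappa>r_def)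
    show "\<bar>partial e1 (\<kappa>r n) x\<bar> \<le> C * r n" "\<bar>partial e2 (\<kappa>r n) x\<bar> \<le> C * r n" for x
      unfolding \<kappa>r_def using C r[of n]
      by (simp_all add: partial_scale smooth_differentiable[OF s\<kappa>] abs_mult mult.commute[of C])
  qed
  have "(\<integral>\<^sup>+ x. ennreal (?D x) \<partial>lborel) = (\<integral>\<^sup>+ x. liminf (\<lambda>n. ennreal ((\<kappa>r n x)\<^sup>2 * ?D x)) \<partial>lborel)"
  proof (intro nn_integral_cong)
    fix x
    have r0: "r \<longlonglongrightarrow> 0" unfolding r_def by (rule LIMSEQ_inverse_real_of_nat)
    have "(\<lambda>n. (r n * fst x, r n * snd x)) \<longlonglongrightarrow> (0 * fst x, 0 * snd x)"
      by (intro tendsto_intros r0)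
    then have "(\<lambda>n. \<kappa>r n x) \<longlonglongrightarrow> \<kappa> 0"
      unfolding \<kappa>r_def
      by (intro continuous_on_tendsto_compose[OF smooth_continuous[OF s\<kappa>]]) (auto simp: zero_prod_def)
    then have "(\<lambda>n. ennreal ((\<kappa>r n x)\<^sup>2 * ?D x)) \<longlonglongrightarrow> ennreal (1\<^sup>2 * ?D x)"
      unfolding \<kappa>(2) by (intro tendsto_ennrealI tendsto_intros)
    then show "ennreal (?D x) = liminf (\<lambda>n. ennreal ((\<kappa>r n x)\<^sup>2 * ?D x))"
      by (simp add: lim_imp_Liminf)
  qed
  also have "\<dots> \<le> liminf (\<lambda>n. \<integral>\<^sup>+ x. ennreal ((\<kappa>r n x)\<^sup>2 * ?D x) \<partial>lborel)"
  proof (rule nn_integral_liminf)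
    fix n
    have "continuous_on UNIV (\<lambda>x. (\<kappa>r n x)\<^sup>2 * ?D x)"
      unfolding \<kappa>r_def using w s\<kappa> by (intro continuous_intros smooth_continuous smooth_scale) auto
    then show "(\<lambda>x. ennreal ((\<kappa>r n x)\<^sup>2 * ?D x)) \<in> borel_measurable lborel"
      by (intro measurable_compose[OF _ measurable_ennreal]) (simp add: borel_measurable_continuous_onI)
  qed
  also have "\<dots> \<le> liminf (\<lambda>n. ?A + ennreal (8 * ((C * r n)\<^sup>2 * (1 + \<mu>\<^sup>2))) * ?W)"
    by (intro Liminf_mono always_eventually allI step)
  also have "\<dots> = ?A"
  proof -
    have "(\<lambda>n. 8 * ((C * r n)\<^sup>2 * (1 + \<mu>\<^sup>2))) \<longlonglongrightarrow> 8 * ((C * 0)\<^sup>2 * (1 + \<mu>\<^sup>2))"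
      unfolding r_def by (intro tendsto_intros LIMSEQ_inverse_real_of_nat)
    then have "(\<lambda>n. ennreal (8 * ((C * r n)\<^sup>2 * (1 + \<mu>\<^sup>2)))) \<longlonglongrightarrow> ennreal 0"
      by (intro tendsto_ennrealI) simp
    then have "(\<lambda>n. ?A + ennreal (8 * ((C * r n)\<^sup>2 * (1 + \<mu>\<^sup>2))) * ?W) \<longlonglongrightarrow> ?A + ennreal 0 * ?W"
      unfolding mult.commute[of _ ?W] using fin
      by (intro tendsto_add tendsto_const ennreal_tendsto_cmult) (simp_all add: less_top)
    then show ?thesis by (simp add: lim_imp_Liminf)
  qed
  finally show ?thesis .
qed

section \<open>Sequences of smooth functions controlled with all their derivatives\<close>

text \<open>For finite \<open>q\<close> the constant bounds the integral of the \<open>q\<close>-th power, not the norm.  Smallness and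
  boundedness are the same for both, and the power integral obeys simple pointwise estimates.\<close>

definition Lq_le :: "ereal \<Rightarrow> real \<Rightarrow> (R2 \<Rightarrow> real) \<Rightarrow> bool" where
  "Lq_le q C g \<longleftrightarrow>
    (if q = \<infinity> then AE x in lebesgue. \<bar>g x\<bar> \<le> C
     else (\<integral>\<^sup>+ x. ennreal (\<bar>g x\<bar> powr real_of_ereal q) \<partial>lebesgue) \<le> ennreal C)"

definition bounded_in :: "ereal \<Rightarrow> (nat \<Rightarrow> R2 \<Rightarrow> real) \<Rightarrow> bool" where
  "bounded_in q F \<longleftrightarrow> (\<exists>C. \<forall>\<^sub>F n in sequentially. Lq_le q C (F n))"

definition null_in :: "ereal \<Rightarrow> (nat \<Rightarrow> R2 \<Rightarrow> real) \<Rightarrow> bool" where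
  "null_in q F \<longleftrightarrow> (\<forall>e>0. \<forall>\<^sub>F n in sequentially. Lq_le q e (F n))"

lemma Lq_le_mono: "Lq_le q C f \<Longrightarrow> C \<le> D \<Longrightarrow> Lq_le q D f"
proof (cases "q = \<infinity>")
  case True
  assume "Lq_le q C f" "C \<le> D"
  then have "AE x in lebesgue. \<bar>f x\<bar> \<le> C" using True by (simp add: Lq_le_def)
  then have "AE x in lebesgue. \<bar>f x\<bar> \<le> D" by eventually_elim (use \<open>C \<le> D\<close> in linarith)
  with True show ?thesis by (simp add: Lq_le_def)
next
  case False
  assume "Lq_le q C f" "C \<le> D"
  with False show ?thesis
    using ennreal_leI[of C D] by (auto simp: Lq_le_def)
qed

lemma continuous_AE_le:
  fixes f :: "R2 \<Rightarrow> real"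
  assumes f: "continuous_on UNIV f" and ae: "AE x in lebesgue. f x \<le> C"
  shows "f x \<le> C"
proof (rule ccontr)
  assume "\<not> f x \<le> C"
  then have "x \<in> {x. f x > C}" by simp
  moreover have op: "open {x. f x > C}" using f by (intro open_Collect_less continuous_on_const)
  moreover have "emeasure lebesgue {x. f x > C} = 0"
    using AE_iff_measurable[of "{x. f x > C}" lebesgue "\<lambda>x. f x \<le> C"] op ae by (simp add: not_le)
  ultimately show False
    using open_not_negligible[OF op] by (auto simp: negligible_iff_null_sets null_sets_def)
qed

lemma Lq_le_uniformD:
  assumes "continuous_on UNIV f" "Lq_le \<infinity> C f"
  shows "\<bar>f x\<bar> \<le> C"
  using assms by (intro continuous_AE_le[of "\<lambda>x. \<bar>f x\<bar>"] continuous_on_rabs) (simp_all add: Lq_le_def)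

lemma bounded_inE:
  assumes "bounded_in q F"
  obtains C where "C > 0" "\<forall>\<^sub>F n in sequentially. Lq_le q C (F n)"
proof -
  from assms obtain C where C: "\<forall>\<^sub>F n in sequentially. Lq_le q C (F n)"
    unfolding bounded_in_def by blast
  show ?thesis
  proof (rule that[of "\<bar>C\<bar> + 1"])
    show "\<forall>\<^sub>F n in sequentially. Lq_le q (\<bar>C\<bar> + 1) (F n)"
      using C by (rule eventually_mono) (erule Lq_le_mono, simp)
  qed simp
qed

lemma null_in_imp_bounded_in: "null_in q F \<Longrightarrow> bounded_in q F"
  unfolding null_in_def bounded_in_def using zero_less_one by blast

lemma powr_add_le:
  fixes a b r :: real
  assumes "r \<ge> 0"
  shows "\<bar>a + b\<bar> powr r \<le> 2 powr r * (\<bar>a\<bar> powr r + \<bar>b\<bar> powr r)"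
proof -
  have "\<bar>a + b\<bar> powr r \<le> (2 * max \<bar>a\<bar> \<bar>b\<bar>) powr r"
    using assms by (intro powr_mono2) auto
  also have "\<dots> = 2 powr r * (max \<bar>a\<bar> \<bar>b\<bar>) powr r"
    by (simp add: powr_mult)
  also have "\<dots> \<le> 2 powr r * (\<bar>a\<bar> powr r + \<bar>b\<bar> powr r)"
    by (intro mult_left_mono) (auto simp: max_def)
  finally show ?thesis .
qed

lemma Lq_le_add:
  assumes "Lq_le q C f" "Lq_le q C g" "q \<ge> 0" "C \<ge> 0"
    "f \<in> borel_measurable lebesgue" "g \<in> borel_measurable lebesgue"
  shows "Lq_le q (2 * (if q = \<infinity> then 1 else 2 powr real_of_ereal q) * C) (\<lambda>x. f x + g x)"
proof (cases "q = \<infinity>")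
  case True
  with assms have "AE x in lebesgue. \<bar>f x\<bar> \<le> C" "AE x in lebesgue. \<bar>g x\<bar> \<le> C"
    by (simp_all add: Lq_le_def)
  then have "AE x in lebesgue. \<bar>f x + g x\<bar> \<le> 2 * C" by eventually_elim linarith
  with True show ?thesis by (simp add: Lq_le_def)
next
  case False
  let ?r = "real_of_ereal q"
  have r: "?r \<ge> 0" using assms(3) False by (cases q) auto
  have "(\<integral>\<^sup>+ x. ennreal (\<bar>f x + g x\<bar> powr ?r) \<partial>lebesgue)
      \<le> (\<integral>\<^sup>+ x. ennreal (2 powr ?r) * (ennreal (\<bar>f x\<bar> powr ?r) + ennreal (\<bar>g x\<bar> powr ?r)) \<partial>lebesgue)"
    using powr_add_le[OF r] by (intro nn_integral_mono)
      (simp add: ennreal_leI flip: ennreal_plus ennreal_mult)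
  also have "\<dots> = ennreal (2 powr ?r) * ((\<integral>\<^sup>+ x. ennreal (\<bar>f x\<bar> powr ?r) \<partial>lebesgue)
      + (\<integral>\<^sup>+ x. ennreal (\<bar>g x\<bar> powr ?r) \<partial>lebesgue))"
    using assms(5,6) by (subst nn_integral_cmult) (auto simp: nn_integral_add)
  also have "\<dots> \<le> ennreal (2 powr ?r) * (ennreal C + ennreal C)"
    using assms(1,2) False by (intro mult_left_mono add_mono) (auto simp: Lq_le_def)
  also have "\<dots> = ennreal (2 * 2 powr ?r * C)"
    using assms(4) by (simp add: algebra_simps flip: ennreal_plus ennreal_mult)
  finally show ?thesis using False by (simp add: Lq_le_def)
qed

lemma Lq_le_mult:
  assumes b: "\<And>x. \<bar>b x\<bar> \<le> B" and f: "Lq_le q C f" and "q \<ge> 0" "C \<ge> 0" "f \<in> borel_measurable lebesgue"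
  shows "Lq_le q ((if q = \<infinity> then B else B powr real_of_ereal q) * C) (\<lambda>x. b x * f x)"
proof (cases "q = \<infinity>")
  case True
  with f have "AE x in lebesgue. \<bar>f x\<bar> \<le> C" by (simp add: Lq_le_def)
  then have "AE x in lebesgue. \<bar>b x * f x\<bar> \<le> B * C"
    by eventually_elim (use b order_trans[OF abs_ge_zero b] in \<open>auto simp: abs_mult intro!: mult_mono\<close>)
  with True show ?thesis by (simp add: Lq_le_def)
next
  case False
  let ?r = "real_of_ereal q"
  have r: "?r \<ge> 0" using assms(3) False by (cases q) auto
  have "(\<integral>\<^sup>+ x. ennreal (\<bar>b x * f x\<bar> powr ?r) \<partial>lebesgue)
      \<le> (\<integral>\<^sup>+ x. ennreal (B powr ?r) * ennreal (\<bar>f x\<bar> powr ?r) \<partial>lebesgue)"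
  proof (rule nn_integral_mono)
    fix x
    have "\<bar>b x * f x\<bar> powr ?r \<le> B powr ?r * \<bar>f x\<bar> powr ?r"
      using b[of x] r by (simp add: abs_mult powr_mult powr_mono2 mult_right_mono)
    then show "ennreal (\<bar>b x * f x\<bar> powr ?r) \<le> ennreal (B powr ?r) * ennreal (\<bar>f x\<bar> powr ?r)"
      by (simp add: ennreal_leI flip: ennreal_mult)
  qed
  also have "\<dots> = ennreal (B powr ?r) * (\<integral>\<^sup>+ x. ennreal (\<bar>f x\<bar> powr ?r) \<partial>lebesgue)"
    using assms(5) by (intro nn_integral_cmult) simp
  also have "\<dots> \<le> ennreal (B powr ?r) * ennreal C"
    using f False by (intro mult_left_mono) (auto simp: Lq_le_def)
  also have "\<dots> = ennreal (B powr ?r * C)"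
    using assms(4) by (simp flip: ennreal_mult)
  finally show ?thesis using False by (simp add: Lq_le_def)
qed

definition smooth_seq :: "(nat \<Rightarrow> R2 \<Rightarrow> real) \<Rightarrow> bool" where
  "smooth_seq F \<longleftrightarrow> (\<forall>n. smooth (F n))"

lemma smooth_seqD: "smooth_seq F \<Longrightarrow> smooth (F n)"
  by (simp add: smooth_seq_def)

lemma smooth_seq_measurable: "smooth_seq F \<Longrightarrow> F n \<in> borel_measurable lebesgue"
  by (simp add: smooth_seq_def lebesgue_measurable_continuous smooth_continuous)

lemma smooth_seq_uniformD: "smooth_seq F \<Longrightarrow> Lq_le \<infinity> C (F n) \<Longrightarrow> \<bar>F n x\<bar> \<le> C"
  by (simp add: smooth_seq_def Lq_le_uniformD smooth_continuous)

lemma smooth_seq_const [simp]: "smooth_seq (\<lambda>n x. c n)"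
  by (simp add: smooth_seq_def)

lemma smooth_seq_intros [intro]:
  "smooth_seq (\<lambda>n x. c n)"
  "smooth_seq F \<Longrightarrow> smooth_seq (\<lambda>n. partial e1 (F n))"
  "smooth_seq F \<Longrightarrow> smooth_seq (\<lambda>n. partial e2 (F n))"
  "smooth_seq F \<Longrightarrow> smooth_seq G \<Longrightarrow> smooth_seq (\<lambda>n x. F n x + G n x)"
  "smooth_seq F \<Longrightarrow> smooth_seq G \<Longrightarrow> smooth_seq (\<lambda>n x. F n x * G n x)"
  "smooth_seq F \<Longrightarrow> smooth_seq (\<lambda>n x. a n * F n x)"
  by (auto simp: smooth_seq_def intro: smooth_cmult)

lemma bounded_in_add:
  assumes "q \<ge> 0" "smooth_seq F" "smooth_seq G" "bounded_in q F" "bounded_in q G"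
  shows "bounded_in q (\<lambda>n x. F n x + G n x)"
proof -
  obtain C D where C: "C > 0" "\<forall>\<^sub>F n in sequentially. Lq_le q C (F n)"
    and D: "D > 0" "\<forall>\<^sub>F n in sequentially. Lq_le q D (G n)"
    using assms(4,5) by (auto elim!: bounded_inE)
  have "\<forall>\<^sub>F n in sequentially. Lq_le q (2 * (if q = \<infinity> then 1 else 2 powr real_of_ereal q) * (C + D))
      (\<lambda>x. F n x + G n x)"
    using C(2) D(2)
  proof eventually_elim
    case (elim n)
    then show ?case
      using C(1) D(1) assms(1-3)
      by (intro Lq_le_add smooth_seq_measurable) (auto intro: Lq_le_mono)
  qed
  then show ?thesis unfolding bounded_in_def by blast
qed

lemma null_in_add:
  assumes "q \<ge> 0" "smooth_seq F" "smooth_seq G" "null_in q F" "null_in q G"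
  shows "null_in q (\<lambda>n x. F n x + G n x)"
  unfolding null_in_def
proof (intro allI impI)
  fix e :: real assume e: "e > 0"
  define K where "K = 2 * (if q = \<infinity> then 1 else 2 powr real_of_ereal q)"
  have K: "K > 0" by (auto simp: K_def)
  with e have eK: "e / K > 0" by simp
  have "\<forall>\<^sub>F n in sequentially. Lq_le q (e / K) (F n)" "\<forall>\<^sub>F n in sequentially. Lq_le q (e / K) (G n)"
    using assms(4,5) eK unfolding null_in_def by blast+
  then show "\<forall>\<^sub>F n in sequentially. Lq_le q e (\<lambda>x. F n x + G n x)"
  proof eventually_elim
    case (elim n)
    then have "Lq_le q (K * (e / K)) (\<lambda>x. F n x + G n x)"
      unfolding K_def using assms(1-3) eK unfolding K_def
      by (intro Lq_le_add smooth_seq_measurable) auto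
    then show ?case using K by simp
  qed
qed

lemma bounded_in_mult:
  assumes "q \<ge> 0" "smooth_seq F" "smooth_seq G" "bounded_in \<infinity> F" "bounded_in q G"
  shows "bounded_in q (\<lambda>n x. F n x * G n x)"
proof -
  obtain B C where B: "B > 0" "\<forall>\<^sub>F n in sequentially. Lq_le \<infinity> B (F n)"
    and C: "C > 0" "\<forall>\<^sub>F n in sequentially. Lq_le q C (G n)"
    using assms(4,5) by (auto elim!: bounded_inE)
  have "\<forall>\<^sub>F n in sequentially. Lq_le q ((if q = \<infinity> then B else B powr real_of_ereal q) * C)
      (\<lambda>x. F n x * G n x)"
    using B(2) C(2)
  proof eventually_elim
    case (elim n)
    then show ?case
      using C(1) assms(1-3) by (intro Lq_le_mult smooth_seq_measurable) (auto intro: smooth_seq_uniformD)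
  qed
  then show ?thesis unfolding bounded_in_def by blast
qed

lemma null_in_mult:
  assumes "q \<ge> 0" "smooth_seq F" "smooth_seq G" "bounded_in \<infinity> F" "null_in q G"
  shows "null_in q (\<lambda>n x. F n x * G n x)"
  unfolding null_in_def
proof (intro allI impI)
  fix e :: real assume e: "e > 0"
  obtain B where B: "B > 0" "\<forall>\<^sub>F n in sequentially. Lq_le \<infinity> B (F n)"
    using assms(4) by (rule bounded_inE)
  define K where "K = (if q = \<infinity> then B else B powr real_of_ereal q)"
  have K: "K > 0" using B by (auto simp: K_def)
  with e have eK: "e / K > 0" by simp
  have "\<forall>\<^sub>F n in sequentially. Lq_le q (e / K) (G n)"
    using assms(5) eK unfolding null_in_def by blast
  with B(2) show "\<forall>\<^sub>F n in sequentially. Lq_le q e (\<lambda>x. F n x * G n x)"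
  proof eventually_elim
    case (elim n)
    then have "Lq_le q (K * (e / K)) (\<lambda>x. F n x * G n x)"
      unfolding K_def using assms(1-3) eK unfolding K_def
      by (intro Lq_le_mult smooth_seq_measurable) (auto intro: smooth_seq_uniformD)
    then show ?case using K by simp
  qed
qed

lemma null_in_mult':
  assumes "q > 0" "smooth_seq F" "smooth_seq G" "null_in \<infinity> F" "bounded_in q G"
  shows "null_in q (\<lambda>n x. F n x * G n x)"
  unfolding null_in_def
proof (intro allI impI)
  fix e :: real assume e: "e > 0"
  obtain C where C: "C > 0" "\<forall>\<^sub>F n in sequentially. Lq_le q C (G n)"
    using assms(5) by (rule bounded_inE)
  define B where "B = (if q = \<infinity> then e / C else (e / C) powr (1 / real_of_ereal q))"
  have B: "B > 0" using C e by (auto simp: B_def)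
  have K: "(if q = \<infinity> then B else B powr real_of_ereal q) * C = e"
    using C e assms(1) by (cases q) (auto simp: B_def powr_powr)
  have "\<forall>\<^sub>F n in sequentially. Lq_le \<infinity> B (F n)"
    using assms(4) B unfolding null_in_def by blast
  with C(2) show "\<forall>\<^sub>F n in sequentially. Lq_le q e (\<lambda>x. F n x * G n x)"
  proof eventually_elim
    case (elim n)
    have "Lq_le q ((if q = \<infinity> then B else B powr real_of_ereal q) * C) (\<lambda>x. F n x * G n x)"
      using elim assms(1-3) C(1)
      by (intro Lq_le_mult smooth_seq_measurable) (auto intro: smooth_seq_uniformD)
    then show ?case by (simp add: K)
  qed
qed

lemma null_in_const: "c \<longlonglongrightarrow> 0 \<Longrightarrow> null_in \<infinity> (\<lambda>n x. c n)"
  unfolding null_in_def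
proof (intro allI impI)
  fix e :: real assume "e > 0" "c \<longlonglongrightarrow> 0"
  then have "\<forall>\<^sub>F n in sequentially. \<bar>c n\<bar> < e" by (simp add: tendsto_iff)
  then show "\<forall>\<^sub>F n in sequentially. Lq_le \<infinity> e (\<lambda>x. c n)"
    by (rule eventually_mono) (simp add: Lq_le_def)
qed

lemma bounded_in_const: "Bseq c \<Longrightarrow> bounded_in \<infinity> (\<lambda>n x. c n)"
proof -
  assume "Bseq c"
  then obtain K where "\<And>n. \<bar>c n\<bar> \<le> K" by (auto simp: Bseq_def)
  then show ?thesis
    unfolding bounded_in_def Lq_le_def by (intro exI[of _ K] always_eventually) simp
qed

lemma abs_powr_2: "\<bar>x\<bar> powr 2 = (x::real)\<^sup>2"
  by (cases "x = 0") (auto simp: powr_numeral)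

lemma Lq_le_2: "Lq_le 2 C f \<longleftrightarrow> (\<integral>\<^sup>+ x. ennreal ((f x)\<^sup>2) \<partial>lborel) \<le> ennreal C"
  by (simp add: Lq_le_def abs_powr_2 nn_integral_completion)

text \<open>The product of two sequences that are null both in \<open>L\<^sup>2\<close> and uniformly is null in every
  \<open>L\<^sup>q\<close>, \<open>q \<ge> 1\<close>, because \<open>\<bar>a b\<bar>\<^sup>q \<le> \<bar>a b\<bar> \<le> a\<^sup>2 + b\<^sup>2\<close> once \<open>\<bar>a\<bar>, \<bar>b\<bar> \<le> 1\<close>.\<close>

lemma null_in_product:
  assumes "q \<ge> 1" "smooth_seq F" "smooth_seq G" "null_in 2 F" "null_in \<infinity> F" "null_in 2 G" "null_in \<infinity> G"
  shows "null_in q (\<lambda>n x. F n x * G n x)"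
proof (cases "q = \<infinity>")
  case True
  then show ?thesis
    using assms null_in_mult[of \<infinity> F G] null_in_imp_bounded_in by simp
next
  case False
  let ?r = "real_of_ereal q"
  have r: "?r \<ge> 1" using assms(1) False by (cases q) auto
  show ?thesis
    unfolding null_in_def
  proof (intro allI impI)
    fix e :: real assume e: "e > 0"
    have "\<forall>\<^sub>F n in sequentially. Lq_le 2 (e / 2) (F n)" "\<forall>\<^sub>F n in sequentially. Lq_le 2 (e / 2) (G n)"
      "\<forall>\<^sub>F n in sequentially. Lq_le \<infinity> 1 (F n)" "\<forall>\<^sub>F n in sequentially. Lq_le \<infinity> 1 (G n)"
      using assms(4-7) e half_gt_zero[OF e] zero_less_one unfolding null_in_def by blast+
    then show "\<forall>\<^sub>F n in sequentially. Lq_le q e (\<lambda>x. F n x * G n x)"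
    proof eventually_elim
      case (elim n)
      have "(\<integral>\<^sup>+ x. ennreal (\<bar>F n x * G n x\<bar> powr ?r) \<partial>lborel)
        \<le> (\<integral>\<^sup>+ x. ennreal ((F n x)\<^sup>2) + ennreal ((G n x)\<^sup>2) \<partial>lborel)"
      proof (rule nn_integral_mono)
        fix x
        have F1: "\<bar>F n x\<bar> \<le> 1" and G1: "\<bar>G n x\<bar> \<le> 1" using elim(3,4) assms(2,3) by (auto intro: smooth_seq_uniformD)
        have "\<bar>F n x * G n x\<bar> \<le> 1"
          unfolding abs_mult using F1 G1 by (intro mult_le_one) auto
        then have "\<bar>F n x * G n x\<bar> powr ?r \<le> \<bar>F n x * G n x\<bar> powr 1"
          using r by (intro powr_mono') auto
        also have "\<dots> = \<bar>F n x\<bar> * \<bar>G n x\<bar>" by (simp add: abs_mult)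
        also have "\<dots> \<le> (F n x)\<^sup>2 + (G n x)\<^sup>2"
          using sum_squares_bound[of "\<bar>F n x\<bar>" "\<bar>G n x\<bar>"]
            mult_nonneg_nonneg[OF abs_ge_zero abs_ge_zero, of "F n x" "G n x"]
          by (simp only: power2_abs mult.assoc)
        finally show "ennreal (\<bar>F n x * G n x\<bar> powr ?r) \<le> ennreal ((F n x)\<^sup>2) + ennreal ((G n x)\<^sup>2)"
          by (simp add: ennreal_leI flip: ennreal_plus)
      qed
      also have "\<dots> = (\<integral>\<^sup>+ x. ennreal ((F n x)\<^sup>2) \<partial>lborel) + (\<integral>\<^sup>+ x. ennreal ((G n x)\<^sup>2) \<partial>lborel)"
        using smooth_borel[OF smooth_seqD[OF assms(2)]] smooth_borel[OF smooth_seqD[OF assms(3)]]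
        by (intro nn_integral_add) auto
      also have "\<dots> \<le> ennreal (e / 2) + ennreal (e / 2)"
        using elim(1,2) unfolding Lq_le_2 by (rule add_mono)
      also have "\<dots> = ennreal e" using e by (simp flip: ennreal_plus)
      finally show ?case using False by (simp add: Lq_le_def nn_integral_completion)
    qed
  qed
qed

text \<open>A recursion on single derivatives, rather than a condition on all multi-indices: closure of
  \<open>jets k P\<close> under products then needs only the product rule for one derivative.\<close>

primrec jets :: "nat \<Rightarrow> ((nat \<Rightarrow> R2 \<Rightarrow> real) \<Rightarrow> bool) \<Rightarrow> (nat \<Rightarrow> R2 \<Rightarrow> real) \<Rightarrow> bool" where
  "jets 0 P F \<longleftrightarrow> P F"
| "jets (Suc k) P F \<longleftrightarrow>
     P F \<and> jets k P (\<lambda>n. partial e1 (F n)) \<and> jets k P (\<lambda>n. partial e2 (F n))"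

lemma jets_0D: "jets k P F \<Longrightarrow> P F"
  by (cases k) auto

lemma jets_SucD: "jets (Suc k) P F \<Longrightarrow> jets k P F"
proof (induction k arbitrary: F)
  case (Suc k)
  from Suc.prems Suc.IH show ?case unfolding jets.simps(2)[of _ P F] by blast
qed simp

lemma jets_mono: "(\<And>F. P F \<Longrightarrow> Q F) \<Longrightarrow> jets k P F \<Longrightarrow> jets k Q F"
  by (induction k arbitrary: F) auto

lemma jets_conj: "jets k (\<lambda>F. P F \<and> Q F) F \<longleftrightarrow> jets k P F \<and> jets k Q F"
  by (induction k arbitrary: F) auto

lemma jets_add:
  assumes P: "\<And>F G. smooth_seq F \<Longrightarrow> smooth_seq G \<Longrightarrow> P F \<Longrightarrow> P G \<Longrightarrow> P (\<lambda>n x. F n x + G n x)"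
  shows "smooth_seq F \<Longrightarrow> smooth_seq G \<Longrightarrow> jets k P F \<Longrightarrow> jets k P G \<Longrightarrow> jets k P (\<lambda>n x. F n x + G n x)"
proof (induction k arbitrary: F G)
  case (Suc k)
  have "(\<lambda>n. partial e (\<lambda>x. F n x + G n x)) = (\<lambda>n x. partial e (F n) x + partial e (G n) x)" for e
    using Suc.prems smooth_seqD by (intro ext partial_add smooth_differentiable) blast+
  with Suc P show ?case by auto
qed (simp add: P)

lemma jets_mult:
  assumes R: "\<And>F G. smooth_seq F \<Longrightarrow> smooth_seq G \<Longrightarrow> R F \<Longrightarrow> R G \<Longrightarrow> R (\<lambda>n x. F n x + G n x)"
    and PQ: "\<And>F G. smooth_seq F \<Longrightarrow> smooth_seq G \<Longrightarrow> P F \<Longrightarrow> Q G \<Longrightarrow> R (\<lambda>n x. F n x * G n x)"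
  shows "smooth_seq F \<Longrightarrow> smooth_seq G \<Longrightarrow> jets k P F \<Longrightarrow> jets k Q G \<Longrightarrow> jets k R (\<lambda>n x. F n x * G n x)"
proof (induction k arbitrary: F G)
  case (Suc k)
  have "(\<lambda>n. partial e (\<lambda>x. F n x * G n x)) =
      (\<lambda>n x. F n x * partial e (G n) x + partial e (F n) x * G n x)" for e
    using Suc.prems smooth_seqD by (intro ext partial_mult) blast+
  moreover have "jets k P F" "jets k Q G" using Suc.prems jets_SucD by blast+
  moreover have "R (\<lambda>n x. F n x * G n x)" using Suc.prems PQ by auto
  ultimately show ?case
    unfolding jets.simps(2)
    using Suc.prems by (auto intro!: jets_add[of R] R Suc.IH)
qed (simp add: PQ)

lemma jets_const: "P (\<lambda>n x. c n) \<Longrightarrow> P (\<lambda>n x. 0) \<Longrightarrow> jets k P (\<lambda>n x. c n)"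
proof (induction k arbitrary: c)
  case (Suc k)
  then show ?case by (simp add: partial_const)
qed simp

text \<open>If \<open>m\<close> derivatives of \<open>P\<close> yield \<open>Q\<close>, then a loss of \<open>m\<close> derivatives is the only price for passing
  from \<open>P\<close> to \<open>Q\<close> at every order.\<close>

lemma jets_comp:
  assumes PQ: "\<And>F. smooth_seq F \<Longrightarrow> jets m P F \<Longrightarrow> Q F"
  shows "smooth_seq F \<Longrightarrow> jets (k + m) P F \<Longrightarrow> jets k Q F"
proof (induction k arbitrary: F)
  case (Suc k)
  have "jets m P F" using Suc.prems(2)
    by (induction k) (auto dest: jets_SucD simp del: jets.simps)
  with Suc PQ show ?case by auto
qed (simp add: PQ)

lemma jets_bounded_add:
  "q \<ge> 0 \<Longrightarrow> smooth_seq F \<Longrightarrow> smooth_seq G \<Longrightarrow> jets k (bounded_in q) F \<Longrightarrow> jets k (bounded_in q) G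
    \<Longrightarrow> jets k (bounded_in q) (\<lambda>n x. F n x + G n x)"
  by (rule jets_add[where P = "bounded_in q"]) (auto intro: bounded_in_add)

lemma jets_null_add:
  "q \<ge> 0 \<Longrightarrow> smooth_seq F \<Longrightarrow> smooth_seq G \<Longrightarrow> jets k (null_in q) F \<Longrightarrow> jets k (null_in q) G
    \<Longrightarrow> jets k (null_in q) (\<lambda>n x. F n x + G n x)"
  by (rule jets_add[where P = "null_in q"]) (auto intro: null_in_add)

lemma jets_bounded_mult:
  "q \<ge> 0 \<Longrightarrow> smooth_seq F \<Longrightarrow> smooth_seq G \<Longrightarrow> jets k (bounded_in \<infinity>) F \<Longrightarrow> jets k (bounded_in q) G
    \<Longrightarrow> jets k (bounded_in q) (\<lambda>n x. F n x * G n x)"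
  by (rule jets_mult[where P = "bounded_in \<infinity>" and Q = "bounded_in q"])
    (auto intro: bounded_in_add bounded_in_mult)

lemma jets_null_mult:
  "q \<ge> 0 \<Longrightarrow> smooth_seq F \<Longrightarrow> smooth_seq G \<Longrightarrow> jets k (bounded_in \<infinity>) F \<Longrightarrow> jets k (null_in q) G
    \<Longrightarrow> jets k (null_in q) (\<lambda>n x. F n x * G n x)"
  by (rule jets_mult[where P = "bounded_in \<infinity>" and Q = "null_in q"])
    (auto intro: null_in_add null_in_mult)

lemma jets_null_mult':
  "q > 0 \<Longrightarrow> smooth_seq F \<Longrightarrow> smooth_seq G \<Longrightarrow> jets k (null_in \<infinity>) F \<Longrightarrow> jets k (bounded_in q) G
    \<Longrightarrow> jets k (null_in q) (\<lambda>n x. F n x * G n x)"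
  by (rule jets_mult[where P = "null_in \<infinity>" and Q = "bounded_in q"])
    (auto intro: null_in_add null_in_mult')

lemma jets_null_product:
  assumes "q \<ge> 1" "smooth_seq F" "smooth_seq G" "jets k (null_in 2) F" "jets k (null_in \<infinity>) F"
    "jets k (null_in 2) G" "jets k (null_in \<infinity>) G"
  shows "jets k (null_in q) (\<lambda>n x. F n x * G n x)"
proof (rule jets_mult[where P = "\<lambda>F. null_in 2 F \<and> null_in \<infinity> F" and Q = "\<lambda>F. null_in 2 F \<and> null_in \<infinity> F"])
  have "q \<ge> 0" by (rule order_trans[OF _ assms(1)]) simp
  then show "null_in q (\<lambda>n x. F n x + G n x)"
    if "smooth_seq F" "smooth_seq G" "null_in q F" "null_in q G" for F G
    using that by (intro null_in_add)
  show "null_in q (\<lambda>n x. F n x * G n x)"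
    if "smooth_seq F" "smooth_seq G" "null_in 2 F \<and> null_in \<infinity> F" "null_in 2 G \<and> null_in \<infinity> G" for F G
    using that assms(1) by (intro null_in_product) blast+
  show "jets k (\<lambda>F. null_in 2 F \<and> null_in \<infinity> F) F" "jets k (\<lambda>F. null_in 2 F \<and> null_in \<infinity> F) G"
    unfolding jets_conj using assms by blast+
qed (rule assms)+

lemma jets_null_const: "c \<longlonglongrightarrow> 0 \<Longrightarrow> jets k (null_in \<infinity>) (\<lambda>n x. c n)"
  by (intro jets_const null_in_const) auto

lemma jets_bounded_const: "Bseq c \<Longrightarrow> jets k (bounded_in \<infinity>) (\<lambda>n x. c n)"
  by (intro jets_const bounded_in_const) auto

lemma jets_null_imp_bounded: "jets k (null_in q) F \<Longrightarrow> jets k (bounded_in q) F"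
  by (rule jets_mono[OF null_in_imp_bounded_in])

lemma jets_bounded_cmult:
  "q \<ge> 0 \<Longrightarrow> smooth_seq F \<Longrightarrow> Bseq c \<Longrightarrow> jets k (bounded_in q) F \<Longrightarrow> jets k (bounded_in q) (\<lambda>n x. c n * F n x)"
  by (intro jets_bounded_mult jets_bounded_const) auto

lemma jets_null_cmult:
  "q \<ge> 0 \<Longrightarrow> smooth_seq F \<Longrightarrow> Bseq c \<Longrightarrow> jets k (null_in q) F \<Longrightarrow> jets k (null_in q) (\<lambda>n x. c n * F n x)"
  by (intro jets_null_mult jets_bounded_const) auto

lemma jets_null_cmult':
  "q > 0 \<Longrightarrow> smooth_seq F \<Longrightarrow> c \<longlonglongrightarrow> 0 \<Longrightarrow> jets k (bounded_in q) F \<Longrightarrow> jets k (null_in q) (\<lambda>n x. c n * F n x)"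
  by (intro jets_null_mult' jets_null_const) auto

lemma null_in_uniform_if_jets_2:
  assumes F: "smooth_seq F" and j: "jets 2 (null_in 2) F"
  shows "null_in \<infinity> F"
proof -
  have n: "null_in 2 F" "null_in 2 (\<lambda>n. partial e1 (F n))" "null_in 2 (\<lambda>n. partial e2 (F n))"
    "null_in 2 (\<lambda>n. partial e2 (partial e1 (F n)))"
    using j by (simp_all add: numeral_2_eq_2)
  show ?thesis
    unfolding null_in_def
  proof (intro allI impI)
    fix e :: real assume e: "e > 0"
    (* 9 = 4 + 2 + 2 + 1 is the sum of the coefficients in the Sobolev inequality. *)
    define d where "d = e\<^sup>2 / 9"
    have d: "d > 0" using e by (simp add: d_def)
    from n have "\<forall>\<^sub>F n in sequentially. Lq_le 2 d (F n)"
      "\<forall>\<^sub>F n in sequentially. Lq_le 2 d (partial e1 (F n))"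
      "\<forall>\<^sub>F n in sequentially. Lq_le 2 d (partial e2 (F n))"
      "\<forall>\<^sub>F n in sequentially. Lq_le 2 d (partial e2 (partial e1 (F n)))"
      using d unfolding null_in_def by blast+
    then show "\<forall>\<^sub>F n in sequentially. Lq_le \<infinity> e (F n)"
    proof eventually_elim
      case (elim n)
      have s: "smooth (F n)" using F by (rule smooth_seqD)
      note m = smooth_borel[OF s] smooth_borel[OF smooth_partial1[OF s]]
        smooth_borel[OF smooth_partial2[OF s]] smooth_borel[OF smooth_partial2[OF smooth_partial1[OF s]]]
      have "\<bar>F n x\<bar> \<le> e" for x
      proof -
        have "ennreal ((F n x)\<^sup>2) \<le> (\<integral>\<^sup>+ x. ennreal (4 * (F n x)\<^sup>2 + 2 * (partial e1 (F n) x)\<^sup>2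
           + 2 * (partial e2 (F n) x)\<^sup>2 + (partial e2 (partial e1 (F n)) x)\<^sup>2) \<partial>lborel)"
          by (rule sobolev_2d[OF s])
        also have "\<dots> = (\<integral>\<^sup>+ x. ennreal 4 * ennreal ((F n x)\<^sup>2) + ennreal 2 * ennreal ((partial e1 (F n) x)\<^sup>2)
           + ennreal 2 * ennreal ((partial e2 (F n) x)\<^sup>2) + ennreal ((partial e2 (partial e1 (F n)) x)\<^sup>2) \<partial>lborel)"
          by (intro nn_integral_cong) (simp add: ennreal_plus ennreal_mult)
        also have "\<dots> = ennreal 4 * (\<integral>\<^sup>+ x. ennreal ((F n x)\<^sup>2) \<partial>lborel)
           + ennreal 2 * (\<integral>\<^sup>+ x. ennreal ((partial e1 (F n) x)\<^sup>2) \<partial>lborel)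
           + ennreal 2 * (\<integral>\<^sup>+ x. ennreal ((partial e2 (F n) x)\<^sup>2) \<partial>lborel)
           + (\<integral>\<^sup>+ x. ennreal ((partial e2 (partial e1 (F n)) x)\<^sup>2) \<partial>lborel)"
          using m by (simp add: nn_integral_add nn_integral_cmult)
        also have "\<dots> \<le> ennreal 4 * ennreal d + ennreal 2 * ennreal d + ennreal 2 * ennreal d + ennreal d"
          using elim unfolding Lq_le_2 by (intro add_mono mult_left_mono) auto
        also have "\<dots> = ennreal (e\<^sup>2)"
          using d by (simp add: d_def del: ennreal_numeral flip: ennreal_plus ennreal_mult)
        finally have "(F n x)\<^sup>2 \<le> e\<^sup>2" by simp
        then show ?thesis using e abs_le_square_iff[of "F n x" e] by simp
      qed
      then show ?case by (simp add: Lq_le_def)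
    qed
  qed
qed

lemma jets_null_uniform:
  "smooth_seq F \<Longrightarrow> jets (k + 2) (null_in 2) F \<Longrightarrow> jets k (null_in \<infinity>) F"
  by (rule jets_comp[OF null_in_uniform_if_jets_2])

section \<open>Propagation of smallness to all derivatives\<close>

text \<open>Given \<open>e\<close>, choose \<open>\<tau>\<close> so small that \<open>\<tau> \<integral> f\<^sup>2 \<le> e / 2\<close>; afterwards the remaining term is small because
  \<open>\<epsilon> \<Phi>\<close> tends to \<open>0\<close> in \<open>L\<^sup>2\<close>.\<close>

lemma energy_null:
  fixes \<Phi> f b d :: "nat \<Rightarrow> R2 \<Rightarrow> real" and \<epsilon> \<mu> :: "nat \<Rightarrow> real"
  assumes s: "smooth_seq \<Phi>" "smooth_seq f"
    and eq: "\<And>n x. partial e1 (partial e1 (\<Phi> n)) x + (\<mu> n)\<^sup>2 * partial e2 (partial e2 (\<Phi> n)) x =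
       \<epsilon> n * (f n x + b n x * partial e1 (\<Phi> n) x + d n x * (\<mu> n * partial e2 (\<Phi> n) x))"
    and \<epsilon>: "\<And>n. \<epsilon> n > 0"
    and sbd: "smooth_seq b" "smooth_seq d"
    and f: "bounded_in 2 f" and b: "bounded_in \<infinity> b" and d: "bounded_in \<infinity> d"
    and null: "null_in 2 (\<lambda>n x. \<epsilon> n * \<Phi> n x)"
  shows "null_in 2 (\<lambda>n. partial e1 (\<Phi> n))" and "null_in 2 (\<lambda>n x. \<mu> n * partial e2 (\<Phi> n) x)"
proof -
  have "\<forall>\<^sub>F n in sequentially. (\<integral>\<^sup>+ x. ennreal ((partial e1 (\<Phi> n) x)\<^sup>2 + (\<mu> n * partial e2 (\<Phi> n) x)\<^sup>2) \<partial>lborel)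
      \<le> ennreal e" if e: "e > 0" for e
  proof -
    obtain C B1 B2 where C: "C > 0" "\<forall>\<^sub>F n in sequentially. Lq_le 2 C (f n)"
      and B1: "B1 > 0" "\<forall>\<^sub>F n in sequentially. Lq_le \<infinity> B1 (b n)"
      and B2: "B2 > 0" "\<forall>\<^sub>F n in sequentially. Lq_le \<infinity> B2 (d n)"
      using f b d by (auto elim!: bounded_inE)
    define B where "B = max B1 B2"
    define \<tau> where "\<tau> = e / (2 * C)"
    define K where "K = 1 / \<tau> + 4 * B\<^sup>2"
    have \<tau>: "\<tau> > 0" using e C by (simp add: \<tau>_def)
    have K: "K > 0" using \<tau> by (auto simp: K_def intro: add_pos_nonneg)
    have "\<forall>\<^sub>F n in sequentially. Lq_le 2 (e / (2 * K)) (\<lambda>x. \<epsilon> n * \<Phi> n x)"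
      using null e K unfolding null_in_def by simp
    with C(2) B1(2) B2(2) show ?thesis
    proof eventually_elim
      case (elim n)
      have s\<Phi>: "smooth (\<Phi> n)" and sf: "smooth (f n)" using s by (auto intro: smooth_seqD)
      note m = smooth_borel[OF s\<Phi>] smooth_borel[OF sf]
      have W: "(\<integral>\<^sup>+ x. ennreal ((\<epsilon> n * \<Phi> n x)\<^sup>2) \<partial>lborel) \<le> ennreal (e / (2 * K))"
        using elim(4) unfolding Lq_le_2 .
      have "(\<integral>\<^sup>+ x. ennreal ((\<Phi> n x)\<^sup>2) \<partial>lborel) < \<infinity>"
      proof -
        have "(\<integral>\<^sup>+ x. ennreal ((\<Phi> n x)\<^sup>2) \<partial>lborel) =
            (\<integral>\<^sup>+ x. ennreal ((1 / \<epsilon> n)\<^sup>2) * ennreal ((\<epsilon> n * \<Phi> n x)\<^sup>2) \<partial>lborel)"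
          using \<epsilon>[of n] by (intro nn_integral_cong) (simp add: power_mult_distrib power_divide flip: ennreal_mult)
        also have "\<dots> = ennreal ((1 / \<epsilon> n)\<^sup>2) * (\<integral>\<^sup>+ x. ennreal ((\<epsilon> n * \<Phi> n x)\<^sup>2) \<partial>lborel)"
          using m by (intro nn_integral_cmult) simp
        also have "\<dots> < \<infinity>"
          using le_less_trans[OF W ennreal_less_top] by (simp add: ennreal_mult_less_top)
        finally show ?thesis .
      qed
      then have "(\<integral>\<^sup>+ x. ennreal ((partial e1 (\<Phi> n) x)\<^sup>2 + (\<mu> n * partial e2 (\<Phi> n) x)\<^sup>2) \<partial>lborel)
        \<le> (\<integral>\<^sup>+ x. ennreal (\<tau> * (f n x)\<^sup>2 + K * (\<epsilon> n * \<Phi> n x)\<^sup>2) \<partial>lborel)"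
        unfolding K_def using elim(2,3) \<tau> sf
        by (intro energy_estimate[OF s\<Phi> _ eq, where B = B] smooth_continuous)
          (auto simp: B_def intro: le_max_iff_disj[THEN iffD2] smooth_seq_uniformD sbd)
      also have "\<dots> = (\<integral>\<^sup>+ x. ennreal \<tau> * ennreal ((f n x)\<^sup>2) + ennreal K * ennreal ((\<epsilon> n * \<Phi> n x)\<^sup>2) \<partial>lborel)"
        using \<tau> K by (intro nn_integral_cong) (simp add: ennreal_plus ennreal_mult)
      also have "\<dots> = ennreal \<tau> * (\<integral>\<^sup>+ x. ennreal ((f n x)\<^sup>2) \<partial>lborel)
          + ennreal K * (\<integral>\<^sup>+ x. ennreal ((\<epsilon> n * \<Phi> n x)\<^sup>2) \<partial>lborel)"
        using m by (simp add: nn_integral_add nn_integral_cmult)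
      also have "\<dots> \<le> ennreal \<tau> * ennreal C + ennreal K * ennreal (e / (2 * K))"
        using elim(1) W unfolding Lq_le_2 by (intro add_mono mult_left_mono) auto
      also have "\<dots> = ennreal e"
        using \<tau> K C e by (simp add: \<tau>_def flip: ennreal_plus ennreal_mult)
      finally show ?case .
    qed
  qed
  note main = this
  show "null_in 2 (\<lambda>n. partial e1 (\<Phi> n))"
    unfolding null_in_def Lq_le_2
  proof (intro allI impI)
    fix e :: real assume "e > 0"
    from main[OF this] show "\<forall>\<^sub>F n in sequentially. (\<integral>\<^sup>+ x. ennreal ((partial e1 (\<Phi> n) x)\<^sup>2) \<partial>lborel) \<le> ennreal e"
      by (rule eventually_mono) (erule order_trans[rotated], auto intro!: nn_integral_mono ennreal_leI)
  qed
  show "null_in 2 (\<lambda>n x. \<mu> n * partial e2 (\<Phi> n) x)"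
    unfolding null_in_def Lq_le_2
  proof (intro allI impI)
    fix e :: real assume "e > 0"
    from main[OF this] show "\<forall>\<^sub>F n in sequentially. (\<integral>\<^sup>+ x. ennreal ((\<mu> n * partial e2 (\<Phi> n) x)\<^sup>2) \<partial>lborel) \<le> ennreal e"
      by (rule eventually_mono) (erule order_trans[rotated], auto intro!: nn_integral_mono ennreal_leI)
  qed
qed

text \<open>The equation for \<open>w = \<partial>\<^sub>i \<Phi>\<close> has the same form, with the source term
  \<open>\<partial>\<^sub>i f + \<partial>\<^sub>i b \<partial>\<^sub>1 \<Phi> + \<partial>\<^sub>i d \<mu> \<partial>\<^sub>2 \<Phi>\<close>, which contains only derivatives of \<open>\<Phi>\<close> known to be small.
  Moreover \<open>\<epsilon> w\<close> is null: it is \<open>\<epsilon> \<partial>\<^sub>1 \<Phi>\<close> or a multiple of \<open>\<mu> \<partial>\<^sub>2 \<Phi>\<close>.\<close>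

lemma jets_energy_null:
  fixes \<Phi> f b d :: "nat \<Rightarrow> R2 \<Rightarrow> real" and \<epsilon> \<mu> :: "nat \<Rightarrow> real"
  assumes sb: "smooth_seq b" "smooth_seq d"
    and \<epsilon>: "\<And>n. \<epsilon> n > 0" and \<mu>: "\<And>n. \<mu> n = \<epsilon> n / sqrt 2" "\<epsilon> \<longlonglongrightarrow> 0"
    and b: "\<And>k. jets k (bounded_in \<infinity>) b" and d: "\<And>k. jets k (bounded_in \<infinity>) d"
  shows "smooth_seq \<Phi> \<Longrightarrow> smooth_seq f \<Longrightarrow>
    (\<And>n x. partial e1 (partial e1 (\<Phi> n)) x + (\<mu> n)\<^sup>2 * partial e2 (partial e2 (\<Phi> n)) x =
       \<epsilon> n * (f n x + b n x * partial e1 (\<Phi> n) x + d n x * (\<mu> n * partial e2 (\<Phi> n) x))) \<Longrightarrow>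
    jets k (bounded_in 2) f \<Longrightarrow> null_in 2 (\<lambda>n. partial e1 (\<Phi> n)) \<Longrightarrow>
    null_in 2 (\<lambda>n x. \<mu> n * partial e2 (\<Phi> n) x) \<Longrightarrow>
    jets k (null_in 2) (\<lambda>n. partial e1 (\<Phi> n)) \<and> jets k (null_in 2) (\<lambda>n x. \<mu> n * partial e2 (\<Phi> n) x)"
proof (induction k arbitrary: \<Phi> f)
  case (Suc k)
  note s = Suc.prems(1,2) and eq = Suc.prems(3)
  have B\<epsilon>: "Bseq \<epsilon>" using \<mu>(2) convergentI convergent_imp_Bseq by blast
  have low: "jets k (null_in 2) (\<lambda>n. partial e1 (\<Phi> n))" "jets k (null_in 2) (\<lambda>n x. \<mu> n * partial e2 (\<Phi> n) x)"
    using Suc.IH[OF s eq jets_SucD[OF Suc.prems(4)] Suc.prems(5,6)] by blast+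
  have step: "jets k (null_in 2) (\<lambda>n. partial e1 (partial e (\<Phi> n))) \<and>
      jets k (null_in 2) (\<lambda>n x. \<mu> n * partial e2 (partial e (\<Phi> n)) x)" if e: "e = e1 \<or> e = e2" for e
  proof -
    let ?w = "\<lambda>n. partial e (\<Phi> n)"
    let ?f = "\<lambda>n x. partial e (f n) x + partial e (b n) x * partial e1 (\<Phi> n) x
        + partial e (d n) x * (\<mu> n * partial e2 (\<Phi> n) x)"
    have se: "smooth_seq (\<lambda>n. partial e (F n))" if "smooth_seq F" for F
      using that e by auto
    have je: "jets k P (\<lambda>n. partial e (F n))" if "jets (Suc k) P F" for P F
      using that e by auto
    have sf: "smooth_seq ?f" using s sb by (intro smooth_seq_intros se)
    have jf: "jets k (bounded_in 2) ?f"
      using s sb Suc.prems(4)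
      by (intro jets_bounded_add jets_bounded_mult smooth_seq_intros se je b d low[THEN jets_null_imp_bounded])
        auto
    have eqw: "partial e1 (partial e1 (?w n)) x + (\<mu> n)\<^sup>2 * partial e2 (partial e2 (?w n)) x =
       \<epsilon> n * (?f n x + b n x * partial e1 (?w n) x + d n x * (\<mu> n * partial e2 (?w n) x))" for n x
    proof -
      have s\<Phi>: "smooth (\<Phi> n)" and sf: "smooth (f n)" and sbn: "smooth (b n)" "smooth (d n)"
        using s sb by (auto intro: smooth_seqD)
      have comm: "partial e1 (partial e g) = partial e (partial e1 g)"
        "partial e2 (partial e g) = partial e (partial e2 g)" if "smooth g" for g :: "R2 \<Rightarrow> real"
        using e partial_commute[OF that] by auto
      have "partial e1 (partial e1 (?w n)) x + (\<mu> n)\<^sup>2 * partial e2 (partial e2 (?w n)) x =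
          partial e (\<lambda>x. partial e1 (partial e1 (\<Phi> n)) x + (\<mu> n)\<^sup>2 * partial e2 (partial e2 (\<Phi> n)) x) x"
        using s\<Phi> by (simp add: comm smooth_partial1 smooth_partial2 partial_add partial_cmult
            smooth_differentiable smooth_cmult)
      also have "\<dots> = partial e (\<lambda>x. \<epsilon> n * (f n x + b n x * partial e1 (\<Phi> n) x
          + d n x * (\<mu> n * partial e2 (\<Phi> n) x))) x"
        by (simp only: eq)
      also have "\<dots> = \<epsilon> n * (?f n x + b n x * partial e1 (?w n) x + d n x * (\<mu> n * partial e2 (?w n) x))"
        using s\<Phi> sf sbn
        by (simp add: comm smooth_partial1 smooth_partial2 partial_add partial_cmult partial_mult
            smooth_differentiable smooth_cmult smooth_mult smooth_add algebra_simps)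
      finally show ?thesis .
    qed
    have null: "null_in 2 (\<lambda>n x. \<epsilon> n * ?w n x)"
      using e
    proof
      assume "e = e1"
      then show ?thesis
        using Suc.prems(5) s by (auto intro!: null_in_mult bounded_in_const B\<epsilon>)
    next
      assume "e = e2"
      have "null_in 2 (\<lambda>n x. sqrt 2 * (\<mu> n * partial e2 (\<Phi> n) x))"
        by (rule null_in_mult[OF _ _ _ _ Suc.prems(6)])
          (use s in \<open>auto intro: bounded_in_const Bfun_const\<close>)
      also have "(\<lambda>n x. sqrt 2 * (\<mu> n * partial e2 (\<Phi> n) x)) = (\<lambda>n x. \<epsilon> n * ?w n x)"
        using \<open>e = e2\<close> by (simp add: \<mu>(1))
      finally show ?thesis .
    qed
    have "null_in 2 (\<lambda>n. partial e1 (?w n))" "null_in 2 (\<lambda>n x. \<mu> n * partial e2 (?w n) x)"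
      using energy_null[OF se[OF s(1)] sf eqw \<epsilon> sb jets_0D[OF jf] jets_0D[OF b] jets_0D[OF d] null]
      by blast+
    from Suc.IH[OF se[OF s(1)] sf eqw jf this] show ?thesis .
  qed
  have comm: "partial e2 (partial e1 (\<Phi> n)) = partial e1 (partial e2 (\<Phi> n))"
    "partial e1 (\<lambda>x. \<mu> n * partial e2 (\<Phi> n) x) = (\<lambda>x. \<mu> n * partial e1 (partial e2 (\<Phi> n)) x)"
    "partial e2 (\<lambda>x. \<mu> n * partial e2 (\<Phi> n) x) = (\<lambda>x. \<mu> n * partial e2 (partial e2 (\<Phi> n)) x)" for n
    using smooth_seqD[OF s(1), of n]
    by (auto simp: partial_commute partial_cmult smooth_partial2)
  show ?case
    using Suc.prems(5,6) step[of e1] step[of e2] by (simp add: comm)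
qed simp

section \<open>Sobolev convergence of smooth functions\<close>

lemma Lq_norm_nonneg: "Lq_norm q (f :: R2 \<Rightarrow> real) \<ge> 0"
proof (cases "q = \<infinity>")
  case True
  have "emeasure lebesgue (space lebesgue :: R2 set) \<noteq> 0" by simp
  then have "0 = esssup lebesgue (\<lambda>x::R2. 0 :: ereal)" by (simp add: esssup_const)
  also have "\<dots> \<le> esssup lebesgue (\<lambda>x. ereal (norm (f x)))"
    by (rule esssup_mono) auto
  finally show ?thesis using True by (simp add: Lq_norm_def real_of_ereal_pos)
qed (simp add: Lq_norm_def)

lemma Lq_le_cong:
  assumes "AE x in lebesgue. f x = g x" "Lq_le q C f"
  shows "Lq_le q C g"
proof (cases "q = \<infinity>")
  case True
  with assms(2) have "AE x in lebesgue. \<bar>f x\<bar> \<le> C" by (simp add: Lq_le_def)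
  with assms(1) have "AE x in lebesgue. \<bar>g x\<bar> \<le> C" by eventually_elim simp
  with True show ?thesis by (simp add: Lq_le_def)
next
  case False
  have "(\<integral>\<^sup>+ x. ennreal (\<bar>f x\<bar> powr real_of_ereal q) \<partial>lebesgue) =
      (\<integral>\<^sup>+ x. ennreal (\<bar>g x\<bar> powr real_of_ereal q) \<partial>lebesgue)"
  proof (rule nn_integral_cong_AE)
    show "AE x in lebesgue. ennreal (\<bar>f x\<bar> powr real_of_ereal q) = ennreal (\<bar>g x\<bar> powr real_of_ereal q)"
      using assms(1) by eventually_elim simp
  qed
  with False assms(2) show ?thesis by (simp add: Lq_le_def)
qed

text \<open>The bound on \<open>Lq_norm q\<close> that corresponds to \<open>Lq_le q C\<close>.\<close>

definition norm_bound :: "ereal \<Rightarrow> real \<Rightarrow> real" where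
  "norm_bound q C = (if q = \<infinity> then C else C powr (1 / real_of_ereal q))"

lemma Lq_le_imp_Lq:
  assumes g: "g \<in> borel_measurable lebesgue" and le: "Lq_le q C g" and "C \<ge> 0" and q: "q > 0"
  shows "g \<in> Lq q" and "Lq_norm q g \<le> norm_bound q C"
proof -
  have "g \<in> Lq q \<and> Lq_norm q g \<le> norm_bound q C"
  proof (cases "q = \<infinity>")
    case True
    have "esssup lebesgue (\<lambda>x. ereal (norm (g x))) \<le> ereal C"
      using g le True by (intro esssup_I) (auto simp: Lq_le_def)
    then show ?thesis
      using g True \<open>C \<ge> 0\<close> by (cases "esssup lebesgue (\<lambda>x. ereal (norm (g x)))")
        (auto simp: Lq_def Lq_norm_def norm_bound_def)
  next
    case False
    let ?r = "real_of_ereal q"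
    have r: "?r > 0" using q False by (cases q) auto
    have I: "(\<integral>\<^sup>+ x. ennreal (\<bar>g x\<bar> powr ?r) \<partial>lebesgue) \<le> ennreal C"
      using le False by (simp add: Lq_le_def)
    have int: "integrable lebesgue (\<lambda>x. \<bar>g x\<bar> powr ?r)"
      by (rule integrableI_bounded) (use g le_less_trans[OF I ennreal_less_top] in auto)
    then have "ennreal (LINT x|lebesgue. \<bar>g x\<bar> powr ?r) \<le> ennreal C"
      using I by (simp add: nn_integral_eq_integral)
    then have "(LINT x|lebesgue. \<bar>g x\<bar> powr ?r) \<le> C"
      using \<open>C \<ge> 0\<close> by simp
    then have "(LINT x|lebesgue. \<bar>g x\<bar> powr ?r) powr (1 / ?r) \<le> C powr (1 / ?r)"
      using r by (intro powr_mono2) auto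
    then show ?thesis
      using g int False by (simp add: Lq_def Lq_norm_def norm_bound_def)
  qed
  then show "g \<in> Lq q" and "Lq_norm q g \<le> norm_bound q C" by blast+
qed

lemma Lq_imp_Lq_le:
  assumes g: "g \<in> Lq q" and le: "Lq_norm q g \<le> norm_bound q C" and "C \<ge> 0" and q: "q > 0"
  shows "Lq_le q C (g :: R2 \<Rightarrow> real)"
proof (cases "q = \<infinity>")
  case True
  let ?E = "esssup lebesgue (\<lambda>x. ereal (norm (g x)))"
  have "?E < \<infinity>" using g True by (simp add: Lq_def)
  moreover have "real_of_ereal ?E \<le> C" using le True by (simp add: Lq_norm_def norm_bound_def)
  ultimately have "?E \<le> ereal C" by (cases ?E) auto
  moreover have "AE x in lebesgue. ereal (norm (g x)) \<le> ?E" by (rule esssup_AE)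
  ultimately have "AE x in lebesgue. \<bar>g x\<bar> \<le> C"
    by (elim eventually_mono) (metis ereal_less_eq(3) order_trans real_norm_def)
  with True show ?thesis by (simp add: Lq_le_def)
next
  case False
  let ?r = "real_of_ereal q"
  have r: "?r > 0" using q False by (cases q) auto
  have int: "integrable lebesgue (\<lambda>x. \<bar>g x\<bar> powr ?r)"
    using g False by (simp add: Lq_def)
  let ?I = "LINT x|lebesgue. \<bar>g x\<bar> powr ?r"
  have "?I \<ge> 0" by (intro Bochner_Integration.integral_nonneg) simp
  have root: "?I powr (1 / ?r) \<le> C powr (1 / ?r)"
    using le False by (simp add: Lq_norm_def norm_bound_def)
  have le: "(?I powr (1 / ?r)) powr ?r \<le> (C powr (1 / ?r)) powr ?r"
    by (rule powr_mono2[OF _ _ root]) (use r in auto)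
  have "?I = (?I powr (1 / ?r)) powr ?r" using r \<open>?I \<ge> 0\<close> by (simp add: powr_powr)
  also note le
  also have "(C powr (1 / ?r)) powr ?r = C" using r \<open>C \<ge> 0\<close> by (simp add: powr_powr)
  finally have "?I \<le> C" .
  then show ?thesis
    using False int by (simp add: Lq_le_def nn_integral_eq_integral ennreal_leI)
qed

lemma Lq_imp_Lq_le_ex:
  assumes g: "g \<in> Lq q" and q: "q > 0"
  shows "\<exists>C\<ge>0. Lq_le q C (g :: R2 \<Rightarrow> real)"
proof -
  define C where "C = (if q = \<infinity> then Lq_norm q g else Lq_norm q g powr real_of_ereal q)"
  have "C \<ge> 0" by (auto simp: C_def Lq_norm_nonneg)
  moreover have "norm_bound q C = Lq_norm q g"
    using q Lq_norm_nonneg[of q g] by (cases q) (auto simp: norm_bound_def C_def powr_powr)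
  ultimately show ?thesis using Lq_imp_Lq_le[OF g _ _ q] by (intro exI[of _ C]) auto
qed

lemma norm_bound_pos: "e > 0 \<Longrightarrow> norm_bound q e > 0"
  by (simp add: norm_bound_def)

lemma norm_bound_small: "e > 0 \<Longrightarrow> q > 0 \<Longrightarrow> \<exists>d>0. norm_bound q d \<le> e"
proof -
  assume "e > 0" "q > 0"
  define d where "d = (if q = \<infinity> then e else e powr real_of_ereal q)"
  have "d > 0" using \<open>e > 0\<close> by (simp add: d_def)
  moreover have "norm_bound q d = e"
    using \<open>e > 0\<close> \<open>q > 0\<close> by (cases q) (auto simp: norm_bound_def d_def powr_powr)
  ultimately show ?thesis by auto
qed

lemma locally_integrable_measurable:
  fixes g :: "R2 \<Rightarrow> 'b::euclidean_space"
  assumes g: "locally_integrable g"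
  shows "g \<in> borel_measurable lebesgue"
proof (rule borel_measurable_LIMSEQ_metric)
  let ?B = "\<lambda>n. box (- real n, - real n) (real n, real n) :: R2 set"
  show "(\<lambda>x. indicator (?B n) x *\<^sub>R g x) \<in> borel_measurable lebesgue" for n
    using integrable_box[OF g] by (rule borel_measurable_integrable)
  show "(\<lambda>n. indicator (?B n) x *\<^sub>R g x) \<longlonglongrightarrow> g x" for x
  proof (rule tendsto_eventually)
    obtain m where m: "max \<bar>fst x\<bar> \<bar>snd x\<bar> < real m" using reals_Archimedean2 by blast
    show "\<forall>\<^sub>F n in sequentially. indicator (?B n) x *\<^sub>R g x = g x"
      using eventually_ge_at_top[of m]
    proof eventually_elim
      case (elim n)
      then have "real m \<le> real n" by simp
      with m have "x \<in> ?B n" by (auto simp: mem_box_R2)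
      then show ?case by simp
    qed
  qed
qed

lemma is_weak_deriv_measurable: "is_weak_deriv \<alpha> f g \<Longrightarrow> g \<in> borel_measurable lebesgue"
  by (simp add: is_weak_deriv_def locally_integrable_measurable)

lemma Lq_AE_cong:
  fixes f g :: "R2 \<Rightarrow> real"
  assumes "f \<in> Lq q" "AE x in lebesgue. f x = g x" "g \<in> borel_measurable lebesgue" "q > 0"
  shows "g \<in> Lq q"
proof -
  obtain C where "C \<ge> 0" "Lq_le q C f" using Lq_imp_Lq_le_ex assms by blast
  then show ?thesis using Lq_le_cong[OF assms(2)] Lq_le_imp_Lq assms by blast
qed

lemma Lq_add:
  fixes f g :: "R2 \<Rightarrow> real"
  assumes "f \<in> Lq q" "g \<in> Lq q" "q > 0"
  shows "(\<lambda>x. f x + g x) \<in> Lq q"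
proof -
  have m: "f \<in> borel_measurable lebesgue" "g \<in> borel_measurable lebesgue"
    using assms by (auto simp: Lq_def)
  obtain C D where C: "C \<ge> 0" "Lq_le q C f" and D: "D \<ge> 0" "Lq_le q D g"
    using Lq_imp_Lq_le_ex assms by metis
  have "Lq_le q (C + D) f" "Lq_le q (C + D) g"
    using C D by (auto elim: Lq_le_mono)
  then have "Lq_le q (2 * (if q = \<infinity> then 1 else 2 powr real_of_ereal q) * (C + D)) (\<lambda>x. f x + g x)"
    using m C D assms(3) by (intro Lq_le_add) auto
  from Lq_le_imp_Lq(1)[OF _ this] show ?thesis using C D m assms(3) by simp
qed

lemma finite_multi_indices: "finite {\<alpha> :: nat \<times> nat. fst \<alpha> + snd \<alpha> \<le> k}"
  by (rule finite_subset[of _ "{..k} \<times> {..k}"]) auto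

text \<open>Weak derivatives are unique almost everywhere, so \<open>weak_deriv \<alpha> (F n - f)\<close> is the classical derivative
  of \<open>F n\<close> minus any weak derivative of \<open>f\<close>.\<close>

lemma Wkq_tendsto_smooth_iff:
  fixes F :: "nat \<Rightarrow> R2 \<Rightarrow> real"
  assumes F: "smooth_seq F" and q: "q > 0"
  shows "Wkq_tendsto k q F f \<longleftrightarrow> f \<in> Wkq k q \<and>
    (\<forall>\<alpha> g. fst \<alpha> + snd \<alpha> \<le> k \<longrightarrow> is_weak_deriv \<alpha> f g \<longrightarrow>
       (\<forall>e>0. \<forall>\<^sub>F n in sequentially. Lq_le q e (\<lambda>x. multi_partial \<alpha> (F n) x - g x)))"
    (is "_ \<longleftrightarrow> _ \<and> ?R")
proof -
  have DF: "is_weak_deriv \<alpha> (F n) (multi_partial \<alpha> (F n))" for \<alpha> n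
    by (rule is_weak_deriv_smooth[OF smooth_seqD[OF F]])
  have AE: "AE x in lebesgue. weak_deriv \<alpha> (\<lambda>x. F n x - f x) x = multi_partial \<alpha> (F n) x - g x"
    "weak_deriv \<alpha> (\<lambda>x. F n x - f x) \<in> borel_measurable lebesgue"
    "(\<lambda>x. multi_partial \<alpha> (F n) x - g x) \<in> borel_measurable lebesgue"
    if "is_weak_deriv \<alpha> f g" for \<alpha> g n
    using is_weak_deriv_diff[OF DF that, THEN weak_deriv_AE_eq]
      is_weak_deriv_diff[OF DF that, THEN is_weak_deriv_weak_deriv, THEN is_weak_deriv_measurable]
      is_weak_deriv_diff[OF DF that, THEN is_weak_deriv_measurable] .
  have gLq: "g \<in> Lq q" if "f \<in> Wkq k q" "fst \<alpha> + snd \<alpha> \<le> k" "is_weak_deriv \<alpha> f g" for \<alpha> g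
  proof -
    from that obtain h where h: "is_weak_deriv \<alpha> f h" "h \<in> Lq q"
      by (auto simp: Wkq_def deriv_in_Lq_def)
    show ?thesis
      by (rule Lq_AE_cong[OF h(2) is_weak_deriv_unique[OF h(1) that(3)]
            is_weak_deriv_measurable[OF that(3)] q])
  qed
  show ?thesis
  proof
    assume conv: "Wkq_tendsto k q F f"
    then have f: "f \<in> Wkq k q" and ev: "\<forall>\<^sub>F n in sequentially. F n \<in> Wkq k q"
      and lim: "(\<lambda>n. Wkq_norm k q (\<lambda>x. F n x - f x)) \<longlonglongrightarrow> 0"
      by (auto simp: Wkq_tendsto_def)
    have ?R
    proof (intro allI impI)
      fix \<alpha> g and e :: real
      assume \<alpha>: "fst \<alpha> + snd \<alpha> \<le> k" and g: "is_weak_deriv \<alpha> f g" and e: "e > 0"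
      have "\<forall>\<^sub>F n in sequentially. Wkq_norm k q (\<lambda>x. F n x - f x) < norm_bound q e"
        using order_tendstoD(2)[OF lim norm_bound_pos[OF e]] .
      with ev show "\<forall>\<^sub>F n in sequentially. Lq_le q e (\<lambda>x. multi_partial \<alpha> (F n) x - g x)"
      proof eventually_elim
        case (elim n)
        let ?w = "weak_deriv \<alpha> (\<lambda>x. F n x - f x)"
        have "Lq_norm q ?w \<le> Wkq_norm k q (\<lambda>x. F n x - f x)"
          unfolding Wkq_norm_def
          by (rule member_le_sum) (use \<alpha> in \<open>auto simp: Lq_norm_nonneg finite_multi_indices\<close>)
        with elim(2) have le: "Lq_norm q ?w \<le> norm_bound q e" by simp
        obtain h where h: "is_weak_deriv \<alpha> (F n) h" "h \<in> Lq q"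
          using elim(1) \<alpha> by (auto simp: Wkq_def deriv_in_Lq_def)
        have "(\<lambda>x. - 1 * g x) \<in> Lq q"
          using gLq[OF f \<alpha> g] by (cases "q = \<infinity>") (simp_all add: Lq_def)
        from Lq_add[OF h(2) this q] have hg: "(\<lambda>x. h x - g x) \<in> Lq q" by simp
        have "AE x in lebesgue. h x - g x = ?w x"
          using weak_deriv_AE_eq[OF is_weak_deriv_diff[OF h(1) g]] by eventually_elim simp
        then have "?w \<in> Lq q"
          using hg AE(2)[OF g] q by (intro Lq_AE_cong[OF hg])
        then have "Lq_le q e ?w" using le e q by (intro Lq_imp_Lq_le) auto
        then show ?case by (rule Lq_le_cong[OF AE(1)[OF g]])
      qed
    qed
    with f show "f \<in> Wkq k q \<and> ?R" by blast
  next
    assume R: "f \<in> Wkq k q \<and> ?R"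
    then have f: "f \<in> Wkq k q" by blast
    have ex: "\<exists>g. is_weak_deriv \<alpha> f g \<and> g \<in> Lq q" if "fst \<alpha> + snd \<alpha> \<le> k" for \<alpha>
      using f that by (auto simp: Wkq_def deriv_in_Lq_def)
    have "\<forall>\<^sub>F n in sequentially. \<forall>\<alpha>\<in>{\<alpha>. fst \<alpha> + snd \<alpha> \<le> k}. deriv_in_Lq \<alpha> q (F n)"
    proof (rule eventually_ball_finite[OF finite_multi_indices], rule ballI)
      fix \<alpha> :: "nat \<times> nat" assume "\<alpha> \<in> {\<alpha>. fst \<alpha> + snd \<alpha> \<le> k}"
      then have \<alpha>: "fst \<alpha> + snd \<alpha> \<le> k" by simp
      then obtain g where g: "is_weak_deriv \<alpha> f g" "g \<in> Lq q" using ex by blast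
      have "\<forall>\<^sub>F n in sequentially. Lq_le q 1 (\<lambda>x. multi_partial \<alpha> (F n) x - g x)"
        using R \<alpha> g(1) zero_less_one by blast
      then show "\<forall>\<^sub>F n in sequentially. deriv_in_Lq \<alpha> q (F n)"
      proof eventually_elim
        case (elim n)
        have "(\<lambda>x. multi_partial \<alpha> (F n) x - g x) \<in> Lq q"
          by (rule Lq_le_imp_Lq(1)[OF AE(3)[OF g(1)] elim _ q]) simp
        from Lq_add[OF this g(2) q] have "multi_partial \<alpha> (F n) \<in> Lq q" by simp
        then show ?case using DF unfolding deriv_in_Lq_def by blast
      qed
    qed
    then have ev: "\<forall>\<^sub>F n in sequentially. F n \<in> Wkq k q"
      by (rule eventually_mono) (auto simp: Wkq_def)
    have "(\<lambda>n. Lq_norm q (weak_deriv \<alpha> (\<lambda>x. F n x - f x))) \<longlonglongrightarrow> 0"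
      if \<alpha>: "fst \<alpha> + snd \<alpha> \<le> k" for \<alpha>
    proof (rule tendstoI)
      fix e :: real assume e: "e > 0"
      obtain g where g: "is_weak_deriv \<alpha> f g" using ex \<alpha> by blast
      have "e / 2 > 0" using e by simp
      from norm_bound_small[OF this q] obtain d where d: "d > 0" "norm_bound q d \<le> e / 2" by blast
      have "\<forall>\<^sub>F n in sequentially. Lq_le q d (\<lambda>x. multi_partial \<alpha> (F n) x - g x)"
        using R \<alpha> g d(1) by blast
      then show "\<forall>\<^sub>F n in sequentially. dist (Lq_norm q (weak_deriv \<alpha> (\<lambda>x. F n x - f x))) 0 < e"
      proof eventually_elim
        case (elim n)
        let ?w = "weak_deriv \<alpha> (\<lambda>x. F n x - f x)"
        have "AE x in lebesgue. multi_partial \<alpha> (F n) x - g x = ?w x"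
          using AE(1)[OF g, of n] by eventually_elim simp
        then have "Lq_le q d ?w" using elim by (rule Lq_le_cong)
        then have "Lq_norm q ?w \<le> norm_bound q d"
          using d(1) q by (intro Lq_le_imp_Lq(2) AE(2)[OF g]) auto
        with d(2) e show ?case using Lq_norm_nonneg[of q ?w] by simp
      qed
    qed
    then have "(\<lambda>n. Wkq_norm k q (\<lambda>x. F n x - f x)) \<longlonglongrightarrow> 0"
      unfolding Wkq_norm_def by (intro tendsto_null_sum) simp
    with f ev show "Wkq_tendsto k q F f" by (simp add: Wkq_tendsto_def)
  qed
qed

lemma jets_multi_partial:
  "smooth_seq F \<Longrightarrow> jets k P F \<Longrightarrow> fst \<alpha> + snd \<alpha> \<le> k \<Longrightarrow> P (\<lambda>n. multi_partial \<alpha> (F n))"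
proof -
  assume F: "jets k P F" and \<alpha>: "fst \<alpha> + snd \<alpha> \<le> k"
  have 2: "jets l P (\<lambda>n. (partial e2 ^^ j) (G n))" if "jets (l + j) P G" for l j G
    using that
  proof (induction j arbitrary: G)
    case (Suc j)
    then have "jets (l + j) P (\<lambda>n. partial e2 (G n))" by simp
    from Suc.IH[OF this] show ?case by (simp add: funpow_swap1)
  qed simp
  have 1: "jets l P (\<lambda>n. (partial e1 ^^ i) (G n))" if "jets (l + i) P G" for l i G
    using that
  proof (induction i arbitrary: G)
    case (Suc i)
    then have "jets (l + i) P (\<lambda>n. partial e1 (G n))" by simp
    from Suc.IH[OF this] show ?case by (simp add: funpow_swap1)
  qed simp
  obtain l where "k = l + fst \<alpha> + snd \<alpha>" using \<alpha> by (metis add.assoc add.commute le_iff_add)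
  with 2[of "l + fst \<alpha>" "snd \<alpha>" F] F have "jets l P (\<lambda>n. multi_partial \<alpha> (F n))"
    unfolding multi_partial_def by (intro 1) simp
  then show ?thesis by (rule jets_0D)
qed

text \<open>By the symmetry of second derivatives every iterated derivative is a \<open>multi_partial\<close>.\<close>

lemma jets_if_multi_partials:
  assumes F: "smooth_seq F" and P: "\<And>\<alpha>. P (\<lambda>n. multi_partial \<alpha> (F n))"
  shows "jets k P F"
proof -
  have "jets k P (\<lambda>n. multi_partial (i, j) (F n))" for i j
  proof (induction k arbitrary: i j)
    case (Suc k)
    then show ?case
      using P smooth_seqD[OF F] by (simp add: partial1_multi_partial partial2_multi_partial)
  qed (simp add: P)
  from this[of 0 0] show ?thesis by (simp add: multi_partial_def)
qed

lemma Wkq_tendsto_imp_jets_bounded: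
  assumes F: "smooth_seq F" and q: "q > 0" and conv: "\<And>k. Wkq_tendsto k q F f"
  shows "jets k (bounded_in q) F"
proof (rule jets_if_multi_partials[OF F])
  fix \<alpha> :: "nat \<times> nat"
  let ?k = "fst \<alpha> + snd \<alpha>"
  have f: "f \<in> Wkq ?k q" and R: "\<And>g. is_weak_deriv \<alpha> f g \<Longrightarrow>
       \<forall>\<^sub>F n in sequentially. Lq_le q 1 (\<lambda>x. multi_partial \<alpha> (F n) x - g x)"
    using conv[of ?k] unfolding Wkq_tendsto_smooth_iff[OF F q] by auto
  from f obtain g where g: "is_weak_deriv \<alpha> f g" "g \<in> Lq q"
    by (auto simp: Wkq_def deriv_in_Lq_def)
  obtain C where C: "C \<ge> 0" "Lq_le q C g" using Lq_imp_Lq_le_ex[OF g(2) q] by blast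
  have m: "g \<in> borel_measurable lebesgue" using g(1) by (rule is_weak_deriv_measurable)
  have "\<forall>\<^sub>F n in sequentially. Lq_le q (2 * (if q = \<infinity> then 1 else 2 powr real_of_ereal q) * (C + 1))
      (multi_partial \<alpha> (F n))"
    using R[OF g(1)]
  proof eventually_elim
    case (elim n)
    have c: "continuous_on UNIV (multi_partial \<alpha> (F n))"
      by (intro smooth_continuous smooth_multi_partial smooth_seqD[OF F])
    have "Lq_le q (2 * (if q = \<infinity> then 1 else 2 powr real_of_ereal q) * (C + 1))
        (\<lambda>x. (multi_partial \<alpha> (F n) x - g x) + g x)"
      using elim C m q lebesgue_measurable_continuous[OF c]
      by (intro Lq_le_add) (auto elim: Lq_le_mono)
    then show ?case by simp
  qed
  then show "bounded_in q (\<lambda>n. multi_partial \<alpha> (F n))" unfolding bounded_in_def by blast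
qed

lemma multi_partial_diff:
  assumes "smooth f" "smooth g"
  shows "multi_partial \<alpha> (\<lambda>x. f x - g x) = (\<lambda>x. multi_partial \<alpha> f x - multi_partial \<alpha> g x)"
proof -
  have 1: "partial e (\<lambda>x. f x - g x) = (\<lambda>x. partial e f x - partial e g x)"
    if "smooth f" "smooth g" for e f g
    using that by (intro ext partial_diff smooth_differentiable)
  have 2: "(partial e2 ^^ j) (\<lambda>x. f x - g x) = (\<lambda>x. (partial e2 ^^ j) f x - (partial e2 ^^ j) g x)" for j
    using assms by (induction j) (auto simp: 1 smooth_funpow2)
  have 3: "(partial e1 ^^ i) (\<lambda>x. f x - g x) = (\<lambda>x. (partial e1 ^^ i) f x - (partial e1 ^^ i) g x)"
    if "smooth f" "smooth g" for i f g
    using that by (induction i) (auto simp: 1 smooth_funpow1)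
  show ?thesis
    unfolding multi_partial_def 2 using assms by (intro 3 smooth_funpow2)
qed

lemma Wkq_tendsto_perturb:
  assumes F: "smooth_seq F" and G: "smooth_seq G" and q: "q > 0"
    and conv: "Wkq_tendsto k q F f" and null: "jets k (null_in q) (\<lambda>n x. G n x - F n x)"
  shows "Wkq_tendsto k q G f"
  unfolding Wkq_tendsto_smooth_iff[OF G q]
proof (intro conjI allI impI)
  show "f \<in> Wkq k q" using conv by (simp add: Wkq_tendsto_def)
  fix \<alpha> g and e :: real
  assume \<alpha>: "fst \<alpha> + snd \<alpha> \<le> k" and g: "is_weak_deriv \<alpha> f g" and e: "e > 0"
  define K where "K = 2 * (if q = \<infinity> then 1 else 2 powr real_of_ereal q)"
  have K: "K > 0" by (auto simp: K_def)
  have GF: "smooth_seq (\<lambda>n x. G n x - F n x)"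
    using F G by (auto simp: smooth_seq_def)
  have "\<forall>\<^sub>F n in sequentially. Lq_le q (e / K) (\<lambda>x. multi_partial \<alpha> (F n) x - g x)"
    using conv \<alpha> g e K unfolding Wkq_tendsto_smooth_iff[OF F q] by simp
  moreover have "\<forall>\<^sub>F n in sequentially. Lq_le q (e / K) (multi_partial \<alpha> (\<lambda>x. G n x - F n x))"
    using jets_multi_partial[OF GF null \<alpha>] e K unfolding null_in_def by simp
  ultimately show "\<forall>\<^sub>F n in sequentially. Lq_le q e (\<lambda>x. multi_partial \<alpha> (G n) x - g x)"
  proof eventually_elim
    case (elim n)
    have s: "smooth (F n)" "smooth (G n)" using F G by (auto intro: smooth_seqD)
    note m = s[THEN smooth_multi_partial, THEN smooth_continuous, THEN lebesgue_measurable_continuous]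
    have "Lq_le q (K * (e / K)) (\<lambda>x. (multi_partial \<alpha> (F n) x - g x) +
        (multi_partial \<alpha> (G n) x - multi_partial \<alpha> (F n) x))"
      unfolding K_def
      using elim e K q is_weak_deriv_measurable[OF g] m unfolding K_def
      by (intro Lq_le_add) (auto simp: multi_partial_diff s)
    then show ?case using K by simp
  qed
qed

section \<open>The equations for modulus and phase\<close>

lemma smooth_of_real: "smooth f \<Longrightarrow> smooth (\<lambda>x. complex_of_real (f x))"
  by (rule smooth_linear[OF bounded_linear_of_real])

lemma partial_of_real: "smooth f \<Longrightarrow> partial e (\<lambda>x. complex_of_real (f x)) x = complex_of_real (partial e f x)"
  using partial_linear[OF bounded_linear_of_real] smooth_differentiable by blast

text \<open>The logarithmic derivative of \<open>U\<close> is half that of \<open>U\<^sup>2 = m exp (2 \<i> \<Phi>)\<close>, whose factors are smooth.\<close>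

lemma partial_polar:
  fixes U :: "R2 \<Rightarrow> complex"
  assumes U: "smooth U" and \<Phi>: "smooth \<Phi>"
    and polar: "\<And>x. U x = of_real (cmod (U x)) * exp (\<i> * of_real (\<Phi> x))"
    and m: "smooth m" "\<And>x. (cmod (U x))\<^sup>2 = m x" "\<And>x. m x > 0"
  shows "partial e U x = U x * (of_real (partial e m x * inverse (m x) / 2) + \<i> * of_real (partial e \<Phi> x))"
proof -
  let ?E = "\<lambda>x. exp (\<i> * of_real (2 * \<Phi> x))"
  have sq: "U x * U x = of_real (m x) * ?E x" for x
  proof -
    have "U x * U x = of_real ((cmod (U x))\<^sup>2) * (exp (\<i> * of_real (\<Phi> x)) * exp (\<i> * of_real (\<Phi> x)))"
      by (subst (1 2) polar) (simp add: power2_eq_square)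
    also have "exp (\<i> * of_real (\<Phi> x)) * exp (\<i> * of_real (\<Phi> x)) = ?E x"
      by (simp add: algebra_simps flip: exp_add)
    finally show ?thesis by (simp only: m(2))
  qed
  note D = smooth_differentiable[unfolded frechet_derivative_works]
  have "((\<lambda>x. \<i> * complex_of_real (2 * \<Phi> x)) has_derivative
      (\<lambda>h. \<i> * of_real (2 * frechet_derivative \<Phi> (at x) h))) (at x)"
    by (intro has_derivative_mult_right has_derivative_of_real D \<Phi>)
  from has_derivative_compose[OF this DERIV_exp[unfolded has_field_derivative_def]]
  have DE: "(?E has_derivative
      (\<lambda>h. ?E x * (\<i> * of_real (2 * frechet_derivative \<Phi> (at x) h)))) (at x)" .
  have "((\<lambda>x. of_real (m x) * ?E x) has_derivative (\<lambda>h. of_real (m x) *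
      (?E x * (\<i> * of_real (2 * frechet_derivative \<Phi> (at x) h))) +
      of_real (frechet_derivative m (at x) h) * ?E x)) (at x)"
    by (intro has_derivative_mult has_derivative_of_real D m DE)
  from partial_eq[OF this, of e]
  have "partial e (\<lambda>x. U x * U x) x = of_real (m x) * ?E x * (\<i> * of_real (2 * partial e \<Phi> x)) +
      of_real (partial e m x) * ?E x"
    by (simp add: sq partial_def)
  moreover have "partial e (\<lambda>x. U x * U x) x = 2 * U x * partial e U x"
    using U by (simp add: partial_mult)
  moreover have E: "?E x = U x * U x * inverse (of_real (m x))"
    using m(3)[of x] by (simp add: sq)
  ultimately have "2 * U x * partial e U x = U x * U x * (\<i> * of_real (2 * partial e \<Phi> x)) +
      of_real (partial e m x) * (U x * U x * inverse (of_real (m x)))"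
    using m(3)[of x] unfolding E by simp
  moreover have "U x \<noteq> 0" using m(2,3)[of x] by auto
  moreover have "U x * U x * (\<i> * of_real (2 * partial e \<Phi> x)) +
      of_real (partial e m x) * (U x * U x * inverse (of_real (m x))) =
      2 * U x * (U x * (of_real (partial e m x * inverse (m x) / 2) + \<i> * of_real (partial e \<Phi> x)))"
    by (simp add: algebra_simps)
  ultimately show ?thesis by simp
qed

text \<open>Here \<open>\<Lambda>1\<close> and \<open>\<Lambda>2\<close> are the partial derivatives of \<open>\<epsilon>\<^sup>-\<^sup>2 ln \<bar>U\<bar>\<close>.  Writing \<open>U = exp (h)\<close>, the
  equation reads \<open>\<i> c \<epsilon> \<partial>\<^sub>1 h + \<epsilon>\<^sup>2 (\<partial>\<^sub>1\<^sup>2 h + (\<partial>\<^sub>1 h)\<^sup>2) + \<dots> = 0\<close>; real and imaginary parts give the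
  two conclusions.\<close>

lemma polar_equations:
  fixes U :: "R2 \<Rightarrow> complex" and N \<Phi> M \<Lambda>1 \<Lambda>2 :: "R2 \<Rightarrow> real" and \<epsilon> c :: real
  assumes U: "smooth U" and \<Phi>: "smooth \<Phi>" and N: "smooth N"
    and polar: "\<And>x. U x = of_real (cmod (U x)) * exp (\<i> * of_real (\<Phi> x))"
    and m: "\<And>x. (cmod (U x))\<^sup>2 = 1 - \<epsilon>\<^sup>2 * N x / 6" "\<And>x. 1 - \<epsilon>\<^sup>2 * N x / 6 > 0"
    and \<epsilon>: "\<epsilon> > 0"
    and eq: "\<And>x. \<i> * of_real (c * \<epsilon>) * partial e1 U x + of_real (\<epsilon>\<^sup>2) * partial e1 (partial e1 U) x
        + of_real (\<epsilon> ^ 4 / 2) * partial e2 (partial e2 U) x + U x * of_real (\<epsilon>\<^sup>2 * N x / 6) = 0"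
  defines "M \<equiv> \<lambda>x. inverse (1 - \<epsilon>\<^sup>2 * N x / 6)"
    and "\<Lambda>1 \<equiv> \<lambda>x. - 1 / 12 * (M x * partial e1 N x)" and "\<Lambda>2 \<equiv> \<lambda>x. - 1 / 12 * (M x * partial e2 N x)"
  shows "partial e1 (partial e1 \<Phi>) x + \<epsilon>\<^sup>2 / 2 * partial e2 (partial e2 \<Phi>) x =
      \<epsilon> * (- c * \<Lambda>1 x - 2 * \<epsilon> * \<Lambda>1 x * partial e1 \<Phi> x - \<epsilon> ^ 3 * \<Lambda>2 x * partial e2 \<Phi> x)"
    and "c * partial e1 \<Phi> x / \<epsilon> = N x / 6 + \<epsilon>\<^sup>2 * partial e1 \<Lambda>1 x + \<epsilon> ^ 4 * (\<Lambda>1 x)\<^sup>2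
      + \<epsilon> ^ 4 / 2 * partial e2 \<Lambda>2 x + \<epsilon> ^ 6 / 2 * (\<Lambda>2 x)\<^sup>2
      - (partial e1 \<Phi> x)\<^sup>2 - \<epsilon>\<^sup>2 / 2 * (partial e2 \<Phi> x)\<^sup>2"
proof -
  let ?m = "\<lambda>x. 1 - \<epsilon>\<^sup>2 * N x / 6"
  have sm': "smooth (\<lambda>x. 1 + (- \<epsilon>\<^sup>2 / 6) * N x)"
    using N by (intro smooth_add smooth_cmult smooth_const)
  have m_eq: "?m = (\<lambda>x. 1 + (- \<epsilon>\<^sup>2 / 6) * N x)" by (auto simp: algebra_simps)
  have sm: "smooth ?m" unfolding m_eq by (rule sm')
  have pm: "partial e ?m x = (- \<epsilon>\<^sup>2 / 6) * partial e N x" for e x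
  proof -
    have "partial e ?m x = partial e (\<lambda>x. 1) x + partial e (\<lambda>x. (- \<epsilon>\<^sup>2 / 6) * N x) x"
      unfolding m_eq by (intro partial_add smooth_differentiable smooth_const smooth_cmult N)
    then show ?thesis by (simp only: partial_const partial_cmult[OF N] add_0)
  qed
  have sM: "smooth M" unfolding M_def using m(2) by (intro smooth_inverse sm) (simp add: less_imp_neq[symmetric])
  have s\<Lambda>: "smooth \<Lambda>1" "smooth \<Lambda>2" unfolding \<Lambda>1_def \<Lambda>2_def
    by (intro smooth_cmult smooth_mult smooth_partial1 smooth_partial2 sM N)+
  define k1 where "k1 x = complex_of_real (\<epsilon>\<^sup>2 * \<Lambda>1 x) + \<i> * of_real (partial e1 \<Phi> x)" for x
  define k2 where "k2 x = complex_of_real (\<epsilon>\<^sup>2 * \<Lambda>2 x) + \<i> * of_real (partial e2 \<Phi> x)" for x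
  have pU: "partial e1 U = (\<lambda>x. U x * k1 x)" "partial e2 U = (\<lambda>x. U x * k2 x)"
  proof -
    have "partial e U x = U x * (of_real (\<epsilon>\<^sup>2 * (- 1 / 12 * (M x * partial e N x))) + \<i> * of_real (partial e \<Phi> x))" for e x
    proof -
      have "partial e ?m x * inverse (?m x) / 2 = \<epsilon>\<^sup>2 * (- 1 / 12 * (M x * partial e N x))"
        unfolding pm M_def by simp
      then show ?thesis using partial_polar[OF U \<Phi> polar sm m, of e x] by simp
    qed
    then show "partial e1 U = (\<lambda>x. U x * k1 x)" "partial e2 U = (\<lambda>x. U x * k2 x)"
      by (auto simp: k1_def k2_def \<Lambda>1_def \<Lambda>2_def)
  qed
  have K: "smooth (\<lambda>x. complex_of_real (\<epsilon>\<^sup>2 * l x) + \<i> * of_real (g x))"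
    "partial e (\<lambda>x. complex_of_real (\<epsilon>\<^sup>2 * l x) + \<i> * of_real (g x)) x =
      complex_of_real (\<epsilon>\<^sup>2 * partial e l x) + \<i> * of_real (partial e g x)"
    if "smooth l" "smooth g" for l g e x
  proof -
    have s: "smooth (\<lambda>x. complex_of_real (\<epsilon>\<^sup>2 * l x))" "smooth (\<lambda>x. \<i> * complex_of_real (g x))"
      "smooth (\<lambda>x. complex_of_real (g x))" "smooth (\<lambda>x. \<epsilon>\<^sup>2 * l x)"
      using that by (auto intro!: smooth_of_real smooth_cmult)
    show "smooth (\<lambda>x. complex_of_real (\<epsilon>\<^sup>2 * l x) + \<i> * of_real (g x))"
      using s by (intro smooth_add)
    show "partial e (\<lambda>x. complex_of_real (\<epsilon>\<^sup>2 * l x) + \<i> * of_real (g x)) x =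
      complex_of_real (\<epsilon>\<^sup>2 * partial e l x) + \<i> * of_real (partial e g x)"
      using that s
      by (subst partial_add) (simp_all only: smooth_differentiable partial_of_real partial_cmult)
  qed
  have sk: "smooth k1" "smooth k2"
    unfolding k1_def[abs_def] k2_def[abs_def] by (intro K(1) s\<Lambda> smooth_partial1 smooth_partial2 \<Phi>)+
  have pk: "partial e k1 x = complex_of_real (\<epsilon>\<^sup>2 * partial e \<Lambda>1 x) + \<i> * of_real (partial e (partial e1 \<Phi>) x)"
    "partial e k2 x = complex_of_real (\<epsilon>\<^sup>2 * partial e \<Lambda>2 x) + \<i> * of_real (partial e (partial e2 \<Phi>) x)" for e
    unfolding k1_def[abs_def] k2_def[abs_def] by (intro K(2) s\<Lambda> smooth_partial1 smooth_partial2 \<Phi>)+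
  have "U x * (\<i> * of_real (c * \<epsilon>) * k1 x + of_real (\<epsilon>\<^sup>2) * (partial e1 k1 x + k1 x * k1 x)
     + of_real (\<epsilon> ^ 4 / 2) * (partial e2 k2 x + k2 x * k2 x) + of_real (\<epsilon>\<^sup>2 * N x / 6)) = 0"
    using eq[of x] U sk unfolding pU by (simp add: partial_mult pU algebra_simps)
  moreover have "U x \<noteq> 0" using m[of x] by auto
  ultimately have Z: "\<i> * of_real (c * \<epsilon>) * k1 x + of_real (\<epsilon>\<^sup>2) * (partial e1 k1 x + k1 x * k1 x)
     + of_real (\<epsilon> ^ 4 / 2) * (partial e2 k2 x + k2 x * k2 x) + of_real (\<epsilon>\<^sup>2 * N x / 6) = 0"
    by simp
  have k_Re_Im: "Re (k1 x) = \<epsilon>\<^sup>2 * \<Lambda>1 x" "Im (k1 x) = partial e1 \<Phi> x"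
    "Re (k2 x) = \<epsilon>\<^sup>2 * \<Lambda>2 x" "Im (k2 x) = partial e2 \<Phi> x"
    "Re (partial e1 k1 x) = \<epsilon>\<^sup>2 * partial e1 \<Lambda>1 x" "Im (partial e1 k1 x) = partial e1 (partial e1 \<Phi>) x"
    "Re (partial e2 k2 x) = \<epsilon>\<^sup>2 * partial e2 \<Lambda>2 x" "Im (partial e2 k2 x) = partial e2 (partial e2 \<Phi>) x"
    by (simp_all add: pk k1_def k2_def)
  have Re_r: "Re (of_real r * z) = r * Re z" "Im (of_real r * z) = r * Im z" for r z by simp_all
  have Re_i: "Re (\<i> * of_real r * z) = - r * Im z" "Im (\<i> * of_real r * z) = r * Re z" for r z by simp_all
  from arg_cong[OF Z, of Im]
  have "\<epsilon>\<^sup>2 * (partial e1 (partial e1 \<Phi>) x + \<epsilon>\<^sup>2 / 2 * partial e2 (partial e2 \<Phi>) x) =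
      \<epsilon>\<^sup>2 * (\<epsilon> * (- c * \<Lambda>1 x - 2 * \<epsilon> * \<Lambda>1 x * partial e1 \<Phi> x - \<epsilon> ^ 3 * \<Lambda>2 x * partial e2 \<Phi> x))"
    unfolding plus_complex.sel Re_r Re_i times_complex.sel k_Re_Im Im_complex_of_real zero_complex.sel
    by (simp add: algebra_simps power2_eq_square power3_eq_cube power4_eq_xxxx)
  then show "partial e1 (partial e1 \<Phi>) x + \<epsilon>\<^sup>2 / 2 * partial e2 (partial e2 \<Phi>) x =
      \<epsilon> * (- c * \<Lambda>1 x - 2 * \<epsilon> * \<Lambda>1 x * partial e1 \<Phi> x - \<epsilon> ^ 3 * \<Lambda>2 x * partial e2 \<Phi> x)"
    using mult_left_cancel[of "\<epsilon>\<^sup>2"] \<epsilon> by fastforce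
  from arg_cong[OF Z, of Re]
  have "c * \<epsilon> * partial e1 \<Phi> x = \<epsilon>\<^sup>2 * (N x / 6 + \<epsilon>\<^sup>2 * partial e1 \<Lambda>1 x + \<epsilon> ^ 4 * (\<Lambda>1 x)\<^sup>2
      + \<epsilon> ^ 4 / 2 * partial e2 \<Lambda>2 x + \<epsilon> ^ 6 / 2 * (\<Lambda>2 x)\<^sup>2
      - (partial e1 \<Phi> x)\<^sup>2 - \<epsilon>\<^sup>2 / 2 * (partial e2 \<Phi> x)\<^sup>2)"
    unfolding plus_complex.sel Re_r Re_i times_complex.sel k_Re_Im Re_complex_of_real zero_complex.sel
    by (simp add: algebra_simps eval_nat_numeral)
  then show "c * partial e1 \<Phi> x / \<epsilon> = N x / 6 + \<epsilon>\<^sup>2 * partial e1 \<Lambda>1 x + \<epsilon> ^ 4 * (\<Lambda>1 x)\<^sup>2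
      + \<epsilon> ^ 4 / 2 * partial e2 \<Lambda>2 x + \<epsilon> ^ 6 / 2 * (\<Lambda>2 x)\<^sup>2
      - (partial e1 \<Phi> x)\<^sup>2 - \<epsilon>\<^sup>2 / 2 * (partial e2 \<Phi> x)\<^sup>2"
    using \<epsilon> by (simp add: divide_eq_eq power2_eq_square mult.commute)
qed

section \<open>The asymptotic regime\<close>

text \<open>From \<open>\<partial>M = (\<epsilon>\<^sup>2 / 6) M\<^sup>2 \<partial>N\<close>: a derivative of \<open>M\<close> is expressed by \<open>M\<close> with one derivative less.\<close>

lemma jets_bounded_inverse:
  fixes N M :: "nat \<Rightarrow> R2 \<Rightarrow> real"
  assumes N: "smooth_seq N" and M: "smooth_seq M" and \<epsilon>: "Bseq \<epsilon>"
    and eq: "\<And>n x. M n x * (1 - (\<epsilon> n)\<^sup>2 * N n x / 6) = 1"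
    and bN: "\<And>k. jets k (bounded_in \<infinity>) N" and bM: "bounded_in \<infinity> M"
  shows "jets k (bounded_in \<infinity>) M"
proof (induction k)
  case (Suc k)
  have P: "(\<lambda>n. partial e (M n)) = (\<lambda>n x. ((\<epsilon> n)\<^sup>2 / 6) * (M n x * (M n x * partial e (N n) x)))" for e
  proof (intro ext)
    fix n x
    have s: "smooth (N n)" "smooth (M n)" using N M by (auto intro: smooth_seqD)
    have "partial e (\<lambda>x. M n x * (1 + (- (\<epsilon> n)\<^sup>2 / 6) * N n x)) x = 0"
    proof -
      have "(\<lambda>x. M n x * (1 + (- (\<epsilon> n)\<^sup>2 / 6) * N n x)) = (\<lambda>x. 1)"
      proof
        fix x
        show "M n x * (1 + (- (\<epsilon> n)\<^sup>2 / 6) * N n x) = 1"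
          using eq[of n x] by (simp add: algebra_simps)
      qed
      then show ?thesis by (simp add: partial_const)
    qed
    moreover have "partial e (\<lambda>x. M n x * (1 + (- (\<epsilon> n)\<^sup>2 / 6) * N n x)) x =
       M n x * (- (\<epsilon> n)\<^sup>2 / 6 * partial e (N n) x) + partial e (M n) x * (1 + (- (\<epsilon> n)\<^sup>2 / 6) * N n x)"
    proof -
      have "smooth (\<lambda>x. 1 + (- (\<epsilon> n)\<^sup>2 / 6) * N n x)" using s by (intro smooth_add smooth_cmult smooth_const)
      then show ?thesis
        using s by (subst partial_mult)
          (simp_all only: partial_add partial_const smooth_const smooth_differentiable smooth_cmult partial_cmult add_0)
    qed
    ultimately have "partial e (M n) x * (1 + (- (\<epsilon> n)\<^sup>2 / 6) * N n x) =
        M n x * ((\<epsilon> n)\<^sup>2 / 6 * partial e (N n) x)" by simp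
    then have "M n x * (partial e (M n) x * (1 + (- (\<epsilon> n)\<^sup>2 / 6) * N n x)) =
        M n x * (M n x * ((\<epsilon> n)\<^sup>2 / 6 * partial e (N n) x))" by (simp only:)
    moreover have "M n x * (partial e (M n) x * (1 + (- (\<epsilon> n)\<^sup>2 / 6) * N n x)) =
       partial e (M n) x * (M n x * (1 - (\<epsilon> n)\<^sup>2 * N n x / 6))"
      by (simp add: algebra_simps)
    ultimately have "partial e (M n) x * (M n x * (1 - (\<epsilon> n)\<^sup>2 * N n x / 6)) =
        M n x * (M n x * ((\<epsilon> n)\<^sup>2 / 6 * partial e (N n) x))" by (simp only:)
    then show "partial e (M n) x = ((\<epsilon> n)\<^sup>2 / 6) * (M n x * (M n x * partial e (N n) x))"
      unfolding eq by (simp add: mult.left_commute)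
  qed
  have B: "Bseq (\<lambda>n. (\<epsilon> n)\<^sup>2 / 6)"
    using Bseq_mult[OF Bseq_mult[OF \<epsilon> \<epsilon>] Bfun_const[of "1/6"]] by (simp add: power2_eq_square)
  have "jets k (bounded_in \<infinity>) (\<lambda>n. partial e (M n))" if e: "e = e1 \<or> e = e2" for e
  proof -
    have "jets k (bounded_in \<infinity>) (\<lambda>n. partial e (N n))" using bN[of "Suc k"] e by auto
    moreover have "smooth_seq (\<lambda>n. partial e (N n))" using N e by auto
    ultimately show ?thesis
      unfolding P using M Suc.IH B
      by (intro jets_bounded_cmult jets_bounded_mult smooth_seq_const smooth_seq_intros) auto
  qed
  then show ?case using bM by simp
qed (simp add: bM)

text \<open>The imaginary part of the equation makes the phase gradient small with all its derivatives, and
  then the real part compares \<open>\<partial>\<^sub>1 \<Theta>\<close> with \<open>N\<close>.\<close>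

lemma asymptotics:
  fixes N \<Phi> M :: "nat \<Rightarrow> R2 \<Rightarrow> real" and \<epsilon> c :: "nat \<Rightarrow> real"
  assumes N: "smooth_seq N" and \<Phi>: "smooth_seq \<Phi>" and M: "smooth_seq M"
    and \<epsilon>: "\<And>n. \<epsilon> n > 0" "\<epsilon> \<longlonglongrightarrow> 0" and c: "\<And>n. c n > 0" "c \<longlonglongrightarrow> sqrt 2"
    and bN: "\<And>k q. 1 < q \<Longrightarrow> jets k (bounded_in q) N"
    and bM: "bounded_in \<infinity> M" and M_eq: "\<And>n x. M n x * (1 - (\<epsilon> n)\<^sup>2 * N n x / 6) = 1"
    and null: "null_in 2 (\<lambda>n. partial e1 (\<Phi> n))" "null_in 2 (\<lambda>n x. \<epsilon> n / sqrt 2 * partial e2 (\<Phi> n) x)"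
  defines "\<Lambda>1 \<equiv> \<lambda>n x. - 1 / 12 * (M n x * partial e1 (N n) x)"
    and "\<Lambda>2 \<equiv> \<lambda>n x. - 1 / 12 * (M n x * partial e2 (N n) x)"
  assumes im: "\<And>n x. partial e1 (partial e1 (\<Phi> n)) x + (\<epsilon> n)\<^sup>2 / 2 * partial e2 (partial e2 (\<Phi> n)) x =
      \<epsilon> n * (- c n * \<Lambda>1 n x - 2 * \<epsilon> n * \<Lambda>1 n x * partial e1 (\<Phi> n) x - \<epsilon> n ^ 3 * \<Lambda>2 n x * partial e2 (\<Phi> n) x)"
    and re: "\<And>n x. c n * partial e1 (\<Phi> n) x / \<epsilon> n = N n x / 6 + (\<epsilon> n)\<^sup>2 * partial e1 (\<Lambda>1 n) x
      + \<epsilon> n ^ 4 * (\<Lambda>1 n x)\<^sup>2 + \<epsilon> n ^ 4 / 2 * partial e2 (\<Lambda>2 n) x + \<epsilon> n ^ 6 / 2 * (\<Lambda>2 n x)\<^sup>2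
      - (partial e1 (\<Phi> n) x)\<^sup>2 - (\<epsilon> n)\<^sup>2 / 2 * (partial e2 (\<Phi> n) x)\<^sup>2"
    and q: "1 < q"
  shows "jets k (null_in q) (\<lambda>n x. 6 * sqrt 2 / \<epsilon> n * partial e1 (\<Phi> n) x - N n x)"
proof -
  have q0: "0 < q" "0 \<le> q" "1 \<le> q"
    using less_trans[of 0 1 q] q by simp_all
  have B\<epsilon>: "Bseq \<epsilon>" and Bc: "Bseq c"
    using \<epsilon>(2) c(2) convergentI convergent_imp_Bseq by blast+
  have jM: "jets k (bounded_in \<infinity>) M" for k
    by (rule jets_bounded_inverse[OF N M B\<epsilon> M_eq bN bM]) simp
  have s\<Lambda>: "smooth_seq \<Lambda>1" "smooth_seq \<Lambda>2"
    unfolding \<Lambda>1_def \<Lambda>2_def by (intro smooth_seq_const smooth_seq_intros N M)+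
  have j\<Lambda>: "jets k (bounded_in r) \<Lambda>1" "jets k (bounded_in r) \<Lambda>2" if "1 < r" for k r
  proof -
    have r0: "0 \<le> r" using less_trans[of 0 1 r] that by simp
    have d: "jets k (bounded_in r) (\<lambda>n. partial e1 (N n))" "jets k (bounded_in r) (\<lambda>n. partial e2 (N n))"
      using bN[OF that, of "Suc k"] by simp_all
    show "jets k (bounded_in r) \<Lambda>1" "jets k (bounded_in r) \<Lambda>2"
      unfolding \<Lambda>1_def \<Lambda>2_def
      by (intro jets_bounded_cmult[where c = "\<lambda>_. - 1 / 12"] jets_bounded_mult r0 Bfun_const jM d
          smooth_seq_const smooth_seq_intros N M)+
  qed
  define \<mu> where "\<mu> n = \<epsilon> n / sqrt 2" for n
  have \<mu>2: "(\<mu> n)\<^sup>2 = (\<epsilon> n)\<^sup>2 / 2" for n by (simp add: \<mu>_def power_divide)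
  have B\<mu>: "Bseq \<mu>" unfolding \<mu>_def using Bseq_mult[OF B\<epsilon> Bfun_const[of "1 / sqrt 2"]] by simp
  let ?z1 = "\<lambda>n. partial e1 (\<Phi> n)" and ?z2 = "\<lambda>n x. \<mu> n * partial e2 (\<Phi> n) x"
  let ?f = "\<lambda>n x. (- c n) * \<Lambda>1 n x" and ?b = "\<lambda>n x. (- 2 * \<epsilon> n) * \<Lambda>1 n x"
    and ?d = "\<lambda>n x. (- 2 * \<epsilon> n * \<mu> n) * \<Lambda>2 n x"
  have sz: "smooth_seq ?z1" "smooth_seq ?z2" by (intro smooth_seq_const smooth_seq_intros \<Phi>)+
  have z: "jets k (null_in 2) ?z1 \<and> jets k (null_in 2) ?z2" for k
  proof (rule jets_energy_null[where f = ?f and b = ?b and d = ?d and \<epsilon> = \<epsilon>])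
    show "smooth_seq ?b" "smooth_seq ?d" "smooth_seq ?f"
      by (intro smooth_seq_const smooth_seq_intros s\<Lambda>)+
    show "jets k (bounded_in \<infinity>) ?b" "jets k (bounded_in \<infinity>) ?d" for k
      by (rule jets_bounded_cmult; (intro s\<Lambda> j\<Lambda> Bseq_mult Bfun_const B\<epsilon> B\<mu>)?; simp)+
    show "jets k (bounded_in 2) ?f"
      using s\<Lambda> j\<Lambda>[of 2 k] Bc by (intro jets_bounded_cmult) (auto simp: Bseq_minus_iff)
    show "partial e1 (partial e1 (\<Phi> n)) x + (\<mu> n)\<^sup>2 * partial e2 (partial e2 (\<Phi> n)) x =
       \<epsilon> n * (?f n x + ?b n x * partial e1 (\<Phi> n) x + ?d n x * (\<mu> n * partial e2 (\<Phi> n) x))" for n x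
    proof -
      have "?d n x * (\<mu> n * partial e2 (\<Phi> n) x) =
          - (2 * (\<mu> n)\<^sup>2 * \<epsilon> n * \<Lambda>2 n x * partial e2 (\<Phi> n) x)"
        by (simp add: power2_eq_square)
      also have "2 * (\<mu> n)\<^sup>2 = (\<epsilon> n)\<^sup>2" by (simp add: \<mu>2)
      finally have "?d n x * (\<mu> n * partial e2 (\<Phi> n) x) = - (\<epsilon> n ^ 3 * \<Lambda>2 n x * partial e2 (\<Phi> n) x)"
        by (simp add: power2_eq_square power3_eq_cube)
      then show ?thesis unfolding \<mu>2 im by (simp only:) simp
    qed
    show "null_in 2 ?z2" using null(2) by (simp add: \<mu>_def)
  qed (use \<epsilon> \<Phi> null in \<open>auto simp: \<mu>_def\<close>)
  have z2: "jets k (null_in 2) ?z1" "jets k (null_in 2) ?z2" for k using z by blast+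
  have zu: "jets k (null_in \<infinity>) ?z1" "jets k (null_in \<infinity>) ?z2" for k
    by (rule jets_null_uniform[OF sz(1) z2(1)], rule jets_null_uniform[OF sz(2) z2(2)])
  define Q where "Q n x = ?z1 n x * ?z1 n x + ?z2 n x * ?z2 n x" for n x
  have jQ: "jets k (null_in q) Q"
    unfolding Q_def
    by (intro jets_null_add jets_null_product smooth_seq_intros sz z2 zu q0)
  define A where "A n x = (\<epsilon> n)\<^sup>2 * partial e1 (\<Lambda>1 n) x + (\<epsilon> n ^ 4 * (\<Lambda>1 n x * \<Lambda>1 n x)
      + (\<epsilon> n ^ 4 / 2 * partial e2 (\<Lambda>2 n) x + \<epsilon> n ^ 6 / 2 * (\<Lambda>2 n x * \<Lambda>2 n x)))" for n x
  have lim: "(\<lambda>n. (\<epsilon> n)\<^sup>2) \<longlonglongrightarrow> 0" "(\<lambda>n. \<epsilon> n ^ 4) \<longlonglongrightarrow> 0"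
    "(\<lambda>n. \<epsilon> n ^ 4 / 2) \<longlonglongrightarrow> 0" "(\<lambda>n. \<epsilon> n ^ 6 / 2) \<longlonglongrightarrow> 0"
    using tendsto_power[OF \<epsilon>(2), of 2] tendsto_power[OF \<epsilon>(2), of 4] tendsto_power[OF \<epsilon>(2), of 6]
    by (simp_all add: tendsto_divide_zero)
  have jA: "jets k (null_in q) A"
  proof -
    have d: "jets k (bounded_in q) (\<lambda>n. partial e1 (\<Lambda>1 n))" "jets k (bounded_in q) (\<lambda>n. partial e2 (\<Lambda>2 n))"
      using j\<Lambda>[OF q, of "Suc k"] by simp_all
    have p: "jets k (bounded_in q) (\<lambda>n x. \<Lambda>1 n x * \<Lambda>1 n x)" "jets k (bounded_in q) (\<lambda>n x. \<Lambda>2 n x * \<Lambda>2 n x)"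
      using j\<Lambda>[OF q, of k] j\<Lambda>[of \<infinity> k] s\<Lambda> q0 by (auto intro!: jets_bounded_mult)
    show ?thesis
      unfolding A_def
      by (intro jets_null_add jets_null_cmult' smooth_seq_const smooth_seq_intros s\<Lambda> q0 lim d p)
  qed
  have sA: "smooth_seq A" "smooth_seq Q"
    unfolding A_def Q_def by (intro smooth_seq_const smooth_seq_intros s\<Lambda> sz)+
  define r where "r n = sqrt 2 / c n" for n
  have r: "r \<longlonglongrightarrow> 1"
    using tendsto_divide[OF tendsto_const c(2), of "sqrt 2"] by (simp add: r_def[abs_def])
  have r1: "(\<lambda>n. r n - 1) \<longlonglongrightarrow> 0" using tendsto_diff[OF r tendsto_const[of 1]] by simp
  have Br: "Bseq (\<lambda>n. 6 * r n)" "Bseq (\<lambda>n. - 6 * r n)"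
  proof -
    have "Bseq r" using r convergentI convergent_imp_Bseq by blast
    then show "Bseq (\<lambda>n. 6 * r n)" "Bseq (\<lambda>n. - 6 * r n)" by (intro Bseq_mult Bfun_const; assumption)+
  qed
  have "(\<lambda>n x. 6 * sqrt 2 / \<epsilon> n * partial e1 (\<Phi> n) x - N n x) =
      (\<lambda>n x. (r n - 1) * N n x + ((6 * r n) * A n x + (- 6 * r n) * Q n x))"
  proof (intro ext)
    fix n x
    have "6 * sqrt 2 / \<epsilon> n * partial e1 (\<Phi> n) x = 6 * r n * (c n * partial e1 (\<Phi> n) x / \<epsilon> n)"
      using c(1)[of n] by (simp add: r_def)
    also have "c n * partial e1 (\<Phi> n) x / \<epsilon> n = N n x / 6 + A n x - Q n x"
      unfolding re A_def Q_def
      by (simp add: \<mu>2 power2_eq_square[symmetric] power_mult_distrib)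
    finally show "6 * sqrt 2 / \<epsilon> n * partial e1 (\<Phi> n) x - N n x =
        (r n - 1) * N n x + ((6 * r n) * A n x + (- 6 * r n) * Q n x)"
      by (simp add: algebra_simps)
  qed
  moreover have "jets k (null_in q) (\<lambda>n x. (r n - 1) * N n x + ((6 * r n) * A n x + (- 6 * r n) * Q n x))"
    by (rule jets_null_add[OF q0(2)];
        ((rule jets_null_cmult'[OF q0(1) N r1 bN[OF q]] jets_null_add[OF q0(2)]
          jets_null_cmult[OF q0(2) sA(1) Br(1) jA] jets_null_cmult[OF q0(2) sA(2) Br(2) jQ]
         | intro smooth_seq_const smooth_seq_intros N sA)+))
  ultimately show ?thesis by simp
qed

section \<open>Minimizers of small momentum have small energy\<close>

lemma nn_integral_lebesgue_eq_lborel: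
  "(\<integral>\<^sup>+ x. f x \<partial>lebesgue) = (\<integral>\<^sup>+ x. f x \<partial>lborel)"
  by (rule nn_integral_completion)

lemma weak_deriv_smooth_AE:
  assumes "smooth f"
  shows "AE x in lebesgue. weak_deriv (1, 0) f x = partial e1 f x"
    and "AE x in lebesgue. weak_deriv (0, 1) f x = partial e2 f x"
  using weak_deriv_AE_eq[OF is_weak_deriv_smooth[OF assms, of "(1, 0)"]]
    weak_deriv_AE_eq[OF is_weak_deriv_smooth[OF assms, of "(0, 1)"]]
  by (simp_all add: multi_partial_def)

lemma GL_energy_smooth:
  assumes "smooth v"
  shows "GL_energy v = 1 / 2 * (\<integral>\<^sup>+ x. ennreal ((cmod (partial e1 v x))\<^sup>2 + (cmod (partial e2 v x))\<^sup>2) \<partial>lborel)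
     + 1 / 4 * (\<integral>\<^sup>+ x. ennreal ((eta v x)\<^sup>2) \<partial>lborel)"
proof -
  have "(\<integral>\<^sup>+ x. ennreal ((cmod (weak_deriv (1, 0) v x))\<^sup>2 + (cmod (weak_deriv (0, 1) v x))\<^sup>2) \<partial>lebesgue) =
      (\<integral>\<^sup>+ x. ennreal ((cmod (partial e1 v x))\<^sup>2 + (cmod (partial e2 v x))\<^sup>2) \<partial>lebesgue)"
  proof (rule nn_integral_cong_AE)
    show "AE x in lebesgue. ennreal ((cmod (weak_deriv (1, 0) v x))\<^sup>2 + (cmod (weak_deriv (0, 1) v x))\<^sup>2) =
        ennreal ((cmod (partial e1 v x))\<^sup>2 + (cmod (partial e2 v x))\<^sup>2)"
      using weak_deriv_smooth_AE[OF assms] by eventually_elim simp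
  qed
  then show ?thesis by (simp add: GL_energy_def eta_def nn_integral_lebesgue_eq_lborel)
qed

lemma ennreal_half: "(2::ennreal) * (1 / 2) = 1" and ennreal_quarter: "(4::ennreal) * (1 / 4) = 1"
  by (simp_all add: ennreal_times_divide ennreal_divide_self)

lemma gradient_le_energy:
  assumes "smooth v"
  shows "(\<integral>\<^sup>+ x. ennreal ((cmod (partial e1 v x))\<^sup>2 + (cmod (partial e2 v x))\<^sup>2) \<partial>lborel) \<le> 2 * GL_energy v"
    (is "?G \<le> _")
proof -
  have "?G = 2 * (1 / 2 * ?G)"
    unfolding mult.assoc[symmetric] ennreal_half by simp
  also have "\<dots> \<le> 2 * GL_energy v"
    unfolding GL_energy_smooth[OF assms] by (intro mult_left_mono) auto
  finally show ?thesis .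
qed

lemma eta_le_energy:
  assumes "smooth v"
  shows "(\<integral>\<^sup>+ x. ennreal ((eta v x)\<^sup>2) \<partial>lborel) \<le> 4 * GL_energy v"
    (is "?G \<le> _")
proof -
  have "?G = 4 * (1 / 4 * ?G)"
    unfolding mult.assoc[symmetric] ennreal_quarter by simp
  also have "\<dots> \<le> 4 * GL_energy v"
    unfolding GL_energy_smooth[OF assms] by (intro mult_left_mono) auto
  finally show ?thesis .
qed

lemma smooth_Re: "smooth u \<Longrightarrow> smooth (\<lambda>x. Re (u x))"
  by (rule smooth_linear[OF bounded_linear_Re])

lemma smooth_eta:
  assumes "smooth u"
  shows "smooth (eta u)"
proof -
  have "smooth (\<lambda>x. 1 - u x \<bullet> u x)"
    using assms by (intro smooth_diff smooth_inner smooth_const)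
  also have "(\<lambda>x. 1 - u x \<bullet> u x) = eta u"
    by (auto simp: eta_def dot_square_norm)
  finally show ?thesis .
qed

lemma Lq_scaleR:
  fixes f :: "R2 \<Rightarrow> 'b::euclidean_space"
  assumes "f \<in> Lq q" "q \<noteq> \<infinity>"
  shows "(\<lambda>x. s *\<^sub>R f x) \<in> Lq q"
  using assms by (auto simp: Lq_def powr_mult)

lemma deriv_in_Lq_scaleR:
  assumes "deriv_in_Lq \<alpha> q f" "q \<noteq> \<infinity>"
  shows "deriv_in_Lq \<alpha> q (\<lambda>x. s *\<^sub>R f x)"
  using assms is_weak_deriv_scaleR Lq_scaleR unfolding deriv_in_Lq_def by blast

lemma V_space_scaleR:
  assumes "v \<in> V_space"
  shows "(\<lambda>x. s *\<^sub>R v x) \<in> V_space"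
proof -
  have f: "(2::ereal) \<noteq> \<infinity>" "(4::ereal) \<noteq> \<infinity>" "(4 / 3 :: ereal) \<noteq> \<infinity>"
    by (auto simp: divide_ereal_def)
  have "deriv_in_Lq \<alpha> 2 (\<lambda>x. s *\<^sub>R v x) \<and> deriv_in_Lq \<alpha> (4 / 3) (\<lambda>x. Re (s *\<^sub>R v x))"
    if "\<alpha> \<in> {(1, 0), (0, 1)}" for \<alpha>
    using assms that deriv_in_Lq_scaleR[OF _ f(1), of \<alpha> v s]
      deriv_in_Lq_scaleR[OF _ f(3), of \<alpha> "\<lambda>x. Re (v x)" s]
    unfolding V_space_def by auto
  moreover have "(\<lambda>x. Re (s *\<^sub>R v x)) \<in> Lq 2" "(\<lambda>x. Im (s *\<^sub>R v x)) \<in> Lq 4"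
    using assms Lq_scaleR[OF _ f(1), of "\<lambda>x. Re (v x)" s] Lq_scaleR[OF _ f(2), of "\<lambda>x. Im (v x)" s]
    unfolding V_space_def by auto
  ultimately show ?thesis unfolding V_space_def by blast
qed

text \<open>The momentum is a quadratic form in \<open>v - 1\<close>, and the almost everywhere unique weak derivative may
  be replaced by the classical one.\<close>

lemma momentum_dilation:
  assumes u: "smooth u"
  shows "momentum (\<lambda>x. 1 + s *\<^sub>R (u x - 1)) = s\<^sup>2 * momentum u"
proof -
  let ?v = "\<lambda>x. 1 + s *\<^sub>R (u x - 1)"
  have su: "smooth (\<lambda>x. u x - 1)" using u by (intro smooth_diff smooth_const)
  have ss: "smooth (\<lambda>x. s *\<^sub>R (u x - 1))" using su by (intro smooth_scaleR smooth_const)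
  have v: "smooth ?v" using ss by (intro smooth_add smooth_const)
  have p: "partial e1 ?v x = s *\<^sub>R partial e1 u x" for x
    using u su ss
    by (simp add: partial_add partial_diff partial_const partial_scaleR_const smooth_differentiable)
  have m: "weak_deriv (1, 0) f \<in> borel_measurable lebesgue" if "smooth f" for f :: "R2 \<Rightarrow> complex"
    using is_weak_deriv_measurable[OF is_weak_deriv_weak_deriv[OF is_weak_deriv_smooth[OF that]]] .
  have ml: "f \<in> borel_measurable lebesgue" if "smooth f" for f :: "R2 \<Rightarrow> complex"
    using lebesgue_measurable_continuous[OF smooth_continuous[OF that]] .
  have "(LINT x|lebesgue. (\<i> * weak_deriv (1, 0) ?v x) \<bullet> (?v x - 1)) =
      (LINT x|lebesgue. s\<^sup>2 * ((\<i> * weak_deriv (1, 0) u x) \<bullet> (u x - 1)))"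
  proof (rule integral_cong_AE)
    show "(\<lambda>x. (\<i> * weak_deriv (1, 0) ?v x) \<bullet> (?v x - 1)) \<in> borel_measurable lebesgue"
      by (intro borel_measurable_inner borel_measurable_times borel_measurable_const m[OF v]
          borel_measurable_diff ml[OF v])
    show "(\<lambda>x. s\<^sup>2 * ((\<i> * weak_deriv (1, 0) u x) \<bullet> (u x - 1))) \<in> borel_measurable lebesgue"
      by (intro borel_measurable_inner borel_measurable_times borel_measurable_const m[OF u]
          borel_measurable_diff ml[OF u])
    show "AE x in lebesgue. (\<i> * weak_deriv (1, 0) ?v x) \<bullet> (?v x - 1) =
       s\<^sup>2 * ((\<i> * weak_deriv (1, 0) u x) \<bullet> (u x - 1))"
      using weak_deriv_smooth_AE(1)[OF u] weak_deriv_smooth_AE(1)[OF v]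
    proof eventually_elim
      case (elim x)
      have "(\<i> * (s *\<^sub>R z)) \<bullet> (s *\<^sub>R w) = s\<^sup>2 * ((\<i> * z) \<bullet> w)" for z w
        by (simp add: power2_eq_square)
      then show ?case unfolding elim p by simp
    qed
  qed
  then show ?thesis by (simp add: momentum_def)
qed

text \<open>With \<open>v = 1 + s (u - 1)\<close> one has
  \<open>1 - \<bar>v\<bar>\<^sup>2 = s\<^sup>2 (1 - \<bar>u\<bar>\<^sup>2) - 2 s (1 - s) Re (u - 1)\<close>: expressing \<open>\<bar>u - 1\<bar>\<^sup>2\<close> by
  \<open>1 - \<bar>u\<bar>\<^sup>2\<close> and \<open>Re (u - 1)\<close> leaves two square integrable functions.\<close>

lemma GL_energy_dilation:
  assumes u: "smooth u" and s: "0 \<le> s" "s \<le> 1"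
  shows "GL_energy (\<lambda>x. 1 + s *\<^sub>R (u x - 1)) \<le>
    ennreal (s\<^sup>2) * (2 * GL_energy u + 2 * (\<integral>\<^sup>+ x. ennreal ((Re (u x - 1))\<^sup>2) \<partial>lborel))"
proof -
  let ?v = "\<lambda>x. 1 + s *\<^sub>R (u x - 1)"
  let ?a = "\<lambda>x. Re (u x - 1)"
  have su: "smooth (\<lambda>x. u x - 1)" using u by (intro smooth_diff smooth_const)
  have ss: "smooth (\<lambda>x. s *\<^sub>R (u x - 1))" using su by (intro smooth_scaleR smooth_const)
  have v: "smooth ?v" using ss by (intro smooth_add smooth_const)
  have p: "partial e ?v x = s *\<^sub>R partial e u x" for e x
    using u su ss
    by (simp add: partial_add partial_diff partial_const partial_scaleR_const smooth_differentiable)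
  let ?G = "\<integral>\<^sup>+ x. ennreal ((cmod (partial e1 u x))\<^sup>2 + (cmod (partial e2 u x))\<^sup>2) \<partial>lborel"
  let ?E = "\<integral>\<^sup>+ x. ennreal ((eta u x)\<^sup>2) \<partial>lborel"
  let ?A = "\<integral>\<^sup>+ x. ennreal ((?a x)\<^sup>2) \<partial>lborel"
  note meas = smooth_borel[OF smooth_eta[OF u]] smooth_borel[OF smooth_Re[OF su]]
    smooth_borel[OF smooth_partial1[OF u]] smooth_borel[OF smooth_partial2[OF u]]
  have "(\<integral>\<^sup>+ x. ennreal ((cmod (partial e1 ?v x))\<^sup>2 + (cmod (partial e2 ?v x))\<^sup>2) \<partial>lborel) =
      (\<integral>\<^sup>+ x. ennreal (s\<^sup>2) * ennreal ((cmod (partial e1 u x))\<^sup>2 + (cmod (partial e2 u x))\<^sup>2) \<partial>lborel)"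
    by (intro nn_integral_cong) (simp add: p power_mult_distrib distrib_left flip: ennreal_mult)
  also have "\<dots> = ennreal (s\<^sup>2) * ?G"
    using meas by (intro nn_integral_cmult) simp
  finally have G: "(\<integral>\<^sup>+ x. ennreal ((cmod (partial e1 ?v x))\<^sup>2 + (cmod (partial e2 ?v x))\<^sup>2) \<partial>lborel) =
    ennreal (s\<^sup>2) * ?G" .
  have "(\<integral>\<^sup>+ x. ennreal ((eta ?v x)\<^sup>2) \<partial>lborel) \<le>
      (\<integral>\<^sup>+ x. ennreal (s\<^sup>2) * (2 * ennreal ((eta u x)\<^sup>2) + 8 * ennreal ((?a x)\<^sup>2)) \<partial>lborel)"
  proof (rule nn_integral_mono)
    fix x
    have e: "eta ?v x = s * (s * eta u x - 2 * (1 - s) * ?a x)"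
      unfolding eta_def cmod_power2 by (simp add: power2_eq_square algebra_simps)
    have "(s * eta u x - 2 * (1 - s) * ?a x)\<^sup>2 \<le> 2 * (s * eta u x)\<^sup>2 + 2 * (2 * (1 - s) * ?a x)\<^sup>2"
      using zero_le_power2[of "s * eta u x + 2 * (1 - s) * ?a x"]
      by (simp add: power2_sum power2_diff)
    also have "(s * eta u x)\<^sup>2 \<le> (eta u x)\<^sup>2"
      using s by (simp add: power_mult_distrib mult_left_le_one_le power_le_one)
    also have "(2 * (1 - s) * ?a x)\<^sup>2 = 4 * ((1 - s)\<^sup>2 * (?a x)\<^sup>2)"
      by (simp only: power_mult_distrib) simp
    also have "(1 - s)\<^sup>2 * (?a x)\<^sup>2 \<le> (?a x)\<^sup>2"
      using s by (intro mult_left_le_one_le) (auto simp: power_le_one)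
    finally have "(eta ?v x)\<^sup>2 \<le> s\<^sup>2 * (2 * (eta u x)\<^sup>2 + 8 * (?a x)\<^sup>2)"
      unfolding e power_mult_distrib by (intro mult_left_mono) auto
    then show "ennreal ((eta ?v x)\<^sup>2) \<le> ennreal (s\<^sup>2) * (2 * ennreal ((eta u x)\<^sup>2) + 8 * ennreal ((?a x)\<^sup>2))"
      using ennreal_leI by (fastforce simp: ennreal_plus ennreal_mult)
  qed
  also have "\<dots> = ennreal (s\<^sup>2) * (2 * ?E + 8 * ?A)"
    using meas by (simp add: nn_integral_cmult nn_integral_add)
  finally have E: "(\<integral>\<^sup>+ x. ennreal ((eta ?v x)\<^sup>2) \<partial>lborel) \<le> ennreal (s\<^sup>2) * (2 * ?E + 8 * ?A)" .
  have "GL_energy ?v \<le> 1 / 2 * (ennreal (s\<^sup>2) * ?G) + 1 / 4 * (ennreal (s\<^sup>2) * (2 * ?E + 8 * ?A))"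
    unfolding GL_energy_smooth[OF v] G by (intro add_mono mult_left_mono E) auto
  also have "\<dots> = ennreal (s\<^sup>2) * (1 / 2 * ?G + 1 / 4 * (2 * ?E + 8 * ?A))"
    by (simp add: distrib_left mult.left_commute)
  also have "\<dots> \<le> ennreal (s\<^sup>2) * (2 * GL_energy u + 2 * ?A)"
  proof (rule mult_left_mono)
    have "1 / 4 * (2 * ?E + 8 * ?A) = 2 * (1 / 4 * ?E) + (1 / 4 * 8) * ?A"
      by (simp add: distrib_left mult.left_commute mult.assoc)
    moreover have "1 / 4 * 8 = (2 :: ennreal)"
    proof -
      have "1 / 4 * 8 = 4 * (1 / 4) * (2 :: ennreal)" by (simp add: mult.commute mult.left_commute)
      then show ?thesis by (simp only: ennreal_quarter mult_1)
    qed
    moreover have "1 / 2 * ?G \<le> 2 * (1 / 2 * ?G)"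
      using mult_right_mono[of 1 2 "1 / 2 * ?G"] by simp
    ultimately show "1 / 2 * ?G + 1 / 4 * (2 * ?E + 8 * ?A) \<le> 2 * GL_energy u + 2 * ?A"
      unfolding GL_energy_smooth[OF u] by (simp add: distrib_left add.assoc add_mono)
  qed simp
  finally show ?thesis .
qed

text \<open>Dilations of the minimizer of momentum \<open>1\<close>, with \<open>s = sqrt \<pp>\<close>, are competitors of momentum \<open>\<pp>\<close>.\<close>

lemma E_min_le_linear:
  assumes u: "GP_minimizer 1 c u"
  shows "\<exists>K::real. \<forall>\<pp>. 0 < \<pp> \<longrightarrow> \<pp> \<le> 1 \<longrightarrow> E_min \<pp> \<le> ennreal (K * \<pp>)"
proof -
  have s: "smooth u" and fin: "GL_energy u < \<infinity>" and W: "u \<in> W_space" and mom: "momentum u = 1"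
    using u by (auto simp: GP_minimizer_def TW_solution_def)
  let ?A = "\<integral>\<^sup>+ x. ennreal ((Re (u x - 1))\<^sup>2) \<partial>lborel"
  have "(\<lambda>x. Re (u x - 1)) \<in> Lq 2" using W by (simp add: W_space_def V_space_def)
  moreover have "(0::ereal) < 2" by simp
  ultimately obtain C where "Lq_le 2 C (\<lambda>x. Re (u x - 1))"
    using Lq_imp_Lq_le_ex by blast
  then have "?A < top" unfolding Lq_le_2 by (rule le_less_trans) simp
  with fin have "2 * GL_energy u + 2 * ?A < top" by (simp add: ennreal_mult_less_top)
  then obtain K where K: "2 * GL_energy u + 2 * ?A = ennreal K" "K \<ge> 0"
    by (cases "2 * GL_energy u + 2 * ?A") auto
  have "E_min \<pp> \<le> ennreal (K * \<pp>)" if p: "0 < \<pp>" "\<pp> \<le> 1" for \<pp>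
  proof -
    define t where "t = sqrt \<pp>"
    have t: "0 \<le> t" "t \<le> 1" "t\<^sup>2 = \<pp>" using p by (auto simp: t_def)
    let ?v = "\<lambda>x. 1 + t *\<^sub>R (u x - 1)"
    have "?v \<in> W_space"
      using W V_space_scaleR[of "\<lambda>x. u x - 1" t] by (simp add: W_space_def)
    moreover have "momentum ?v = \<pp>" using momentum_dilation[OF s, of t] mom t by simp
    ultimately have "E_min \<pp> \<le> GL_energy ?v" unfolding E_min_def by (intro Inf_lower) blast
    also have "\<dots> \<le> ennreal (t\<^sup>2) * ennreal K"
      using GL_energy_dilation[OF s t(1,2)] unfolding K(1) .
    also have "\<dots> = ennreal (K * \<pp>)" using K p t by (simp add: mult.commute flip: ennreal_mult)
    finally show ?thesis .
  qed
  then show ?thesis by blast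
qed

section \<open>The change of scale\<close>

lemma nn_integral_scale:
  fixes f :: "R2 \<Rightarrow> ennreal"
  assumes f: "f \<in> borel_measurable borel" and ab: "a > 0" "b > 0"
  shows "(\<integral>\<^sup>+ x. f x \<partial>lborel) = ennreal (a * b) * (\<integral>\<^sup>+ x. f (a * fst x, b * snd x) \<partial>lborel)"
proof -
  have f': "f \<in> borel_measurable (lborel \<Otimes>\<^sub>M lborel)" using f by (simp add: lborel_prod)
  have sc: "(\<lambda>x::R2. (a * fst x, b * snd x)) \<in> borel_measurable borel" for a b :: real
    by (intro borel_measurable_continuous_onI continuous_intros)
  have fs: "(\<lambda>x. f (a * fst x, b * snd x)) \<in> borel_measurable (lborel \<Otimes>\<^sub>M lborel)"
    unfolding lborel_prod using measurable_compose[OF sc f, of a b] by simp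
  have ft: "(\<lambda>x. f (fst x, b * snd x)) \<in> borel_measurable (lborel \<Otimes>\<^sub>M lborel)"
    unfolding lborel_prod using measurable_compose[OF sc f, of 1 b] by simp
  have m: "(\<lambda>s. \<integral>\<^sup>+ t. f (s, b * t) \<partial>lborel) \<in> borel_measurable borel"
    using lborel.borel_measurable_nn_integral_fst[OF ft] by simp
  have m1: "(\<lambda>t. f (s, t)) \<in> borel_measurable borel" for s
    by (intro measurable_compose[OF _ f]) simp
  have "(\<integral>\<^sup>+ x. f x \<partial>lborel) = (\<integral>\<^sup>+ s. (\<integral>\<^sup>+ t. f (s, t) \<partial>lborel) \<partial>lborel)"
    using lborel.nn_integral_fst[OF f'] by (simp add: lborel_prod)
  also have "\<dots> = (\<integral>\<^sup>+ s. ennreal b * (\<integral>\<^sup>+ t. f (s, b * t) \<partial>lborel) \<partial>lborel)"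
    using ab nn_integral_real_affine[OF m1, where c = b and t = 0] by (intro nn_integral_cong) simp
  also have "\<dots> = ennreal b * (\<integral>\<^sup>+ s. (\<integral>\<^sup>+ t. f (s, b * t) \<partial>lborel) \<partial>lborel)"
    using m by (intro nn_integral_cmult) simp
  also have "\<dots> = ennreal b * (ennreal a * (\<integral>\<^sup>+ s. (\<integral>\<^sup>+ t. f (a * s, b * t) \<partial>lborel) \<partial>lborel))"
    using ab nn_integral_real_affine[OF m, where c = a and t = 0] by simp
  also have "(\<integral>\<^sup>+ s. (\<integral>\<^sup>+ t. f (a * s, b * t) \<partial>lborel) \<partial>lborel) = (\<integral>\<^sup>+ x. f (a * fst x, b * snd x) \<partial>lborel)"
    using lborel.nn_integral_fst[OF fs] by (simp add: lborel_prod)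
  finally show ?thesis using ab by (simp add: ennreal_mult ac_simps)
qed

lemma rescale_eq: "rescale \<epsilon> x = (1 / \<epsilon> * fst x, sqrt 2 / \<epsilon>\<^sup>2 * snd x)"
  by (simp add: rescale_def)

lemma nn_integral_rescale:
  fixes f :: "R2 \<Rightarrow> real"
  assumes f: "f \<in> borel_measurable borel" and \<epsilon>: "\<epsilon> > 0"
  shows "(\<integral>\<^sup>+ x. ennreal (f (rescale \<epsilon> x)) \<partial>lborel) = ennreal (\<epsilon> ^ 3 / sqrt 2) * (\<integral>\<^sup>+ x. ennreal (f x) \<partial>lborel)"
proof -
  have "(\<integral>\<^sup>+ x. ennreal (f x) \<partial>lborel) =
      ennreal (1 / \<epsilon> * (sqrt 2 / \<epsilon>\<^sup>2)) * (\<integral>\<^sup>+ x. ennreal (f (rescale \<epsilon> x)) \<partial>lborel)"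
    unfolding rescale_eq using f \<epsilon> by (intro nn_integral_scale) auto
  note scale = this
  have nonneg: "0 \<le> \<epsilon> ^ 3 / sqrt 2" using \<epsilon> by simp
  have "ennreal (\<epsilon> ^ 3 / sqrt 2) * (\<integral>\<^sup>+ x. ennreal (f x) \<partial>lborel) =
      ennreal (\<epsilon> ^ 3 / sqrt 2 * (1 / \<epsilon> * (sqrt 2 / \<epsilon>\<^sup>2))) * (\<integral>\<^sup>+ x. ennreal (f (rescale \<epsilon> x)) \<partial>lborel)"
    by (simp only: scale ennreal_mult'[OF nonneg] mult.assoc)
  also have "\<epsilon> ^ 3 / sqrt 2 * (1 / \<epsilon> * (sqrt 2 / \<epsilon>\<^sup>2)) = 1"
    using \<epsilon> by (simp add: power2_eq_square power3_eq_cube)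
  finally show ?thesis by simp
qed

lemma smooth_rescale: "smooth f \<Longrightarrow> smooth (\<lambda>x. f (rescale \<epsilon> x))"
  unfolding rescale_eq by (rule smooth_scale)

lemma partial_rescale:
  assumes "smooth f"
  shows "partial e1 (\<lambda>x. f (rescale \<epsilon> x)) x = (1 / \<epsilon>) *\<^sub>R partial e1 f (rescale \<epsilon> x)"
    and "partial e2 (\<lambda>x. f (rescale \<epsilon> x)) x = (sqrt 2 / \<epsilon>\<^sup>2) *\<^sub>R partial e2 f (rescale \<epsilon> x)"
  unfolding rescale_eq
  by (rule partial_scale(1)[OF smooth_differentiable[OF assms]],
      rule partial_scale(2)[OF smooth_differentiable[OF assms]])

section \<open>Travelling waves in the transonic scaling\<close>

lemma N_resc_eta: "eps c > 0 \<Longrightarrow> (eps c)\<^sup>2 * N_resc c u x / 6 = eta u (rescale (eps c) x)"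
  by (simp add: N_resc_def)

lemma smooth_N_resc: "smooth u \<Longrightarrow> smooth (N_resc c u)"
  unfolding N_resc_def[abs_def] by (intro smooth_cmult smooth_rescale smooth_eta)

lemma nn_integral_N_resc:
  assumes u: "smooth u" and \<epsilon>: "eps c > 0"
  shows "ennreal (eps c) * (\<integral>\<^sup>+ x. ennreal ((N_resc c u x)\<^sup>2) \<partial>lborel) =
     ennreal (36 / sqrt 2) * (\<integral>\<^sup>+ x. ennreal ((eta u x)\<^sup>2) \<partial>lborel)"
proof -
  define \<epsilon> where "\<epsilon> = eps c"
  have e: "\<epsilon> > 0" using \<epsilon> by (simp add: \<epsilon>_def)
  note m = smooth_borel[OF smooth_eta[OF u]]
  have "(\<integral>\<^sup>+ x. ennreal ((N_resc c u x)\<^sup>2) \<partial>lborel) =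
      (\<integral>\<^sup>+ x. ennreal (36 / \<epsilon> ^ 4 * (eta u (rescale \<epsilon> x))\<^sup>2) \<partial>lborel)"
    by (intro nn_integral_cong)
      (simp add: N_resc_def \<epsilon>_def power_mult_distrib power_divide flip: power_mult)
  also have "\<dots> = ennreal (\<epsilon> ^ 3 / sqrt 2) * (\<integral>\<^sup>+ x. ennreal (36 / \<epsilon> ^ 4 * (eta u x)\<^sup>2) \<partial>lborel)"
    using m by (intro nn_integral_rescale[OF _ e]) simp
  also have "(\<integral>\<^sup>+ x. ennreal (36 / \<epsilon> ^ 4 * (eta u x)\<^sup>2) \<partial>lborel) =
      ennreal (36 / \<epsilon> ^ 4) * (\<integral>\<^sup>+ x. ennreal ((eta u x)\<^sup>2) \<partial>lborel)"
  proof -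
    have "0 \<le> 36 / \<epsilon> ^ 4" using e by simp
    from ennreal_mult'[OF this] show ?thesis
      using m by (subst nn_integral_cmult[symmetric]) simp_all
  qed
  finally have I: "(\<integral>\<^sup>+ x. ennreal ((N_resc c u x)\<^sup>2) \<partial>lborel) = ennreal (\<epsilon> ^ 3 / sqrt 2) *
      (ennreal (36 / \<epsilon> ^ 4) * (\<integral>\<^sup>+ x. ennreal ((eta u x)\<^sup>2) \<partial>lborel))" .
  have nonneg: "0 \<le> \<epsilon>" "0 \<le> \<epsilon> ^ 3 / sqrt 2" using e by simp_all
  have "ennreal \<epsilon> * (\<integral>\<^sup>+ x. ennreal ((N_resc c u x)\<^sup>2) \<partial>lborel) =
      ennreal (\<epsilon> * (\<epsilon> ^ 3 / sqrt 2) * (36 / \<epsilon> ^ 4)) * (\<integral>\<^sup>+ x. ennreal ((eta u x)\<^sup>2) \<partial>lborel)"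
    by (simp only: I mult.assoc ennreal_mult'[OF nonneg(1)] ennreal_mult'[OF nonneg(2)])
  also have "\<epsilon> * (\<epsilon> ^ 3 / sqrt 2) * (36 / \<epsilon> ^ 4) = 36 / sqrt 2"
    using e by (simp add: power3_eq_cube power4_eq_xxxx)
  finally show ?thesis by (simp add: \<epsilon>_def)
qed

text \<open>Otherwise \<open>F n\<close> and \<open>F n - f\<close> would both be small in \<open>L\<^sup>2\<close> for some \<open>n\<close>, hence also \<open>f\<close>.\<close>

lemma L2_lower_bound:
  assumes F: "smooth_seq F" and conv: "Wkq_tendsto 0 2 F f" and nz: "\<not> (AE x in lebesgue. f x = 0)"
  shows "\<exists>d>0. \<forall>\<^sub>F n in sequentially. ennreal d \<le> (\<integral>\<^sup>+ x. ennreal ((F n x)\<^sup>2) \<partial>lborel)"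
proof -
  have q: "(2::ereal) > 0" "(2::ereal) \<ge> 0" by simp_all
  have f: "f \<in> Wkq 0 2" using conv by (simp add: Wkq_tendsto_def)
  then have "deriv_in_Lq (0, 0) 2 f" unfolding Wkq_def by simp
  then obtain g where "is_weak_deriv (0, 0) f g" by (auto simp: deriv_in_Lq_def)
  then have loc: "locally_integrable f" by (simp add: is_weak_deriv_def)
  then have wf: "is_weak_deriv (0, 0) f f" by (simp add: is_weak_deriv_def multi_partial_def)
  have mf: "f \<in> borel_measurable lebesgue" by (rule locally_integrable_measurable[OF loc])
  have sq: "(\<integral>\<^sup>+ x. ennreal (\<bar>h x\<bar> powr real_of_ereal 2) \<partial>lebesgue) = (\<integral>\<^sup>+ x. ennreal ((h x)\<^sup>2) \<partial>lebesgue)"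
    for h :: "R2 \<Rightarrow> real"
    by (simp add: abs_powr_2)
  have "(\<integral>\<^sup>+ x. ennreal ((f x)\<^sup>2) \<partial>lebesgue) \<noteq> 0"
    using nz mf by (subst nn_integral_0_iff_AE) (auto simp: ennreal_eq_0_iff)
  then have "0 < (\<integral>\<^sup>+ x. ennreal ((f x)\<^sup>2) \<partial>lebesgue)" by (simp add: zero_less_iff_neq_zero)
  from dense[OF this] obtain J where J: "0 < J" "J < (\<integral>\<^sup>+ x. ennreal ((f x)\<^sup>2) \<partial>lebesgue)" by blast
  then obtain I where "J = ennreal I" by (cases J) auto
  with J have I: "0 < ennreal I" "ennreal I < (\<integral>\<^sup>+ x. ennreal ((f x)\<^sup>2) \<partial>lebesgue)" by simp_all
  then have I0: "I > 0" by simp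
  (* Adding two functions costs the factor 2 * 2 powr 2 = 8 in Lq_le, and 8 d < I. *)
  define d where "d = I / 16"
  have d: "d > 0" using I0 by (simp add: d_def)
  have "\<forall>\<^sub>F n in sequentially. Lq_le 2 d (\<lambda>x. multi_partial (0, 0) (F n) x - f x)"
    using conv wf d unfolding Wkq_tendsto_smooth_iff[OF F q(1)] by (simp del: ereal_less)
  then have "\<forall>\<^sub>F n in sequentially. ennreal d \<le> (\<integral>\<^sup>+ x. ennreal ((F n x)\<^sup>2) \<partial>lborel)"
  proof eventually_elim
    case (elim n)
    show ?case
    proof (rule ccontr)
      assume "\<not> ennreal d \<le> (\<integral>\<^sup>+ x. ennreal ((F n x)\<^sup>2) \<partial>lborel)"
      then have 1: "Lq_le 2 d (F n)" unfolding Lq_le_2 by simp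
      have mF: "F n \<in> borel_measurable lebesgue"
        by (intro lebesgue_measurable_continuous smooth_continuous smooth_seqD[OF F])
      have 2: "Lq_le 2 d (\<lambda>x. f x - F n x)"
        using elim unfolding Lq_le_def multi_partial_def by (simp add: abs_minus_commute)
      have "Lq_le 2 (2 * (if (2::ereal) = \<infinity> then 1 else 2 powr real_of_ereal 2) * d) (\<lambda>x. (f x - F n x) + F n x)"
        using 1 2 q d mF mf by (intro Lq_le_add) auto
      then have "(\<integral>\<^sup>+ x. ennreal ((f x)\<^sup>2) \<partial>lebesgue) \<le> ennreal (8 * d)"
        unfolding Lq_le_def sq by simp
      also have "\<dots> \<le> ennreal I" using I0 by (intro ennreal_leI) (simp add: d_def)
      finally show False using I(2) by simp
    qed
  qed
  with d show ?thesis by blast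
qed

lemma Wkq_tendsto_shift: "Wkq_tendsto k q F f \<Longrightarrow> Wkq_tendsto k q (\<lambda>n. F (n + m)) f"
  unfolding Wkq_tendsto_def
  by (auto simp: eventually_sequentially_seg[where P = "\<lambda>n. F n \<in> Wkq k q"]
      intro: LIMSEQ_ignore_initial_segment[where f = "\<lambda>n. Wkq_norm k q (\<lambda>x. F n x - f x)"])

text \<open>The phase gradient is the imaginary part of \<open>\<partial>u / u\<close>.\<close>

lemma abs_partial_phase_le:
  assumes u: "smooth u" and ph: "phase_of \<phi> u" and lb: "\<And>x. 1 / 2 \<le> cmod (u x)"
  shows "\<bar>partial e \<phi> x\<bar> \<le> 2 * cmod (partial e u x)"
proof -
  have s: "smooth \<phi>" "smooth (\<lambda>x. u x \<bullet> u x)" using ph u by (auto simp: phase_of_def)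
  have "u x \<noteq> 0" for x using lb[of x] by auto
  then have "partial e u x = u x * (of_real (partial e (\<lambda>x. u x \<bullet> u x) x * inverse (u x \<bullet> u x) / 2)
      + \<i> * of_real (partial e \<phi> x))"
    using u s ph by (intro partial_polar) (auto simp: phase_of_def dot_square_norm)
  then have "cmod (partial e u x) = cmod (u x) * cmod (of_real (partial e (\<lambda>x. u x \<bullet> u x) x * inverse (u x \<bullet> u x) / 2)
      + \<i> * of_real (partial e \<phi> x))" (is "_ = _ * cmod ?k")
    by (metis norm_mult)
  moreover have "\<bar>partial e \<phi> x\<bar> \<le> cmod ?k" using abs_Im_le_cmod[of ?k] by simp
  then have "1 / 2 * \<bar>partial e \<phi> x\<bar> \<le> cmod (u x) * cmod ?k"
    using lb[of x] by (intro mult_mono) auto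
  ultimately show ?thesis by linarith
qed

text \<open>The factor \<open>\<epsilon>\<close> on the right is what is left of the Jacobian \<open>\<epsilon>\<^sup>3 / sqrt 2\<close> after
  the two scaling factors \<open>1 / \<epsilon>\<close> of the derivatives have been used up.\<close>

lemma nn_integral_phase_gradient:
  assumes u: "smooth u" and ph: "phase_of \<phi> u" and lb: "\<And>x. 1 / 2 \<le> cmod (u x)" and \<epsilon>: "\<epsilon> > 0"
  defines "\<Phi> \<equiv> \<lambda>x. \<phi> (rescale \<epsilon> x)"
  shows "(\<integral>\<^sup>+ x. ennreal ((partial e1 \<Phi> x)\<^sup>2) \<partial>lborel) \<le> ennreal (8 * \<epsilon>) * GL_energy u"
    and "(\<integral>\<^sup>+ x. ennreal ((\<epsilon> / sqrt 2 * partial e2 \<Phi> x)\<^sup>2) \<partial>lborel) \<le> ennreal (8 * \<epsilon>) * GL_energy u"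
proof -
  have s\<phi>: "smooth \<phi>" using ph by (simp add: phase_of_def)
  have main: "(\<integral>\<^sup>+ x. ennreal ((1 / \<epsilon> * partial e \<phi> (rescale \<epsilon> x))\<^sup>2) \<partial>lborel) \<le> ennreal (8 * \<epsilon>) * GL_energy u"
    if e: "e = e1 \<or> e = e2" for e
  proof -
    have m: "(\<lambda>x. ennreal ((partial e \<phi> x)\<^sup>2)) \<in> borel_measurable lborel"
      "(\<lambda>x. (1 / \<epsilon> * partial e \<phi> x)\<^sup>2) \<in> borel_measurable borel"
      using smooth_borel[OF smooth_partial[OF s\<phi> e]] by auto
    have "(\<integral>\<^sup>+ x. ennreal ((1 / \<epsilon> * partial e \<phi> (rescale \<epsilon> x))\<^sup>2) \<partial>lborel) =
        ennreal (\<epsilon> ^ 3 / sqrt 2) * (\<integral>\<^sup>+ x. ennreal ((1 / \<epsilon> * partial e \<phi> x)\<^sup>2) \<partial>lborel)"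
      by (rule nn_integral_rescale[OF m(2) \<epsilon>])
    also have "(\<integral>\<^sup>+ x. ennreal ((1 / \<epsilon> * partial e \<phi> x)\<^sup>2) \<partial>lborel) \<le>
       (\<integral>\<^sup>+ x. ennreal (4 / \<epsilon>\<^sup>2) * ennreal ((cmod (partial e1 u x))\<^sup>2 + (cmod (partial e2 u x))\<^sup>2) \<partial>lborel)"
    proof (rule nn_integral_mono)
      fix x
      have "(partial e \<phi> x)\<^sup>2 \<le> (2 * cmod (partial e u x))\<^sup>2"
        using abs_partial_phase_le[OF u ph lb, of e x] by (subst abs_le_square_iff[symmetric]) simp
      also have "\<dots> \<le> 4 * ((cmod (partial e1 u x))\<^sup>2 + (cmod (partial e2 u x))\<^sup>2)"
        using e by (auto simp: power_mult_distrib)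
      finally have "(1 / \<epsilon> * partial e \<phi> x)\<^sup>2 \<le>
          4 / \<epsilon>\<^sup>2 * ((cmod (partial e1 u x))\<^sup>2 + (cmod (partial e2 u x))\<^sup>2)"
        using \<epsilon> by (simp add: power_mult_distrib power_divide divide_right_mono)
      moreover have "0 \<le> 4 / \<epsilon>\<^sup>2" by simp
      ultimately show "ennreal ((1 / \<epsilon> * partial e \<phi> x)\<^sup>2) \<le>
          ennreal (4 / \<epsilon>\<^sup>2) * ennreal ((cmod (partial e1 u x))\<^sup>2 + (cmod (partial e2 u x))\<^sup>2)"
        by (simp only: ennreal_leI flip: ennreal_mult')
    qed
    also have "\<dots> = ennreal (4 / \<epsilon>\<^sup>2) *
        (\<integral>\<^sup>+ x. ennreal ((cmod (partial e1 u x))\<^sup>2 + (cmod (partial e2 u x))\<^sup>2) \<partial>lborel)"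
      using smooth_borel[OF smooth_partial1[OF u]] smooth_borel[OF smooth_partial2[OF u]]
      by (intro nn_integral_cmult) simp
    also have "\<dots> \<le> ennreal (4 / \<epsilon>\<^sup>2) * (2 * GL_energy u)"
      by (intro mult_left_mono gradient_le_energy u) simp
    finally have "(\<integral>\<^sup>+ x. ennreal ((1 / \<epsilon> * partial e \<phi> (rescale \<epsilon> x))\<^sup>2) \<partial>lborel)
        \<le> ennreal (\<epsilon> ^ 3 / sqrt 2) * (ennreal (4 / \<epsilon>\<^sup>2) * (ennreal 2 * GL_energy u))"
      by (simp add: mult_left_mono)
    also have "\<dots> = ennreal (\<epsilon> ^ 3 / sqrt 2 * (4 / \<epsilon>\<^sup>2) * 2) * GL_energy u"
      using \<epsilon> by (simp add: ennreal_mult' mult.assoc del: ennreal_numeral times_divide_eq_right times_divide_eq_left)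
    also have "\<dots> \<le> ennreal (8 * \<epsilon>) * GL_energy u"
    proof (intro mult_right_mono ennreal_leI)
      have "\<epsilon> ^ 3 / sqrt 2 * (4 / \<epsilon>\<^sup>2) * 2 = 8 * \<epsilon> / sqrt 2"
        using \<epsilon> by (simp add: power2_eq_square power3_eq_cube)
      also have "\<dots> \<le> 8 * \<epsilon>" using \<epsilon> by (simp add: divide_le_eq)
      finally show "\<epsilon> ^ 3 / sqrt 2 * (4 / \<epsilon>\<^sup>2) * 2 \<le> 8 * \<epsilon>" .
    qed simp
    finally show ?thesis .
  qed
  have p: "partial e1 \<Phi> x = 1 / \<epsilon> * partial e1 \<phi> (rescale \<epsilon> x)"
    "\<epsilon> / sqrt 2 * partial e2 \<Phi> x = 1 / \<epsilon> * partial e2 \<phi> (rescale \<epsilon> x)" for x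
    unfolding \<Phi>_def partial_rescale[OF s\<phi>] using \<epsilon> by (simp_all add: power2_eq_square)
  show "(\<integral>\<^sup>+ x. ennreal ((partial e1 \<Phi> x)\<^sup>2) \<partial>lborel) \<le> ennreal (8 * \<epsilon>) * GL_energy u"
    and "(\<integral>\<^sup>+ x. ennreal ((\<epsilon> / sqrt 2 * partial e2 \<Phi> x)\<^sup>2) \<partial>lborel) \<le> ennreal (8 * \<epsilon>) * GL_energy u"
    unfolding p by (rule main; simp)+
qed

lemma TW_rescaled:
  assumes TW: "TW_solution c u" and \<epsilon>: "eps c > 0"
  defines "U \<equiv> \<lambda>x. u (rescale (eps c) x)"
  shows "\<i> * of_real (c * eps c) * partial e1 U x + of_real ((eps c)\<^sup>2) * partial e1 (partial e1 U) x
        + of_real (eps c ^ 4 / 2) * partial e2 (partial e2 U) x + U x * of_real ((eps c)\<^sup>2 * N_resc c u x / 6) = 0"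
proof -
  define \<epsilon> where "\<epsilon> = eps c"
  have e: "\<epsilon> > 0" using \<epsilon> by (simp add: \<epsilon>_def)
  have u: "smooth u" using TW by (simp add: TW_solution_def)
  let ?R = "rescale \<epsilon>"
  have p1: "partial e1 U = (\<lambda>x. (1 / \<epsilon>) *\<^sub>R partial e1 u (?R x))"
    and p2: "partial e2 U = (\<lambda>x. (sqrt 2 / \<epsilon>\<^sup>2) *\<^sub>R partial e2 u (?R x))"
    unfolding U_def \<epsilon>_def[symmetric] by (intro ext partial_rescale u)+
  have p11: "partial e1 (partial e1 U) x = (1 / \<epsilon>) *\<^sub>R (1 / \<epsilon>) *\<^sub>R partial e1 (partial e1 u) (?R x)"
    unfolding p1
    by (subst partial_scaleR_const[OF smooth_rescale[OF smooth_partial1[OF u]]])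
      (simp only: partial_rescale(1)[OF smooth_partial1[OF u]])
  have p22: "partial e2 (partial e2 U) x = (sqrt 2 / \<epsilon>\<^sup>2) *\<^sub>R (sqrt 2 / \<epsilon>\<^sup>2) *\<^sub>R partial e2 (partial e2 u) (?R x)"
    unfolding p2
    by (subst partial_scaleR_const[OF smooth_rescale[OF smooth_partial2[OF u]]])
      (simp only: partial_rescale(2)[OF smooth_partial2[OF u]])
  have A1: "of_real (c * \<epsilon>) * partial e1 U x = of_real c * partial e1 u (?R x)"
    using e by (simp add: p1 scaleR_conv_of_real)
  have A2: "of_real (\<epsilon>\<^sup>2) * partial e1 (partial e1 U) x = partial e1 (partial e1 u) (?R x)"
    using e by (simp add: p11 scaleR_conv_of_real power2_eq_square)
  have A3: "of_real (\<epsilon> ^ 4 / 2) * partial e2 (partial e2 U) x = partial e2 (partial e2 u) (?R x)"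
  proof -
    have "\<epsilon> ^ 4 / 2 * (sqrt 2 / \<epsilon>\<^sup>2 * (sqrt 2 / \<epsilon>\<^sup>2)) = 1"
      using e by (simp add: power2_eq_square power4_eq_xxxx)
    then have "(\<epsilon> ^ 4 / 2) *\<^sub>R (sqrt 2 / \<epsilon>\<^sup>2) *\<^sub>R (sqrt 2 / \<epsilon>\<^sup>2) *\<^sub>R z = z" for z :: complex
      by (simp only: scaleR_scaleR scaleR_one)
    then show ?thesis by (simp only: p22 scaleR_conv_of_real)
  qed
  have A4: "\<epsilon>\<^sup>2 * N_resc c u x / 6 = 1 - (cmod (u (?R x)))\<^sup>2"
    using N_resc_eta[OF \<epsilon>] by (simp add: eta_def \<epsilon>_def)
  have "U x = u (?R x)" by (simp add: U_def \<epsilon>_def)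
  then show ?thesis
    using TW[unfolded TW_solution_def, THEN conjunct2, rule_format, of "?R x"]
    unfolding \<epsilon>_def[symmetric] A2 A3 A4 mult.assoc A1 by (simp only: add.assoc)
qed

theorem proposition2:
  fixes u :: "real \<Rightarrow> R2 \<Rightarrow> complex"
    and c :: "real \<Rightarrow> real"
    and \<phi> :: "real \<Rightarrow> R2 \<Rightarrow> real"
    and p :: "nat \<Rightarrow> real"
    and N0 :: "R2 \<Rightarrow> real"
    and \<sigma> :: real
  assumes family: "\<And>\<pp>. \<pp> > 0 \<Longrightarrow> GP_minimizer \<pp> (c \<pp>) (u \<pp>)"
    and phase: "\<And>\<pp>. \<pp> > 0 \<Longrightarrow> (\<forall>x. 1 / 2 \<le> cmod (u \<pp> x) \<and> cmod (u \<pp> x) \<le> 2)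
                  \<Longrightarrow> phase_of (\<phi> \<pp>) (u \<pp>)"
    and p_pos: "\<And>n. p n > 0"
    and p_lim: "p \<longlonglongrightarrow> 0"
    and N0: "ground_state \<sigma> N0"
    and N_conv: "\<And>k q. 1 < q \<Longrightarrow> Wkq_tendsto k q (\<lambda>n. N_resc (c (p n)) (u (p n))) N0"
  shows "\<exists>r :: nat \<Rightarrow> nat. strict_mono r \<and>
           (\<forall>k q. 1 < q \<longrightarrow>
              Wkq_tendsto k q
                (\<lambda>n. partial e1 (Theta_resc (c (p (r n))) (\<phi> (p (r n))))) N0)"
proof -
  define \<epsilon> where "\<epsilon> n = eps (c (p n))" for n
  define N where "N n = N_resc (c (p n)) (u (p n))" for n
  have min: "GP_minimizer (p n) (c (p n)) (u (p n))" for n using family p_pos by blast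
  have TW: "TW_solution (c (p n)) (u (p n))" and c_pos: "0 < c (p n)" and c_lt: "c (p n) < sqrt 2"
    and E: "GL_energy (u (p n)) = E_min (p n)" for n
    using min[of n] by (auto simp: GP_minimizer_def)
  have su: "smooth (u (p n))" for n using TW[of n] by (simp add: TW_solution_def)
  have c2: "(c (p n))\<^sup>2 < 2" for n
    using c_pos[of n] c_lt[of n] power_strict_mono[of "c (p n)" "sqrt 2" 2] by simp
  have \<epsilon>_pos: "\<epsilon> n > 0" for n using c2[of n] by (simp add: \<epsilon>_def eps_def)
  have sN: "smooth_seq N" unfolding smooth_seq_def N_def using su smooth_N_resc by blast
  have convN: "Wkq_tendsto k q N N0" if "1 < q" for k q
    using N_conv[OF that] by (simp add: N_def[abs_def])
  have bN: "jets k (bounded_in q) N" if "1 < q" for k q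
    using less_trans[of 0 1 q] that by (intro Wkq_tendsto_imp_jets_bounded[OF sN _ convN]) auto

  (* The energy of the minimizers tends to zero, and this forces the speed to be transonic. *)
  obtain K where K: "\<And>\<pp>. 0 < \<pp> \<Longrightarrow> \<pp> \<le> 1 \<Longrightarrow> E_min \<pp> \<le> ennreal (K * \<pp>)"
    using E_min_le_linear[OF family[of 1]] by auto
  have "\<forall>\<^sub>F n in sequentially. p n < 1" using order_tendstoD(2)[OF p_lim] by simp
  then have En: "\<forall>\<^sub>F n in sequentially. GL_energy (u (p n)) \<le> ennreal (\<bar>K\<bar> * p n)"
  proof eventually_elim
    case (elim n)
    have "GL_energy (u (p n)) \<le> ennreal (K * p n)" using K[of "p n"] p_pos[of n] elim E by simp
    also have "\<dots> \<le> ennreal (\<bar>K\<bar> * p n)" using p_pos[of n] by (intro ennreal_leI mult_right_mono) auto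
    finally show ?case .
  qed

  have "\<not> (AE x in lebesgue. N0 x = 0)"
    using N0 by (auto simp: ground_state_def nonconstant_ae_def)
  moreover have "(1::ereal) < 2" by simp
  ultimately obtain d where d: "d > 0"
    "\<forall>\<^sub>F n in sequentially. ennreal d \<le> (\<integral>\<^sup>+ x. ennreal ((N n x)\<^sup>2) \<partial>lborel)"
    using L2_lower_bound[OF sN convN] by blast
  have "\<forall>\<^sub>F n in sequentially. \<epsilon> n \<le> 144 / sqrt 2 * \<bar>K\<bar> / d * p n"
    using En d(2)
  proof eventually_elim
    case (elim n)
    have "ennreal (\<epsilon> n * d) = ennreal (\<epsilon> n) * ennreal d"
      using \<epsilon>_pos[of n] d(1) by (simp add: ennreal_mult)
    also have "\<dots> \<le> ennreal (\<epsilon> n) * (\<integral>\<^sup>+ x. ennreal ((N n x)\<^sup>2) \<partial>lborel)"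
      using elim(2) by (intro mult_left_mono) auto
    also have "\<dots> = ennreal (36 / sqrt 2) * (\<integral>\<^sup>+ x. ennreal ((eta (u (p n)) x)\<^sup>2) \<partial>lborel)"
      using nn_integral_N_resc[OF su[of n]] \<epsilon>_pos[of n] by (simp add: \<epsilon>_def N_def)
    also have "\<dots> \<le> ennreal (36 / sqrt 2) * (4 * ennreal (\<bar>K\<bar> * p n))"
      by (intro mult_left_mono order_trans[OF eta_le_energy[OF su[of n]]] elim(1)) simp_all
    also have "\<dots> = ennreal (36 / sqrt 2 * (4 * (\<bar>K\<bar> * p n)))"
    proof -
      have "(0::real) \<le> 36 / sqrt 2" "(0::real) \<le> 4" by simp_all
      then show ?thesis by (simp only: ennreal_mult' ennreal_numeral)
    qed
    finally have "\<epsilon> n * d \<le> 36 / sqrt 2 * (4 * (\<bar>K\<bar> * p n))"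
      using p_pos[of n] by (simp add: ennreal_le_iff)
    then show ?case using d(1) by (simp add: field_simps)
  qed
  moreover have "(\<lambda>n. 144 / sqrt 2 * \<bar>K\<bar> / d * p n) \<longlonglongrightarrow> 0"
    by (rule tendsto_mult_right_zero[OF p_lim])
  ultimately have \<epsilon>_lim: "\<epsilon> \<longlonglongrightarrow> 0"
    using \<epsilon>_pos by (intro tendsto_sandwich[of "\<lambda>_. 0" \<epsilon> sequentially "\<lambda>n. 144 / sqrt 2 * \<bar>K\<bar> / d * p n"])
      (simp_all add: less_imp_le)
  have c_eq: "c (p n) = sqrt (2 - (\<epsilon> n)\<^sup>2)" for n
    using c2[of n] c_pos[of n] by (simp add: \<epsilon>_def eps_def)
  have c_lim: "(\<lambda>n. c (p n)) \<longlonglongrightarrow> sqrt 2"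
    unfolding c_eq using tendsto_real_sqrt[OF tendsto_diff[OF tendsto_const[of 2] tendsto_power[OF \<epsilon>_lim, of 2]]]
    by simp

  (* The modulus tends to one uniformly; from index n0 on it lies between 1/2 and 2. *)
  have "bounded_in \<infinity> N" using bN[of \<infinity> 0] by simp
  then obtain B where B: "B > 0" "\<forall>\<^sub>F n in sequentially. Lq_le \<infinity> B (N n)" by (rule bounded_inE)
  have "(\<lambda>n. (\<epsilon> n)\<^sup>2 * B / 6) \<longlonglongrightarrow> 0"
    using tendsto_mult[OF tendsto_power[OF \<epsilon>_lim, of 2] tendsto_const[of "B / 6"]] by simp
  then have "\<forall>\<^sub>F n in sequentially. (\<epsilon> n)\<^sup>2 * B / 6 < 3 / 4" by (rule order_tendstoD) simp
  with B(2) have "\<forall>\<^sub>F n in sequentially. \<forall>x. \<bar>(\<epsilon> n)\<^sup>2 * N n x / 6\<bar> \<le> 3 / 4"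
  proof eventually_elim
    case (elim n)
    have "\<bar>(\<epsilon> n)\<^sup>2 * N n x / 6\<bar> \<le> (\<epsilon> n)\<^sup>2 * B / 6" for x
      using smooth_seq_uniformD[OF sN elim(1)] by (simp add: abs_mult mult_left_mono)
    then show ?case using elim(2) by (meson less_imp_le order_trans)
  qed
  with En have "\<forall>\<^sub>F n in sequentially. GL_energy (u (p n)) \<le> ennreal (\<bar>K\<bar> * p n) \<and>
      (\<forall>x. \<bar>(\<epsilon> n)\<^sup>2 * N n x / 6\<bar> \<le> 3 / 4)"
    by (rule eventually_conj)
  then obtain n0 where n0: "\<And>n. n \<ge> n0 \<Longrightarrow> GL_energy (u (p n)) \<le> ennreal (\<bar>K\<bar> * p n) \<and>
      (\<forall>x. \<bar>(\<epsilon> n)\<^sup>2 * N n x / 6\<bar> \<le> 3 / 4)"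
    unfolding eventually_sequentially by blast

  (* A suffix r marks the sequences without their first n0 terms; U and \<Phi> exist only for these. *)
  define r where "r n = n + n0" for n
  define \<epsilon>r where "\<epsilon>r n = \<epsilon> (r n)" for n
  define Nr where "Nr n = N (r n)" for n
  define cr where "cr n = c (p (r n))" for n
  define U where "U n x = u (p (r n)) (rescale (\<epsilon>r n) x)" for n x
  define \<Phi> where "\<Phi> n x = \<phi> (p (r n)) (rescale (\<epsilon>r n) x)" for n x
  define M where "M n x = inverse (1 - (\<epsilon>r n)\<^sup>2 * Nr n x / 6)" for n x
  have small: "\<bar>(\<epsilon>r n)\<^sup>2 * Nr n x / 6\<bar> \<le> 3 / 4" for n x
    using n0[of "r n"] by (simp add: r_def \<epsilon>r_def Nr_def)
  have \<epsilon>r_pos: "\<epsilon>r n > 0" for n using \<epsilon>_pos by (simp add: \<epsilon>r_def)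
  have m_pos: "1 - (\<epsilon>r n)\<^sup>2 * Nr n x / 6 \<ge> 1 / 4" for n x
    using small[of n x] by linarith
  have eta_eq: "(\<epsilon>r n)\<^sup>2 * Nr n x / 6 = eta (u (p (r n))) (rescale (\<epsilon>r n) x)" for n x
    using N_resc_eta[of "c (p (r n))"] \<epsilon>r_pos[of n] by (simp add: \<epsilon>r_def Nr_def N_def \<epsilon>_def)
  have eta_small: "\<bar>eta (u (p (r n))) y\<bar> \<le> 3 / 4" for n y
  proof -
    have "rescale (\<epsilon>r n) (\<epsilon>r n * fst y, (\<epsilon>r n)\<^sup>2 / sqrt 2 * snd y) = y"
      using \<epsilon>r_pos[of n] by (simp add: rescale_def)
    then show ?thesis using small[of n "(\<epsilon>r n * fst y, (\<epsilon>r n)\<^sup>2 / sqrt 2 * snd y)"] by (simp add: eta_eq)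
  qed
  have modulus: "1 / 2 \<le> cmod (u (p (r n)) y)" "cmod (u (p (r n)) y) \<le> 2" for n y
  proof -
    have "1 / 4 \<le> (cmod (u (p (r n)) y))\<^sup>2" "(cmod (u (p (r n)) y))\<^sup>2 \<le> 4"
      using eta_small[of n y] unfolding eta_def by linarith+
    then have "(1 / 2)\<^sup>2 \<le> (cmod (u (p (r n)) y))\<^sup>2" "(cmod (u (p (r n)) y))\<^sup>2 \<le> 2\<^sup>2"
      by (simp_all add: power_divide)
    then show "1 / 2 \<le> cmod (u (p (r n)) y)" "cmod (u (p (r n)) y) \<le> 2"
      by (auto intro: power2_le_imp_le)
  qed
  have ph: "phase_of (\<phi> (p (r n))) (u (p (r n)))" for n
    using phase[OF p_pos] modulus by blast
  have s\<phi>: "smooth (\<phi> (p (r n)))" for n using ph[of n] by (simp add: phase_of_def)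
  have sU: "smooth (U n)" for n unfolding U_def[abs_def] by (rule smooth_rescale[OF su])
  have s\<Phi>: "smooth (\<Phi> n)" for n unfolding \<Phi>_def[abs_def] by (rule smooth_rescale[OF s\<phi>])
  have sNr: "smooth_seq Nr" using sN by (simp add: smooth_seq_def Nr_def)
  have sM: "smooth_seq M"
    unfolding smooth_seq_def
  proof
    fix n
    have "smooth (\<lambda>x. 1 - (\<epsilon>r n)\<^sup>2 / 6 * Nr n x)"
      by (intro smooth_diff smooth_cmult smooth_const smooth_seqD[OF sNr])
    then have "smooth (\<lambda>x. 1 - (\<epsilon>r n)\<^sup>2 * Nr n x / 6)" by simp
    moreover have "1 - (\<epsilon>r n)\<^sup>2 * Nr n x / 6 \<noteq> 0" for x using m_pos[of n x] by linarith
    ultimately show "smooth (M n)" unfolding M_def[abs_def] by (rule smooth_inverse)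
  qed
  have cmod_U: "(cmod (U n x))\<^sup>2 = 1 - (\<epsilon>r n)\<^sup>2 * Nr n x / 6" for n x
    unfolding eta_eq by (simp add: eta_def U_def)
  have polar: "U n x = of_real (cmod (U n x)) * exp (\<i> * of_real (\<Phi> n x))" for n x
    using ph[of n] by (simp add: phase_of_def U_def \<Phi>_def)
  have U_eq: "\<i> * of_real (cr n * \<epsilon>r n) * partial e1 (U n) x + of_real ((\<epsilon>r n)\<^sup>2) * partial e1 (partial e1 (U n)) x
        + of_real (\<epsilon>r n ^ 4 / 2) * partial e2 (partial e2 (U n)) x + U n x * of_real ((\<epsilon>r n)\<^sup>2 * Nr n x / 6) = 0" for n x
    using TW_rescaled[OF TW[of "r n"]] \<epsilon>_pos[of "r n"]
    by (simp add: U_def[abs_def] \<epsilon>r_def \<epsilon>_def Nr_def N_def cr_def)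
  have m_pos': "1 - (\<epsilon>r n)\<^sup>2 * Nr n x / 6 > 0" for n x using m_pos[of n x] by linarith
  note eqs = polar_equations[OF sU s\<Phi> smooth_seqD[OF sNr] polar cmod_U m_pos' \<epsilon>r_pos U_eq]

  have \<epsilon>r_lim: "\<epsilon>r \<longlonglongrightarrow> 0"
    using LIMSEQ_ignore_initial_segment[OF \<epsilon>_lim, of n0] by (simp add: \<epsilon>r_def[abs_def] r_def)
  have cr_lim: "cr \<longlonglongrightarrow> sqrt 2"
    using LIMSEQ_ignore_initial_segment[OF c_lim, of n0] by (simp add: cr_def[abs_def] r_def)
  have convNr: "Wkq_tendsto k q Nr N0" if "1 < q" for k q
    using Wkq_tendsto_shift[OF convN[OF that], of _ n0] by (simp add: Nr_def[abs_def] r_def)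
  have bNr: "jets k (bounded_in q) Nr" if "1 < q" for k q
    using less_trans[of 0 1 q] that by (intro Wkq_tendsto_imp_jets_bounded[OF sNr _ convNr]) auto
  have bM: "bounded_in \<infinity> M"
    unfolding bounded_in_def
  proof (intro exI[of _ 4] always_eventually allI)
    fix n
    have "\<bar>M n x\<bar> \<le> 4" for x
    proof -
      have "M n x \<le> inverse (1 / 4)" unfolding M_def by (rule le_imp_inverse_le[OF m_pos]) simp
      moreover have "0 \<le> M n x" using m_pos'[of n x] by (simp add: M_def)
      ultimately show ?thesis by simp
    qed
    then show "Lq_le \<infinity> 4 (M n)" by (simp add: Lq_le_def)
  qed
  have lim0: "(\<lambda>n. 8 * \<epsilon>r n * (\<bar>K\<bar> * p (r n))) \<longlonglongrightarrow> 0"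
  proof -
    have "(\<lambda>n. p (r n)) \<longlonglongrightarrow> 0"
      using LIMSEQ_ignore_initial_segment[OF p_lim, of n0] by (simp add: r_def)
    then have "(\<lambda>n. 8 * \<epsilon>r n * (\<bar>K\<bar> * p (r n))) \<longlonglongrightarrow> 8 * 0 * (\<bar>K\<bar> * 0)"
      by (intro tendsto_intros \<epsilon>r_lim)
    then show ?thesis by simp
  qed
  have null: "null_in 2 F"
    if F: "\<And>n. (\<integral>\<^sup>+ x. ennreal ((F n x)\<^sup>2) \<partial>lborel) \<le> ennreal (8 * \<epsilon>r n) * GL_energy (u (p (r n)))" for F
    unfolding null_in_def Lq_le_2
  proof (intro allI impI)
    fix e :: real assume "e > 0"
    from order_tendstoD(2)[OF lim0 this]
    show "\<forall>\<^sub>F n in sequentially. (\<integral>\<^sup>+ x. ennreal ((F n x)\<^sup>2) \<partial>lborel) \<le> ennreal e"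
    proof eventually_elim
      case (elim n)
      have "(\<integral>\<^sup>+ x. ennreal ((F n x)\<^sup>2) \<partial>lborel) \<le> ennreal (8 * \<epsilon>r n) * ennreal (\<bar>K\<bar> * p (r n))"
        using n0[of "r n"] by (intro order_trans[OF F[of n]] mult_left_mono) (auto simp: r_def)
      also have "\<dots> = ennreal (8 * \<epsilon>r n * (\<bar>K\<bar> * p (r n)))"
        using \<epsilon>r_pos[of n] p_pos[of "r n"] by (simp add: ennreal_mult')
      also have "\<dots> \<le> ennreal e" using elim by (intro ennreal_leI) simp
      finally show ?case .
    qed
  qed
  have null1: "null_in 2 (\<lambda>n. partial e1 (\<Phi> n))" and null2: "null_in 2 (\<lambda>n x. \<epsilon>r n / sqrt 2 * partial e2 (\<Phi> n) x)"
    unfolding \<Phi>_def[abs_def]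
    by (rule null, rule nn_integral_phase_gradient[OF su ph modulus(1) \<epsilon>r_pos])+
  have M_eq: "M n x * (1 - (\<epsilon>r n)\<^sup>2 * Nr n x / 6) = 1" for n x
    using m_pos'[of n x] by (simp add: M_def)
  have s\<Phi>_seq: "smooth_seq \<Phi>" using s\<Phi> by (simp add: smooth_seq_def)
  have cr_pos: "cr n > 0" for n using c_pos by (simp add: cr_def)
  have diff: "jets k (null_in q) (\<lambda>n x. 6 * sqrt 2 / \<epsilon>r n * partial e1 (\<Phi> n) x - Nr n x)" if "1 < q" for k q
    by (rule asymptotics[OF sNr s\<Phi>_seq sM \<epsilon>r_pos \<epsilon>r_lim cr_pos cr_lim bNr bM M_eq null1 null2 _ _ that])
      (use eqs in \<open>simp_all add: M_def[abs_def]\<close>)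
  have Theta: "partial e1 (Theta_resc (c (p (r n))) (\<phi> (p (r n)))) = (\<lambda>x. 6 * sqrt 2 / \<epsilon>r n * partial e1 (\<Phi> n) x)" for n
  proof
    fix x
    have "Theta_resc (c (p (r n))) (\<phi> (p (r n))) = (\<lambda>x. 6 * sqrt 2 / \<epsilon>r n * \<Phi> n x)"
      by (auto simp: Theta_resc_def \<epsilon>r_def \<epsilon>_def \<Phi>_def)
    then show "partial e1 (Theta_resc (c (p (r n))) (\<phi> (p (r n)))) x = 6 * sqrt 2 / \<epsilon>r n * partial e1 (\<Phi> n) x"
      by (simp only: partial_cmult[OF s\<Phi>])
  qed
  have "Wkq_tendsto k q (\<lambda>n. partial e1 (Theta_resc (c (p (r n))) (\<phi> (p (r n))))) N0" if q: "1 < q" for k q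
    unfolding Theta
  proof (rule Wkq_tendsto_perturb[OF sNr _ _ convNr[OF q] diff[OF q]])
    show "0 < q" using less_trans[of 0 1 q] q by simp
    show "smooth_seq (\<lambda>n x. 6 * sqrt 2 / \<epsilon>r n * partial e1 (\<Phi> n) x)"
      unfolding smooth_seq_def by (intro allI smooth_cmult smooth_partial1 s\<Phi>)
  qed
  moreover have "strict_mono r" by (simp add: strict_mono_def r_def)
  ultimately show ?thesis by blast
qed

end
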